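(* Let $\Omega\subset\mathbb{R}^N$ ($N\ge2$) be a bounded domain with Lipschitz boundary. Let $p_1,\dots,p_N:\mathbb{R}\to[2,\infty)$ be continuous with $N<p_i^-:=\operatorname{ess\,inf}_{t}p_i(t)\le p_i(t)\le p_i^+:=\operatorname{ess\,sup}_t p_i(t)<\infty$ for all $t\in\mathbb{R}$, and let $p^-:=\min_ip_i^-$, $p^+:=\max_ip_i^+$. Let $f:\Omega\times\mathbb{R}\to\mathbb{R}$ be a Carathéodory function with $f(\cdot,0)<0$ and $|f(x,t)|\le c(1+|t|^{r-1})$ for all $(x,t)$, for some $c>0$, $1\le r<p^-$. Then for every $\epsilon>0$ the problem $-\sum_{i}\frac{\partial}{\partial x_i}\big(|\frac{\partial u}{\partial x_i}|^{p_i(u)-2}\frac{\partial u}{\partial x_i}\big)-\epsilon\Delta_{p^+}u=f(x,u)$ in $\Omega$, $u=0$ on $\partial\Omega$, admits a non-trivial weak solution, i.e. there is $u\in W^{1,p^+}_0(\Omega)$, $u\not\equiv0$, with $$\sum_{i=1}^N\int_\Omega\Big|\frac{\partial u}{\partial x_i}\Big|^{p_i(u)-2}\frac{\partial u}{\partial x_i}\frac{\partial v}{\partial x_i}dx+\epsilon\int_\Omega|\nabla u|^{p^+-2}\nabla u\cdot\nabla v\,dx=\int_\Omega f(x,u)v\,dx\quad\forall v\in W^{1,p^+}_0(\Omega).$$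
   Context: $\Delta_{p^+}u=\operatorname{div}(|\nabla u|^{p^+-2}\nabla u)$. *)

theory Defs
  imports "HOL-Analysis.Analysis"
begin

definition partial :: "'n::finite \<Rightarrow> (real^'n \<Rightarrow> real) \<Rightarrow> (real^'n \<Rightarrow> real)" where
  "partial i \<phi> = (\<lambda>x. frechet_derivative \<phi> (at x) (axis i 1))"

fun iter_partial :: "'n::finite list \<Rightarrow> (real^'n \<Rightarrow> real) \<Rightarrow> (real^'n \<Rightarrow> real)" where
  "iter_partial [] \<phi> = \<phi>"
| "iter_partial (i # is) \<phi> = partial i (iter_partial is \<phi>)"

definition smooth_fun :: "(real^'n::finite \<Rightarrow> real) \<Rightarrow> bool" where
  "smooth_fun \<phi> \<longleftrightarrow> (\<forall>is x. iter_partial is \<phi> differentiable (at x))"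

definition test_fun :: "(real^'n::finite) set \<Rightarrow> (real^'n \<Rightarrow> real) \<Rightarrow> bool" where
  "test_fun \<Omega> \<phi> \<longleftrightarrow> smooth_fun \<phi> \<and> compact (closure {x. \<phi> x \<noteq> 0}) \<and> closure {x. \<phi> x \<noteq> 0} \<subseteq> \<Omega>"

definition loc_integrable :: "(real^'n::finite) set \<Rightarrow> (real^'n \<Rightarrow> real) \<Rightarrow> bool" where
  "loc_integrable \<Omega> g \<longleftrightarrow> (\<forall>K. compact K \<and> K \<subseteq> \<Omega> \<longrightarrow> integrable (lebesgue_on K) g)"

definition weak_partial :: "(real^'n::finite) set \<Rightarrow> 'n \<Rightarrow> (real^'n \<Rightarrow> real) \<Rightarrow> (real^'n \<Rightarrow> real) \<Rightarrow> bool" where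
  "weak_partial \<Omega> i u g \<longleftrightarrow> loc_integrable \<Omega> u \<and> loc_integrable \<Omega> g \<and>
     (\<forall>\<phi>. test_fun \<Omega> \<phi> \<longrightarrow>
        (\<integral>x. u x * partial i \<phi> x \<partial>lebesgue_on \<Omega>) = - (\<integral>x. g x * \<phi> x \<partial>lebesgue_on \<Omega>))"

definition Lp :: "(real^'n::finite) set \<Rightarrow> real \<Rightarrow> (real^'n \<Rightarrow> real) \<Rightarrow> bool" where
  "Lp \<Omega> p g \<longleftrightarrow> g \<in> borel_measurable (lebesgue_on \<Omega>) \<and> integrable (lebesgue_on \<Omega>) (\<lambda>x. \<bar>g x\<bar> powr p)"

definition sobolev :: "(real^'n::finite) set \<Rightarrow> real \<Rightarrow> (real^'n \<Rightarrow> real) \<Rightarrow> (real^'n \<Rightarrow> real^'n) \<Rightarrow> bool" where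
  "sobolev \<Omega> p u Du \<longleftrightarrow> Lp \<Omega> p u \<and> (\<forall>i. Lp \<Omega> p (\<lambda>x. Du x $ i) \<and> weak_partial \<Omega> i u (\<lambda>x. Du x $ i))"

definition sobolev0 :: "(real^'n::finite) set \<Rightarrow> real \<Rightarrow> (real^'n \<Rightarrow> real) \<Rightarrow> (real^'n \<Rightarrow> real^'n) \<Rightarrow> bool" where
  "sobolev0 \<Omega> p u Du \<longleftrightarrow> sobolev \<Omega> p u Du \<and>
     (\<exists>\<phi>::nat \<Rightarrow> real^'n \<Rightarrow> real. (\<forall>k. test_fun \<Omega> (\<phi> k)) \<and>
        (\<lambda>k. \<integral>x. \<bar>\<phi> k x - u x\<bar> powr p \<partial>lebesgue_on \<Omega>) \<longlonglongrightarrow> 0 \<and>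
        (\<forall>i. (\<lambda>k. \<integral>x. \<bar>partial i (\<phi> k) x - Du x $ i\<bar> powr p \<partial>lebesgue_on \<Omega>) \<longlonglongrightarrow> 0))"

text \<open>Near every boundary point, Omega is (in a ball) the region below the graph of a
  Lipschitz function over the hyperplane orthogonal to some unit direction e.\<close>
definition lipschitz_boundary :: "(real^'n::finite) set \<Rightarrow> bool" where
  "lipschitz_boundary \<Omega> \<longleftrightarrow> (\<forall>z\<in>frontier \<Omega>. \<exists>r>0. \<exists>e L g. norm e = 1 \<and>
      L-lipschitz_on {y. y \<bullet> e = 0} (g :: real^'n \<Rightarrow> real) \<and>
      \<Omega> \<inter> ball z r = {x \<in> ball z r. x \<bullet> e < g (x - (x \<bullet> e) *\<^sub>R e)})"

definition bounded_lipschitz_domain :: "(real^'n::finite) set \<Rightarrow> bool" where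
  "bounded_lipschitz_domain \<Omega> \<longleftrightarrow> open \<Omega> \<and> connected \<Omega> \<and> \<Omega> \<noteq> {} \<and> bounded \<Omega> \<and> lipschitz_boundary \<Omega>"

definition caratheodory :: "(real^'n::finite) set \<Rightarrow> (real^'n \<Rightarrow> real \<Rightarrow> real) \<Rightarrow> bool" where
  "caratheodory \<Omega> f \<longleftrightarrow> (\<forall>t. (\<lambda>x. f x t) \<in> borel_measurable (lebesgue_on \<Omega>)) \<and>
     (AE x in lebesgue_on \<Omega>. continuous_on UNIV (f x))"

end

theory Submission
  imports Defs "HOL-Complex_Analysis.Great_Picard"
begin

text \<open>Write \<open>q\<close> for the largest exponent. Freeze the argument of the exponents and of the right-hand side
  at a bounded measurable function \<open>w\<close>. The frozen problem is the Euler--Lagrange equation of a convex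
  functional whose operator is strongly monotone because of the \<open>\<epsilon>\<close>-term, so its near-minimisers among
  test functions satisfy the equation up to a small error and, by Morrey's inequality (\<open>q > N\<close>), form a
  uniformly Cauchy family; their uniform limit \<open>sol w\<close> depends continuously on \<open>w\<close> under pointwise
  convergence. Since \<open>r < q\<close>, a large ball in the supremum norm is mapped into itself.

  Restricting \<open>w\<close> to functions that are constant on small cells turns \<open>sol\<close> into a continuous self-map of a
  finite-dimensional cube, and Brouwer's theorem gives \<open>w\<close> with \<open>w = sol w\<close> at the centres of the cells.
  As the cells shrink, Arzela--Ascoli provides a uniform limit \<open>u\<close>, strong monotonicity upgrades this to strong
  convergence of the gradients in \<open>L\<^sup>q\<close>, and the equation passes to the limit.

  If \<open>u\<close> vanished, testing with \<open>u\<close> would give a vanishing gradient, and testing with a bump function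
  would contradict \<open>f x 0 < 0\<close>.\<close>

section \<open>Elementary inequalities\<close>

text \<open>The obstacle is that the exponents depend on the unknown: as an operator in
  \<open>u\<close>, the left-hand side is neither monotone nor a gradient. Freezing restores both
  properties, but the fixed point must then be sought in a topology in which the exponents converge.
  Pointwise convergence with a common bound is enough, by dominated convergence.

  Sobolev functions appear only at the very end. Until then every object is a test function, and
  being a solution means having a residual of size at most
  \<open>\<theta> * (1 + energy \<psi>)\<close> for all test functions \<open>\<psi>\<close>. This
  error has the same homogeneity as the coercive term, so it can be absorbed on the left when
  \<open>\<psi>\<close> is a difference of two approximate solutions. Products are split by Young's
  inequality with a free parameter \<open>m\<close>, as in the lemma below, where the two cases
  \<open>b \<le> 1/m\<close> and \<open>b > 1/m\<close> each make one summand sufficient. Taking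
  \<open>m\<close> small or large decides which factor receives the small constant, so neither dual
  norms nor Hoelder's inequality occur.

  Because gradients converge strongly, the nonlinear terms pass to the limit by dominated
  convergence, without a Minty argument.\<close>

lemma le_inverse_plus_powr:
  fixes b m q :: real
  assumes "b \<ge> 0" "m > 0" "q \<ge> 1"
  shows "b \<le> 1/m + m powr (q-1) * b powr q"
proof (cases "b \<le> 1/m")
  case True
  then show ?thesis by (simp add: add_increasing2)
next
  case False
  then have mb: "m * b > 1"
    using assms by (simp add: field_simps)
  then have b: "b > 0"
    using assms by (cases "b = 0") auto
  have "1 \<le> (m * b) powr (q-1)"
    using mb assms by (simp add: ge_one_powr_ge_zero)
  then have "b * 1 \<le> b * (m * b) powr (q-1)"
    using b by (intro mult_left_mono) auto
  also have "\<dots> = m powr (q-1) * b powr q"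
    using b assms by (simp add: powr_mult powr_diff)
  finally show ?thesis
    using assms by (simp add: add_increasing)
qed

text \<open>Young's inequality with a free parameter and constants that are not sharp: on either
  side of the threshold \<open>b = m * h\<close> one summand alone dominates.\<close>

lemma powr_mult_le_weighted:
  fixes h b m q :: real
  assumes "h \<ge> 0" "b \<ge> 0" "m > 0" "q > 1"
  shows "h powr (q-1) * b \<le> m * h powr q + m powr (1-q) * b powr q"
proof (cases "b \<le> m * h")
  case True
  have "h powr (q-1) * b \<le> h powr (q-1) * (m * h)"
    using True by (intro mult_left_mono) auto
  also have "\<dots> = m * h powr q"
    using assms by (cases "h = 0") (auto simp: powr_diff)
  finally show ?thesis by (simp add: add_increasing2)
next
  case False
  moreover have "0 \<le> m * h" using assms by simp
  ultimately have b: "b > 0" by linarith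
  have "h powr (q-1) * b \<le> (b/m) powr (q-1) * b"
    using False assms by (intro mult_right_mono powr_mono2) (auto simp: field_simps)
  also have "\<dots> = m powr (1-q) * b powr q"
    using b assms by (simp add: powr_divide powr_diff field_simps)
  finally show ?thesis using assms by (simp add: add_increasing)
qed

lemma powr_le_one_plus:
  fixes x p q :: real
  assumes "x \<ge> 0" "0 \<le> p" "p \<le> q"
  shows "x powr p \<le> 1 + x powr q"
proof (cases "x \<le> 1")
  case True
  then have "x powr p \<le> 1" using assms by (simp add: powr_le1)
  then show ?thesis by (simp add: add_increasing2)
next
  case False
  then have "x powr p \<le> x powr q" using assms by (simp add: powr_mono)
  then show ?thesis by simp
qed

lemma powr_add_le:
  fixes a b q :: real
  assumes "a \<ge> 0" "b \<ge> 0" "q \<ge> 0"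
  shows "(a + b) powr q \<le> 2 powr q * (a powr q + b powr q)"
proof -
  have "(a + b) powr q \<le> (2 * max a b) powr q"
    using assms by (intro powr_mono2) auto
  also have "\<dots> = 2 powr q * max a b powr q"
    using assms by (simp add: powr_mult)
  also have "\<dots> \<le> 2 powr q * (a powr q + b powr q)"
    by (intro mult_left_mono) (auto simp: max_def)
  finally show ?thesis .
qed

text \<open>Typed over inner product spaces so that the same facts serve the scalar terms with
  exponent \<open>p i (u x)\<close> and the vector field of the \<open>q\<close>-Laplacian. At
  \<open>a = 0\<close> the value is 0 whatever \<open>0 powr (p - 2)\<close> is.\<close>

definition flux :: "real \<Rightarrow> 'a::real_inner \<Rightarrow> 'a" where
  "flux p a = norm a powr (p - 2) *\<^sub>R a"

lemma flux_zero [simp]: "flux p 0 = 0"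
  by (simp add: flux_def)

lemma norm_flux: "norm (flux p a) = norm a powr (p - 1)"
  by (cases "a = 0") (auto simp: flux_def powr_diff power2_eq_square powr_numeral)

lemma flux_inner_self: "flux p a \<bullet> a = norm a powr p"
  by (cases "a = 0") (auto simp: flux_def powr_diff powr_numeral dot_square_norm)

lemma flux_inner_le: "\<bar>flux p a \<bullet> b\<bar> \<le> norm a powr (p - 1) * norm b"
  by (metis Cauchy_Schwarz_ineq2 norm_flux)

text \<open>Convexity of the \<open>p\<close>-th power of the norm divided by \<open>p\<close>,
  whose gradient is \<open>flux p\<close>. After Cauchy-Schwarz it is Young's inequality for the
  conjugate exponents \<open>p'\<close> and \<open>p\<close>.\<close>

lemma norm_powr_tangent:
  fixes a b :: "'a::real_inner"
  assumes "p \<ge> 2"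
  shows "norm a powr p / p + flux p a \<bullet> (b - a) \<le> norm b powr p / p"
proof -
  define p' where "p' = p / (p - 1)"
  have p': "p' > 0" "1 / p' + 1 / p = 1" "(p - 1) * p' = p"
    using assms by (auto simp: p'_def field_simps)
  have "flux p a \<bullet> b \<le> norm a powr (p - 1) * norm b"
    using flux_inner_le[of p a b] by linarith
  also have "\<dots> \<le> (norm a powr (p - 1)) powr p' / p' + norm b powr p / p"
  proof (rule Youngs_inequality)
    show "1 < p'" using assms by (auto simp: p'_def field_simps)
  qed (use p' assms in auto)
  also have "(norm a powr (p - 1)) powr p' = norm a powr p"
    using p' by (simp add: powr_powr)
  finally have "flux p a \<bullet> b \<le> norm a powr p * (1 / p') + norm b powr p / p"
    by simp
  also have "1 / p' = 1 - 1 / p" using p' by simp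
  finally show ?thesis
    by (simp add: inner_diff_right flux_inner_self algebra_simps)
qed

text \<open>The inner product splits into a symmetric part, which carries the squared distance, and
  a product of two differences that have the same sign because powers are increasing.\<close>

lemma flux_strongly_monotone:
  fixes a b :: "'a::real_inner"
  assumes "q \<ge> 2"
  shows "(flux q b - flux q a) \<bullet> (b - a) \<ge> 2 powr (1 - q) * norm (b - a) powr q"
proof -
  define A B where "A = norm a" and "B = norm b"
  define s where "s = q - 2"
  have s: "s \<ge> 0" using assms by (simp add: s_def)
  have pos: "A \<ge> 0" "B \<ge> 0" by (auto simp: A_def B_def)
  have ab: "a \<bullet> a = A\<^sup>2" "b \<bullet> b = B\<^sup>2"
    by (auto simp: A_def B_def dot_square_norm)
  have d2: "(norm (b - a))\<^sup>2 = A\<^sup>2 + B\<^sup>2 - 2 * (a \<bullet> b)"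
    unfolding power2_norm_eq_inner ab[symmetric]
    by (simp add: inner_diff_left inner_diff_right inner_commute)
  have "(flux q b - flux q a) \<bullet> (b - a)
     = B powr s * B\<^sup>2 + A powr s * A\<^sup>2 - (A powr s + B powr s) * (a \<bullet> b)"
    unfolding flux_def A_def[symmetric] B_def[symmetric] s_def[symmetric] ab[symmetric]
    by (simp add: inner_diff_left inner_diff_right inner_commute algebra_simps)
  \<comment> \<open>Expressing \<open>a \<bullet> b\<close> through \<open>A\<close>,
    \<open>B\<close> and the distance isolates the two parts.\<close>
  also have "\<dots> = (A powr s + B powr s) * (norm (b - a))\<^sup>2 / 2
      + (B powr s - A powr s) * (B\<^sup>2 - A\<^sup>2) / 2"
    unfolding d2 by (simp add: field_simps)
  finally have eq: "(flux q b - flux q a) \<bullet> (b - a) = (A powr s + B powr s) * (norm (b - a))\<^sup>2 / 2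
      + (B powr s - A powr s) * (B\<^sup>2 - A\<^sup>2) / 2" .
  have "(B powr s - A powr s) * (B\<^sup>2 - A\<^sup>2) \<ge> 0"
  proof (cases "A \<le> B")
    case True
    then show ?thesis using pos s by (intro mult_nonneg_nonneg) (auto simp: powr_mono2 power_mono)
  next
    case False
    then show ?thesis using pos s by (intro mult_nonpos_nonpos) (auto simp: powr_mono2 power_mono)
  qed
  moreover have "2 powr (1 - q) * norm (b - a) powr q \<le> (A powr s + B powr s) * (norm (b - a))\<^sup>2 / 2"
  proof -
    \<comment> \<open>This raises the exponent 2 to \<open>q\<close>: the factor
      \<open>2 powr (q - 2)\<close> from here and the constant \<open>2 powr (1 - q)\<close> combine
      to the 1/2 of the symmetric part.\<close>
    have n: "norm (b - a) \<le> 2 * max A B"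
      using norm_triangle_ineq4[of b a] by (auto simp: A_def B_def)
    have "2 powr (1 - q) * norm (b - a) powr q = 2 powr (1-q) * (norm (b - a) powr s * (norm (b - a))\<^sup>2)"
      by (cases "a = b") (use assms in \<open>auto simp: s_def powr_diff powr_numeral\<close>)
    also have "\<dots> \<le> 2 powr (1-q) * ((2 * max A B) powr s * (norm (b - a))\<^sup>2)"
      using n s by (intro mult_left_mono mult_right_mono powr_mono2) auto
    also have "\<dots> = (max A B) powr s * (norm (b - a))\<^sup>2 / 2"
      using pos by (simp add: powr_mult s_def powr_diff powr_numeral)
    also have "\<dots> \<le> (A powr s + B powr s) * (norm (b - a))\<^sup>2 / 2"
      by (intro divide_right_mono mult_right_mono) (auto simp: max_def)
    finally show ?thesis .
  qed
  ultimately show ?thesis using eq by linarith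
qed

lemma flux_monotone:
  fixes a b :: "'a::real_inner"
  assumes "q \<ge> 2"
  shows "(flux q b - flux q a) \<bullet> (b - a) \<ge> 0"
  by (rule order_trans[OF _ flux_strongly_monotone[OF assms]]) simp

text \<open>A mean value estimate that survives \<open>s < 1\<close>, where the power is not
  Lipschitz near 0; the extra factor \<open>x\<close> compensates. In terms of
  \<open>z = x / y\<close> it follows from \<open>exp a \<ge> 1 + a\<close> and
  \<open>ln a \<le> a - 1\<close>.\<close>

lemma powr_diff_mult_le:
  fixes x y s :: real
  assumes "0 \<le> x" "x \<le> y" "0 \<le> s"
  shows "(y powr s - x powr s) * x \<le> s * y powr s * (y - x)"
proof (cases "x = 0")
  case True
  then show ?thesis using assms by simp
next
  case False
  define z where "z = x / y"
  have y: "y > 0" and x: "x > 0" using False assms by auto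
  have z: "z > 0" "x = z * y" using x y by (auto simp: z_def)
  have "1 + s * ln z \<le> z powr s"
    using z by (simp add: powr_def)
  then have "1 - z powr s \<le> - (s * ln z)" by linarith
  also have "- ln z \<le> 1 / z - 1"
    using ln_le_minus_one[of "1/z"] z by (simp add: ln_div)
  then have "- (s * ln z) \<le> s * (1 / z - 1)"
    using assms mult_left_mono[of "- ln z" "1/z - 1" s] by simp
  finally have "(1 - z powr s) * z \<le> s * (1 / z - 1) * z"
    using z by (intro mult_right_mono) auto
  also have "\<dots> = s * (1 - z)" using z by (simp add: field_simps)
  finally have "(1 - z powr s) * z * (y powr s * y) \<le> s * (1 - z) * (y powr s * y)"
    using y by (intro mult_right_mono) auto
  then show ?thesis using z y by (simp add: powr_mult algebra_simps)
qed

lemma flux_lipschitz: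
  fixes a b :: "'a::real_inner"
  assumes p: "p \<ge> 2" and M: "norm a \<le> M" "norm b \<le> M"
  shows "norm (flux p b - flux p a) \<le> (p - 1) * M powr (p - 2) * norm (b - a)"
proof -
  have main: "norm (flux p b - flux p a) \<le> (p - 1) * M powr (p - 2) * norm (b - a)"
    if le: "norm a \<le> norm b" and M: "norm b \<le> M" for a b :: 'a
  proof -
    define s where "s = p - 2"
    have s: "s \<ge> 0" using p by (simp add: s_def)
    \<comment> \<open>The difference of powers is paired with the shorter vector \<open>a\<close>,
      which is the form that \<open>powr_diff_mult_le\<close> controls.\<close>
    have "flux p b - flux p a = norm b powr s *\<^sub>R (b - a) + (norm b powr s - norm a powr s) *\<^sub>R a"
      by (simp add: flux_def s_def algebra_simps)
    then have "norm (flux p b - flux p a) \<le> norm b powr s * norm (b - a)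
        + \<bar>norm b powr s - norm a powr s\<bar> * norm a"
      by (metis norm_triangle_ineq norm_scaleR abs_of_nonneg powr_ge_zero)
    also have "\<bar>norm b powr s - norm a powr s\<bar> = norm b powr s - norm a powr s"
      using le s by (simp add: powr_mono2)
    also have "(norm b powr s - norm a powr s) * norm a \<le> s * norm b powr s * (norm b - norm a)"
      by (rule powr_diff_mult_le) (use le s in auto)
    also have "\<dots> \<le> s * norm b powr s * norm (b - a)"
      using s norm_triangle_ineq2[of b a] by (intro mult_left_mono) auto
    also have "norm b powr s * norm (b - a) + s * norm b powr s * norm (b - a)
        = (p - 1) * (norm b powr s * norm (b - a))"
      by (simp add: s_def algebra_simps)
    also have "\<dots> \<le> (p - 1) * (M powr s * norm (b - a))"
      using p M s by (intro mult_left_mono mult_right_mono powr_mono2) auto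
    finally show ?thesis by (simp add: s_def algebra_simps)
  qed
  show ?thesis
  proof (cases "norm a \<le> norm b")
    case True
    then show ?thesis using main M by blast
  next
    case False
    then have "norm (flux p a - flux p b) \<le> (p - 1) * M powr (p - 2) * norm (a - b)"
      using main[of b a] M by simp
    then show ?thesis by (simp add: norm_minus_commute)
  qed
qed

text \<open>The right-hand side contains only \<open>q\<close>: powers with the smaller exponent
  \<open>p\<close> are traded for \<open>1 +\<close> the \<open>q\<close>-th power. Later
  \<open>p\<close> varies from point to point, and the bound has to be integrated.\<close>

lemma flux_increment_le:
  fixes a b :: "'a::real_inner"
  assumes p: "p \<ge> 2" "p \<le> q" and t: "0 \<le> t" "t \<le> 1"
  shows "\<bar>(flux p (a + t *\<^sub>R b) - flux p a) \<bullet> b\<bar>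
     \<le> t * (q - 1) * (1 + 2 powr q * (norm a powr q + norm b powr q))"
proof -
  define M where "M = norm a + norm b"
  have M: "M \<ge> 0" "norm b \<le> M" "norm a \<le> M" by (auto simp: M_def)
  have "norm (a + t *\<^sub>R b) \<le> norm a + t * norm b"
    using norm_triangle_ineq[of a "t *\<^sub>R b"] t by simp
  also have "\<dots> \<le> M" using t by (simp add: M_def mult_left_le_one_le)
  finally have "norm (flux p (a + t *\<^sub>R b) - flux p a)
      \<le> (p - 1) * M powr (p - 2) * norm (a + t *\<^sub>R b - a)"
    by (intro flux_lipschitz) (use p M in auto)
  also have "\<dots> = t * ((p - 1) * M powr (p - 2)) * norm b" using t by simp
  finally have "norm (flux p (a + t *\<^sub>R b) - flux p a) * norm b
     \<le> t * ((p - 1) * M powr (p - 2)) * norm b * norm b"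
    by (intro mult_right_mono) auto
  also have "\<dots> \<le> t * ((p - 1) * M powr (p - 2)) * M * M"
    using t p M by (intro mult_mono) auto
  also have "\<dots> = t * ((p - 1) * M powr p)"
    using M by (cases "M = 0") (auto simp: powr_diff powr_numeral power2_eq_square)
  also have "\<dots> \<le> t * ((q - 1) * (1 + M powr q))"
    using t p M by (intro mult_left_mono mult_mono powr_le_one_plus) auto
  also have "\<dots> \<le> t * ((q - 1) * (1 + 2 powr q * (norm a powr q + norm b powr q)))"
    unfolding M_def using t p by (intro mult_left_mono add_left_mono powr_add_le) auto
  finally show ?thesis
    using Cauchy_Schwarz_ineq2[of "flux p (a + t *\<^sub>R b) - flux p a" b] by (simp add: mult.assoc)
qed

text \<open>Joint continuity in exponent and argument. At the limit 0, where real powers are not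
  jointly continuous, exponents at least 2 give \<open>norm (flux p a) \<le> norm a\<close> once
  \<open>norm a < 1\<close>.\<close>

lemma tendsto_flux:
  fixes a :: "'b \<Rightarrow> 'a::real_inner"
  assumes P: "(P \<longlongrightarrow> p) F" and A: "(a \<longlongrightarrow> l) F" and ge: "\<And>n. P n \<ge> 2"
  shows "((\<lambda>n. flux (P n) (a n)) \<longlongrightarrow> flux p l) F"
proof (cases "l = 0")
  case False
  then show ?thesis
    unfolding flux_def by (intro tendsto_intros P A) auto
next
  case True
  have "((\<lambda>n. norm (a n)) \<longlongrightarrow> 0) F" using A True by (simp add: tendsto_norm_zero)
  then have "\<forall>\<^sub>F n in F. norm (a n) < 1" by (rule order_tendstoD) simp
  then have "\<forall>\<^sub>F n in F. norm (flux (P n) (a n)) \<le> norm (a n)"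
  proof eventually_elim
    case (elim n)
    have "norm (a n) powr (P n - 1) \<le> norm (a n) powr 1"
      using elim ge[of n] powr_mono'[of 1 "P n - 1" "norm (a n)"] by (cases "a n = 0") auto
    then show ?case by (simp add: norm_flux)
  qed
  then have "((\<lambda>n. flux (P n) (a n)) \<longlongrightarrow> 0) F"
    by (rule Lim_null_comparison) fact
  then show ?thesis using True by simp
qed

section \<open>Brouwer's theorem on cubes of varying dimension\<close>

text \<open>The dimension is a number and not a type, since the number of cells grows inside the
  proof. The continuity hypothesis also forces \<open>F\<close> to depend only on the first
  \<open>m\<close> coordinates. The proof uses Kuhn's combinatorial lemma on grids of mesh
  \<open>1 / Suc k\<close>.\<close>

lemma brouwer_nat_cube:
  fixes F :: "(nat \<Rightarrow> real) \<Rightarrow> nat \<Rightarrow> real"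
  assumes range: "\<And>x i. \<forall>j<m. x j \<in> {0..1} \<Longrightarrow> i < m \<Longrightarrow> F x i \<in> {0..1}"
    and cont: "\<And>X x i. (\<And>n::nat. \<forall>j<m. X n j \<in> {0..1}) \<Longrightarrow> \<forall>j<m. (\<lambda>n. X n j) \<longlonglongrightarrow> x j \<Longrightarrow> i < m
       \<Longrightarrow> (\<lambda>n. F (X n) i) \<longlonglongrightarrow> F x i"
  shows "\<exists>x. (\<forall>j<m. x j \<in> {0..1}) \<and> (\<forall>i<m. F x i = x i)"
proof -
  define S :: "nat \<Rightarrow> (nat \<Rightarrow> nat) \<Rightarrow> nat \<Rightarrow> real" where "S = (\<lambda>k x i. real (x i) / real (Suc k))"
  \<comment> \<open>Label 0 records that \<open>F\<close> does not decrease the coordinate. The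
    labels on the faces are those prescribed by Kuhn's lemma; they are truthful because
    \<open>F\<close> maps into the unit cube.\<close>
  define lab where "lab = (\<lambda>k x i. if x i = 0 then (0::nat) else if x i = Suc k then 1
      else if S k x i \<le> F (S k x) i then 0 else 1)"
  have S01: "S k x i \<in> {0..1}" if "x i \<le> Suc k" for k x i
    using that by (auto simp: S_def)
  \<comment> \<open>A grid cell with lower corner \<open>a\<close> which, for each coordinate
    \<open>i\<close>, has a vertex \<open>r i\<close> where \<open>F\<close> does not decrease that
    coordinate and a vertex \<open>s i\<close> where it does not increase it.\<close>
  have ex: "\<exists>a r s. \<forall>i<m. a i < Suc k \<and> (\<forall>j<m. a j \<le> r i j \<and> r i j \<le> a j + 1) \<and>
       (\<forall>j<m. a j \<le> s i j \<and> s i j \<le> a j + 1) \<and>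
       S k (r i) i \<le> F (S k (r i)) i \<and> F (S k (s i)) i \<le> S k (s i) i" for k
  proof -
    obtain a where a: "\<forall>i<m. a i < Suc k"
      and rs: "\<forall>i<m. \<exists>r s. (\<forall>j<m. a j \<le> r j \<and> r j \<le> a j + 1) \<and>
         (\<forall>j<m. a j \<le> s j \<and> s j \<le> a j + 1) \<and> lab k r i \<noteq> lab k s i"
      by (rule kuhn_lemma[of "Suc k" m "lab k"]) (auto simp: lab_def)
    have *: "\<exists>r s. (\<forall>j<m. a j \<le> r j \<and> r j \<le> a j + 1) \<and>
       (\<forall>j<m. a j \<le> s j \<and> s j \<le> a j + 1) \<and>
       S k r i \<le> F (S k r) i \<and> F (S k s) i \<le> S k s i" if i: "i < m" for i
    proof -
      obtain r s where r: "\<forall>j<m. a j \<le> r j \<and> r j \<le> a j + 1"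
        and s: "\<forall>j<m. a j \<le> s j \<and> s j \<le> a j + 1" and ne: "lab k r i \<noteq> lab k s i"
        using rs i by blast
      have r': "\<forall>j<m. r j \<le> Suc k" and s': "\<forall>j<m. s j \<le> Suc k"
        using a r s by (metis Suc_eq_plus1 Suc_leI le_trans Suc_le_mono)+
      have Fr: "F (S k r) i \<in> {0..1}" "F (S k s) i \<in> {0..1}"
        using range[of "S k r" i] range[of "S k s" i] S01 r' s' i by blast+
      have l0: "S k x i \<le> F (S k x) i" if "lab k x i = 0" "F (S k x) i \<in> {0..1}" for x
        using that by (auto simp: lab_def S_def split: if_splits)
      have l1: "F (S k x) i \<le> S k x i" if "lab k x i \<noteq> 0" "F (S k x) i \<in> {0..1}" for x
        using that by (auto simp: lab_def S_def split: if_splits)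
      show ?thesis
      proof (cases "lab k r i = 0")
        case True
        then have "S k r i \<le> F (S k r) i" "F (S k s) i \<le> S k s i"
          using l0[of r] l1[of s] ne Fr by simp_all
        then show ?thesis using r s by blast
      next
        case False
        then have "lab k s i = 0" using ne by (auto simp: lab_def split: if_splits)
        then have "S k s i \<le> F (S k s) i" "F (S k r) i \<le> S k r i"
          using l0[of s] l1[of r] False Fr by simp_all
        then show ?thesis using r s by blast
      qed
    qed
    define P where "P = (\<lambda>i r s. (\<forall>j<m. a j \<le> r j \<and> r j \<le> a j + 1) \<and>
       (\<forall>j<m. a j \<le> s j \<and> s j \<le> a j + 1) \<and>
       S k r i \<le> F (S k r) i \<and> F (S k s) i \<le> S k s i)"
    have "\<forall>i. \<exists>r s. i < m \<longrightarrow> P i r s"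
      using * by (auto simp: P_def)
    then obtain r s where "\<forall>i. i < m \<longrightarrow> P i (r i) (s i)"
      by metis
    then have "\<forall>i<m. a i < Suc k \<and> P i (r i) (s i)"
      using a by blast
    then show ?thesis unfolding P_def by (intro exI[of _ a] exI[of _ r] exI[of _ s])
  qed
  define Q where "Q = (\<lambda>k a r s. \<forall>i<m. a i < Suc k \<and> (\<forall>j<m. a j \<le> r i j \<and> r i j \<le> a j + 1) \<and>
       (\<forall>j<m. a j \<le> s i j \<and> s i j \<le> a j + 1) \<and>
       S k (r i) i \<le> F (S k (r i)) i \<and> F (S k (s i)) i \<le> S k (s i) i)"
  have "\<forall>k. \<exists>a r s. Q k a r s" using ex unfolding Q_def by blast
  then obtain A r s where ars: "\<And>k. Q k (A k) (r k) (s k)"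
    by metis
  have A: "i < m \<Longrightarrow> A k i < Suc k" for k i using ars[of k] by (auto simp: Q_def)
  obtain \<kappa> where \<kappa>: "strict_mono \<kappa>" and conv: "\<And>x. x \<in> {..<m} \<Longrightarrow> \<exists>l. (\<lambda>n. S (\<kappa> n) (A (\<kappa> n)) x) \<longlonglongrightarrow> l"
  proof (rule function_convergent_subsequence[of "{..<m}" "\<lambda>k. S k (A k)" 1])
    fix n x assume "x \<in> {..<m}"
    then show "norm (S n (A n) x) \<le> 1" using S01[of "A n" x n] A[of x n] by auto
  qed auto
  define x where "x = (\<lambda>j. lim (\<lambda>n. S (\<kappa> n) (A (\<kappa> n)) j))"
  have x: "(\<lambda>n. S (\<kappa> n) (A (\<kappa> n)) j) \<longlonglongrightarrow> x j" if "j < m" for j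
    unfolding x_def convergent_LIMSEQ_iff[symmetric] using conv[of j] that by (simp add: convergent_def)
  have \<kappa>inf: "(\<lambda>n. 1 / real (Suc (\<kappa> n))) \<longlonglongrightarrow> 0"
    using LIMSEQ_subseq_LIMSEQ[OF LIMSEQ_inverse_real_of_nat \<kappa>] by (simp add: o_def inverse_eq_divide)
  \<comment> \<open>The cells shrink, so arbitrary vertices of them converge to the limit
    \<open>x\<close> of the corners. Applied to \<open>r\<close> and \<open>s\<close>, this yields
    the two inequalities behind \<open>F x i = x i\<close>.\<close>
  have near: "(\<lambda>n. S (\<kappa> n) (B n) j) \<longlonglongrightarrow> x j"
    if j: "j < m" and B: "\<And>n. A (\<kappa> n) j \<le> B n j \<and> B n j \<le> A (\<kappa> n) j + 1" for B j
  proof (rule tendsto_sandwich[OF _ _ x[OF j]])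
    have "(\<lambda>n. S (\<kappa> n) (A (\<kappa> n)) j + 1 / real (Suc (\<kappa> n))) \<longlonglongrightarrow> x j + 0"
      by (intro tendsto_add x[OF j] \<kappa>inf)
    then show "(\<lambda>n. S (\<kappa> n) (A (\<kappa> n)) j + 1 / real (Suc (\<kappa> n))) \<longlonglongrightarrow> x j" by simp
    show "\<forall>\<^sub>F n in sequentially. S (\<kappa> n) (A (\<kappa> n)) j \<le> S (\<kappa> n) (B n) j"
      using B by (intro always_eventually allI) (auto simp: S_def divide_right_mono)
    show "\<forall>\<^sub>F n in sequentially. S (\<kappa> n) (B n) j \<le> S (\<kappa> n) (A (\<kappa> n)) j + 1 / real (Suc (\<kappa> n))"
    proof (intro always_eventually allI)
      fix n
      have "real (B n j) \<le> real (A (\<kappa> n) j) + 1" using B[of n] by linarith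
      then show "S (\<kappa> n) (B n) j \<le> S (\<kappa> n) (A (\<kappa> n)) j + 1 / real (Suc (\<kappa> n))"
        unfolding S_def by (simp add: divide_right_mono flip: add_divide_distrib)
    qed
  qed
  have x01: "x j \<in> {0..1}" if "j < m" for j
  proof -
    have "S (\<kappa> n) (A (\<kappa> n)) j \<in> {0..1}" for n using S01 A[OF that] less_imp_le by blast
    then show ?thesis using closed_sequentially[OF closed_atLeastAtMost _ x[OF that]] by auto
  qed
  have "F x i = x i" if i: "i < m" for i
  proof (rule antisym)
    have rb: "A (\<kappa> n) j \<le> r (\<kappa> n) i j \<and> r (\<kappa> n) i j \<le> A (\<kappa> n) j + 1"
      and sb: "A (\<kappa> n) j \<le> s (\<kappa> n) i j \<and> s (\<kappa> n) i j \<le> A (\<kappa> n) j + 1" if "j < m" for n j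
      using ars[of "\<kappa> n"] i that unfolding Q_def by blast+
    have up: "b \<le> Suc (\<kappa> n)" if "b \<le> A (\<kappa> n) j + 1" "j < m" for b n j
      using A[of j "\<kappa> n"] that by linarith
    have r01: "\<forall>j<m. S (\<kappa> n) (r (\<kappa> n) i) j \<in> {0..1}" and s01: "\<forall>j<m. S (\<kappa> n) (s (\<kappa> n) i) j \<in> {0..1}" for n
      by (intro allI impI S01 up; use rb sb in blast)+
    have "(\<lambda>n. F (S (\<kappa> n) (r (\<kappa> n) i)) i) \<longlonglongrightarrow> F x i"
      by (rule cont[OF r01 _ i]) (intro allI impI near; use rb in blast)
    moreover have "(\<lambda>n. S (\<kappa> n) (r (\<kappa> n) i) i) \<longlonglongrightarrow> x i" using i by (intro near; use rb in blast)
    moreover have "S (\<kappa> n) (r (\<kappa> n) i) i \<le> F (S (\<kappa> n) (r (\<kappa> n) i)) i" for n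
      using ars[of "\<kappa> n"] i unfolding Q_def by blast
    ultimately show "x i \<le> F x i" by (meson LIMSEQ_le)
    have "(\<lambda>n. F (S (\<kappa> n) (s (\<kappa> n) i)) i) \<longlonglongrightarrow> F x i"
      by (rule cont[OF s01 _ i]) (intro allI impI near; use sb in blast)
    moreover have "(\<lambda>n. S (\<kappa> n) (s (\<kappa> n) i) i) \<longlonglongrightarrow> x i" using i by (intro near; use sb in blast)
    moreover have "F (S (\<kappa> n) (s (\<kappa> n) i)) i \<le> S (\<kappa> n) (s (\<kappa> n) i) i" for n
      using ars[of "\<kappa> n"] i unfolding Q_def by blast
    ultimately show "F x i \<le> x i" by (meson LIMSEQ_le)
  qed
  then show ?thesis using x01 by blast
qed

section \<open>Test functions\<close>

definition grad :: "(real^'n::finite \<Rightarrow> real) \<Rightarrow> real^'n \<Rightarrow> real^'n" where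
  "grad \<phi> x = (\<chi> i. partial i \<phi> x)"

lemma grad_nth [simp]: "grad \<phi> x $ i = partial i \<phi> x"
  by (simp add: grad_def)

lemma partial_eqI: "(\<phi> has_derivative D) (at x) \<Longrightarrow> partial i \<phi> x = D (axis i 1)"
  by (simp add: partial_def frechet_derivative_at[symmetric])

lemma has_derivative_grad:
  assumes "\<phi> differentiable (at x)"
  shows "(\<phi> has_derivative (\<lambda>h. grad \<phi> x \<bullet> h)) (at x)"
proof -
  let ?D = "frechet_derivative \<phi> (at x)"
  have D: "(\<phi> has_derivative ?D) (at x)"
    using assms frechet_derivative_works by blast
  interpret D: linear ?D using D has_derivative_linear by blast
  have "?D h = grad \<phi> x \<bullet> h" for h
  proof -
    have "h = (\<Sum>i\<in>UNIV. h $ i *\<^sub>R axis i 1)"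
      by (simp add: vec_eq_iff axis_def if_distrib cong: if_cong)
    then have "?D h = ?D (\<Sum>i\<in>UNIV. h $ i *\<^sub>R axis i 1)" by simp
    also have "\<dots> = (\<Sum>i\<in>UNIV. h $ i * ?D (axis i 1))"
      by (simp add: D.sum D.scaleR)
    also have "\<dots> = grad \<phi> x \<bullet> h"
      by (simp add: inner_vec_def partial_def mult.commute)
    finally show ?thesis .
  qed
  then show ?thesis using D by (metis (no_types, lifting) has_derivative_eq_rhs ext)
qed

lemma partial_lincomb:
  assumes "\<phi> differentiable (at x)" "\<psi> differentiable (at x)"
  shows "partial i (\<lambda>x. a * \<phi> x + b * \<psi> x) x = a * partial i \<phi> x + b * partial i \<psi> x"
    and "(\<lambda>x. a * \<phi> x + b * \<psi> x) differentiable (at x)"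
proof -
  have "((\<lambda>x. a * \<phi> x + b * \<psi> x) has_derivative
      (\<lambda>h. a * (grad \<phi> x \<bullet> h) + b * (grad \<psi> x \<bullet> h))) (at x)"
    by (intro derivative_intros has_derivative_grad assms)
  from partial_eqI[OF this, of i] this
  show "partial i (\<lambda>x. a * \<phi> x + b * \<psi> x) x = a * partial i \<phi> x + b * partial i \<psi> x"
    and "(\<lambda>x. a * \<phi> x + b * \<psi> x) differentiable (at x)"
    by (auto simp: inner_axis differentiable_def)
qed

lemma smooth_fun_differentiable: "smooth_fun \<phi> \<Longrightarrow> \<phi> differentiable (at x)"
  unfolding smooth_fun_def by (metis iter_partial.simps(1))

lemma iter_partial_partial: "iter_partial is (partial i \<phi>) = iter_partial (is @ [i]) \<phi>"
  by (induction "is") auto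

lemma smooth_fun_partial: "smooth_fun \<phi> \<Longrightarrow> smooth_fun (partial i \<phi>)"
  by (simp add: smooth_fun_def iter_partial_partial)

lemma smooth_fun_lincomb:
  assumes "smooth_fun \<phi>" "smooth_fun \<psi>"
  shows "smooth_fun (\<lambda>x. a * \<phi> x + b * \<psi> x)"
proof -
  have "iter_partial is (\<lambda>x. a * \<phi> x + b * \<psi> x)
      = (\<lambda>x. a * iter_partial is \<phi> x + b * iter_partial is \<psi> x)" for "is"
  proof (induction "is")
    case (Cons i "is")
    show ?case
      using assms by (auto simp: Cons smooth_fun_def intro!: partial_lincomb(1))
  qed simp
  then show ?thesis
    using assms by (auto simp: smooth_fun_def intro!: partial_lincomb(2))
qed

lemma smooth_fun_has_derivative:
  "smooth_fun \<phi> \<Longrightarrow> (\<phi> has_derivative (\<lambda>h. grad \<phi> x \<bullet> h)) (at x)"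
  by (intro has_derivative_grad smooth_fun_differentiable)

lemma smooth_fun_continuous: "smooth_fun \<phi> \<Longrightarrow> continuous_on S \<phi>"
  by (meson differentiable_imp_continuous_within continuous_at_imp_continuous_on
      smooth_fun_differentiable)

lemma smooth_fun_continuous_grad: "smooth_fun \<phi> \<Longrightarrow> continuous_on S (grad \<phi>)"
  unfolding grad_def
  by (intro continuous_on_vec_lambda smooth_fun_continuous smooth_fun_partial)

lemma test_fun_smooth: "test_fun \<Omega> \<phi> \<Longrightarrow> smooth_fun \<phi>"
  by (simp add: test_fun_def)

lemma test_fun_lincomb:
  assumes "test_fun \<Omega> \<phi>" "test_fun \<Omega> \<psi>"
  shows "test_fun \<Omega> (\<lambda>x. a * \<phi> x + b * \<psi> x)"
proof -
  let ?S = "\<lambda>f :: real^'a \<Rightarrow> real. closure {x. f x \<noteq> 0}"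
  have sub: "?S (\<lambda>x. a * \<phi> x + b * \<psi> x) \<subseteq> ?S \<phi> \<union> ?S \<psi>"
    unfolding closure_Un[symmetric] by (rule closure_mono) auto
  have "compact ((?S \<phi> \<union> ?S \<psi>) \<inter> ?S (\<lambda>x. a * \<phi> x + b * \<psi> x))"
    using assms by (intro compact_Int_closed compact_Un closed_closure) (auto simp: test_fun_def)
  then have "compact (?S (\<lambda>x. a * \<phi> x + b * \<psi> x))"
    unfolding Int_absorb1[OF sub] .
  then show ?thesis
    using assms sub smooth_fun_lincomb by (auto simp: test_fun_def)
qed

lemma test_fun_diff: "test_fun \<Omega> \<phi> \<Longrightarrow> test_fun \<Omega> \<psi> \<Longrightarrow> test_fun \<Omega> (\<lambda>x. \<phi> x - \<psi> x)"
  using test_fun_lincomb[of \<Omega> \<phi> \<psi> 1 "-1"] by simp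

lemma test_fun_scale: "test_fun \<Omega> \<phi> \<Longrightarrow> test_fun \<Omega> (\<lambda>x. a * \<phi> x)"
  using test_fun_lincomb[of \<Omega> \<phi> \<phi> a 0] by simp

lemma test_fun_add_scale:
  "test_fun \<Omega> \<phi> \<Longrightarrow> test_fun \<Omega> \<psi> \<Longrightarrow> test_fun \<Omega> (\<lambda>x. \<phi> x + t * \<psi> x)"
  using test_fun_lincomb[of \<Omega> \<phi> \<psi> 1 t] by simp

lemma test_fun_zero [simp]: "test_fun \<Omega> (\<lambda>x. 0)"
proof -
  have p: "partial i (\<lambda>x. 0) = (\<lambda>x. 0)" for i :: 'a
    by (auto intro!: ext partial_eqI[where D = "\<lambda>h. 0"])
  have "iter_partial is (\<lambda>x. 0) = (\<lambda>x. 0)" for "is" :: "'a list"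
    by (induction "is") (auto simp: p)
  then show ?thesis by (simp add: test_fun_def smooth_fun_def)
qed

lemma grad_lincomb:
  assumes "smooth_fun \<phi>" "smooth_fun \<psi>"
  shows "grad (\<lambda>x. a * \<phi> x + b * \<psi> x) x = a *\<^sub>R grad \<phi> x + b *\<^sub>R grad \<psi> x"
  by (simp add: vec_eq_iff partial_lincomb smooth_fun_differentiable assms)

lemma grad_diff:
  assumes "smooth_fun \<phi>" "smooth_fun \<psi>"
  shows "grad (\<lambda>x. \<phi> x - \<psi> x) x = grad \<phi> x - grad \<psi> x"
  using grad_lincomb[OF assms, of 1 "-1" x] by simp

lemma grad_add_scale:
  assumes "smooth_fun \<phi>" "smooth_fun \<psi>"
  shows "grad (\<lambda>x. \<phi> x + t * \<psi> x) x = grad \<phi> x + t *\<^sub>R grad \<psi> x"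
  using grad_lincomb[OF assms, of 1 t x] by simp

lemma grad_scale:
  assumes "smooth_fun \<phi>"
  shows "grad (\<lambda>x. a * \<phi> x) x = a *\<^sub>R grad \<phi> x"
  using grad_lincomb[OF assms assms, of a 0 x] by simp

lemma grad_zero [simp]: "grad (\<lambda>x. 0) x = 0"
  by (auto simp: vec_eq_iff intro!: partial_eqI[where D = "\<lambda>h. 0"])

text \<open>The complement of the closed support is open, so \<open>\<phi>\<close> vanishes in a
  neighbourhood of \<open>x\<close>.\<close>

lemma grad_outside_support:
  assumes "smooth_fun \<phi>" "x \<notin> closure {x. \<phi> x \<noteq> 0}"
  shows "grad \<phi> x = 0"
proof -
  let ?U = "- closure {x. \<phi> x \<noteq> 0}"
  have zero: "0 = \<phi> y" if "y \<in> ?U" for y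
    using that closure_subset[of "{x. \<phi> x \<noteq> 0}"] by auto
  have "(\<phi> has_derivative (\<lambda>h. 0)) (at x)"
    by (rule has_derivative_transform_within_open[of "\<lambda>x. 0" _ _ _ ?U, OF _ _ _ zero])
       (use assms in auto)
  then show ?thesis by (simp add: vec_eq_iff partial_eqI)
qed

lemma test_fun_outside:
  assumes "test_fun \<Omega> \<phi>" "x \<notin> \<Omega>"
  shows "\<phi> x = 0" "grad \<phi> x = 0"
proof -
  have "x \<notin> closure {x. \<phi> x \<noteq> 0}" using assms by (auto simp: test_fun_def)
  then show "\<phi> x = 0" "grad \<phi> x = 0"
    using grad_outside_support[OF test_fun_smooth[OF assms(1)]] closure_subset[of "{x. \<phi> x \<noteq> 0}"] by auto
qed

lemma test_fun_compact_support:
  assumes "test_fun \<Omega> \<phi>"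
  obtains K where "compact K" "K \<subseteq> \<Omega>" "\<And>x. x \<notin> K \<Longrightarrow> \<phi> x = 0" "\<And>x. x \<notin> K \<Longrightarrow> grad \<phi> x = 0"
proof
  let ?K = "closure {x. \<phi> x \<noteq> 0}"
  show "compact ?K" "?K \<subseteq> \<Omega>" using assms by (auto simp: test_fun_def)
  show "\<phi> x = 0" if "x \<notin> ?K" for x using that closure_subset[of "{x. \<phi> x \<noteq> 0}"] by auto
  show "grad \<phi> x = 0" if "x \<notin> ?K" for x
    using that grad_outside_support[OF test_fun_smooth[OF assms]] by blast
qed

lemma test_fun_bounded:
  assumes "test_fun \<Omega> \<phi>"
  obtains B where "B > 0" "\<And>x. \<bar>\<phi> x\<bar> \<le> B" "\<And>x. norm (grad \<phi> x) \<le> B"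
proof -
  obtain K where K: "compact K" "\<And>x. x \<notin> K \<Longrightarrow> \<phi> x = 0" "\<And>x. x \<notin> K \<Longrightarrow> grad \<phi> x = 0"
    using test_fun_compact_support[OF assms] by metis
  have "bounded (\<phi> ` K)" "bounded (grad \<phi> ` K)"
    using K(1) test_fun_smooth[OF assms]
    by (intro compact_imp_bounded compact_continuous_image smooth_fun_continuous
        smooth_fun_continuous_grad; simp)+
  then obtain B1 B2 where B: "\<And>x. x \<in> K \<Longrightarrow> \<bar>\<phi> x\<bar> \<le> B1" "\<And>x. x \<in> K \<Longrightarrow> norm (grad \<phi> x) \<le> B2"
    unfolding bounded_iff by auto
  show ?thesis
  proof (rule that[of "max 1 (max B1 B2)"])
    fix x
    show "\<bar>\<phi> x\<bar> \<le> max 1 (max B1 B2)" "norm (grad \<phi> x) \<le> max 1 (max B1 B2)"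
      using B[of x] K(2,3)[of x] by (cases "x \<in> K"; force)+
  qed simp
qed

section \<open>Bump functions\<close>

text \<open>The classical flat function \<open>exp (-1/s)\<close>, with the powers of
  \<open>1/s\<close> produced by differentiation included as a parameter: the family is closed under
  derivatives up to linear combinations.\<close>

definition flat :: "nat \<Rightarrow> real \<Rightarrow> real" where
  "flat k s = (if s > 0 then exp (- 1 / s) / s ^ k else 0)"

text \<open>With \<open>1/s\<close> as variable, the limit from the right is that of a power divided
  by the exponential at infinity.\<close>

lemma flat_tendsto_0: "(flat k \<longlongrightarrow> 0) (at 0)"
proof (rule filterlim_split_at)
  show "(flat k \<longlongrightarrow> 0) (at_left 0)"
    by (rule tendsto_eventually) (auto simp: eventually_at_filter flat_def)
  have "((\<lambda>s::real. inverse s ^ k / exp (inverse s)) \<longlongrightarrow> 0) (at_right 0)"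
    by (rule filterlim_compose[OF tendsto_power_div_exp_0 filterlim_inverse_at_top_right])
  moreover have "\<forall>\<^sub>F s in at_right 0. inverse s ^ k / exp (inverse s) = flat k s"
    by (auto simp: eventually_at_filter flat_def exp_minus field_simps)
  ultimately show "(flat k \<longlongrightarrow> 0) (at_right 0)"
    by (rule Lim_transform_eventually)
qed

lemma flat_deriv: "(flat k has_real_derivative flat (k + 2) s - k * flat (k + 1) s) (at s)"
proof -
  consider "s > 0" | "s < 0" | "s = 0" by linarith
  then show ?thesis
  proof cases
    case 1
    have "((\<lambda>s. exp (- 1 / s) / s ^ k) has_real_derivative flat (k + 2) s - k * flat (k + 1) s) (at s)"
    proof (cases k)
      case 0
      then show ?thesis using 1
        by (auto intro!: derivative_eq_intros simp: flat_def power2_eq_square)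
    next
      \<comment> \<open>The power rule lowers the exponent of \<open>s ^ k\<close>, hence the
        separate treatment of \<open>k = 0\<close>.\<close>
      case (Suc j)
      show ?thesis using 1
        by (auto intro!: derivative_eq_intros simp: flat_def Suc power2_eq_square field_simps)
           (cases j; simp)
    qed
    then show ?thesis
      by (rule has_field_derivative_transform_within_open[where S = "{0<..}"])
         (use 1 in \<open>auto simp: flat_def\<close>)
  next
    case 2
    have "((\<lambda>s. 0) has_real_derivative flat (k + 2) s - k * flat (k + 1) s) (at s)"
      using 2 by (simp add: flat_def)
    then show ?thesis
      by (rule has_field_derivative_transform_within_open[where S = "{..<0}"])
         (use 2 in \<open>auto simp: flat_def\<close>)
  next
    case 3
    \<comment> \<open>At the origin the difference quotient of \<open>flat k\<close> is
      \<open>flat (Suc k)\<close>, which tends to 0.\<close>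
    have "((\<lambda>h. (flat k (0 + h) - flat k 0) / h) \<longlongrightarrow> 0) (at 0)"
    proof (rule Lim_transform_eventually[OF flat_tendsto_0[of "Suc k"]])
      show "\<forall>\<^sub>F h in at 0. flat (Suc k) h = (flat k (0 + h) - flat k 0) / h"
        by (rule eventually_at_filter[THEN iffD2]) (auto simp: flat_def)
    qed
    then show ?thesis using 3 by (simp add: flat_def DERIV_def)
  qed
qed

text \<open>An algebra of functions that contains the bumps and is closed under partial derivatives.\<close>
inductive flat_algebra :: "(real^'n::finite \<Rightarrow> real) \<Rightarrow> bool" where
  const: "flat_algebra (\<lambda>x. c)"
| coord: "flat_algebra (\<lambda>x. x $ i)"
| add: "flat_algebra g \<Longrightarrow> flat_algebra h \<Longrightarrow> flat_algebra (\<lambda>x. g x + h x)"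
| mult: "flat_algebra g \<Longrightarrow> flat_algebra h \<Longrightarrow> flat_algebra (\<lambda>x. g x * h x)"
| comp: "flat_algebra g \<Longrightarrow> flat_algebra (\<lambda>x. flat k (g x))"

text \<open>Both claims run through one induction, because the formula for the partial derivative of
  a sum, product or composition already needs differentiability of the parts. Iterating it gives
  smoothness without any explicit formula for higher derivatives.\<close>

lemma flat_algebra_partial:
  assumes "flat_algebra g"
  shows "(\<forall>x. g differentiable (at x)) \<and> (\<forall>i. flat_algebra (partial i g))"
  using assms
proof (induction rule: flat_algebra.induct)
  case (const c)
  have "partial i (\<lambda>x. c) = (\<lambda>x. 0)" for i :: 'a
    by (auto intro!: ext partial_eqI[where D = "\<lambda>h. 0"])
  then show ?case by (simp add: flat_algebra.const)
next
  case (coord j)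
  have D: "((\<lambda>x. x $ j) has_derivative (\<lambda>h. h $ j)) (at x)" for x :: "real^'a"
    by (rule bounded_linear_imp_has_derivative[OF bounded_linear_vec_nth])
  have "partial i (\<lambda>x. x $ j) = (\<lambda>x. axis i 1 $ j)" for i :: 'a
    by (auto intro!: ext partial_eqI[OF D])
  then show ?case using D by (auto simp: flat_algebra.const differentiable_def)
next
  case (add g h)
  have D: "((\<lambda>x. g x + h x) has_derivative (\<lambda>y. grad g x \<bullet> y + grad h x \<bullet> y)) (at x)" for x
    using add by (intro derivative_intros has_derivative_grad) auto
  have "partial i (\<lambda>x. g x + h x) = (\<lambda>x. partial i g x + partial i h x)" for i
    using partial_eqI[OF D, of i] by (auto simp: inner_axis)
  then show ?case using D add by (auto simp: differentiable_def intro!: flat_algebra.add)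
next
  case (mult g h)
  have D: "((\<lambda>x. g x * h x) has_derivative (\<lambda>y. g x * (grad h x \<bullet> y) + (grad g x \<bullet> y) * h x)) (at x)" for x
    using mult by (intro derivative_intros has_derivative_grad) auto
  have "partial i (\<lambda>x. g x * h x) = (\<lambda>x. g x * partial i h x + partial i g x * h x)" for i
    using partial_eqI[OF D, of i] by (auto simp: inner_axis)
  then show ?case using D mult
    by (auto simp: differentiable_def intro!: flat_algebra.add flat_algebra.mult)
next
  case (comp g k)
  have D: "((\<lambda>x. flat k (g x)) has_derivative
       (\<lambda>y. (grad g x \<bullet> y) * (flat (k + 2) (g x) - k * flat (k + 1) (g x)))) (at x)" for x
    using comp by (intro DERIV_compose_FDERIV[OF flat_deriv] has_derivative_grad) auto
  have "partial i (\<lambda>x. flat k (g x))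
     = (\<lambda>x. partial i g x * (flat (k + 2) (g x) + (- real k) * flat (k + 1) (g x)))" for i
    using partial_eqI[OF D, of i] by (auto simp: inner_axis)
  moreover have "flat_algebra (\<lambda>x. partial i g x * (flat (k + 2) (g x) + (- real k) * flat (k + 1) (g x)))" for i
    using comp by (intro flat_algebra.intros) auto
  ultimately show ?case using D by (auto simp only: differentiable_def)
qed

lemma flat_algebra_smooth:
  assumes "flat_algebra g"
  shows "smooth_fun g"
proof -
  have "flat_algebra (iter_partial is g)" for "is"
    using assms flat_algebra_partial by (induction "is") auto
  then show ?thesis
    using flat_algebra_partial by (auto simp: smooth_fun_def)
qed

lemma exists_bump:
  assumes "open \<Omega>" "\<Omega> \<noteq> {}"
  obtains \<phi> a \<rho> where "test_fun \<Omega> \<phi>" "\<And>x. \<phi> x \<ge> 0" "\<rho> > 0" "ball a \<rho> \<subseteq> \<Omega>"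
    "\<And>x. x \<in> ball a \<rho> \<Longrightarrow> \<phi> x > 0"
proof -
  obtain a where "a \<in> \<Omega>" using assms by blast
  then obtain \<rho> where \<rho>: "\<rho> > 0" "cball a \<rho> \<subseteq> \<Omega>" using assms open_contains_cball by blast
  \<comment> \<open>The polynomial \<open>\<rho>\<^sup>2 - (dist a x)\<^sup>2\<close>, spelled out
    with sums and products only so that the introduction rules of \<open>flat_algebra\<close>
    apply.\<close>
  define g where "g x = \<rho>\<^sup>2 + (\<Sum>j\<in>UNIV. (-1) * ((x $ j + - (a $ j)) * (x $ j + - (a $ j))))" for x
  define \<phi> where "\<phi> x = flat 0 (g x)" for x
  have g_eq: "g x = \<rho>\<^sup>2 - (dist a x)\<^sup>2" for x
    by (simp add: g_def dist_norm norm_minus_commute[of a x] power2_norm_eq_inner inner_vec_def sum_negf)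
  have alg_sum: "flat_algebra (\<lambda>x. \<Sum>j\<in>J. h j x)" if "\<And>j. flat_algebra (h j)"
    for J :: "'a set" and h :: "'a \<Rightarrow> real^'a \<Rightarrow> real"
  proof -
    have "finite J" by simp
    then show ?thesis
      by (induction J) (auto intro!: flat_algebra.intros that)
  qed
  have "flat_algebra \<phi>"
    unfolding \<phi>_def g_def by (intro flat_algebra.intros alg_sum)
  then have smooth: "smooth_fun \<phi>" by (rule flat_algebra_smooth)
  have pos: "\<phi> x > 0 \<longleftrightarrow> x \<in> ball a \<rho>" for x
  proof -
    have "0 < g x \<longleftrightarrow> dist a x < \<rho>"
      unfolding g_eq using \<rho>(1) by (metis diff_gt_0_iff_gt abs_le_square_iff abs_of_pos abs_of_nonneg not_le zero_le_dist)
    then show ?thesis by (simp add: \<phi>_def flat_def)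
  qed
  have nonneg: "\<phi> x \<ge> 0" for x by (simp add: \<phi>_def flat_def)
  have "{x. \<phi> x \<noteq> 0} = ball a \<rho>"
    using pos nonneg by (auto simp: order_less_le)
  then have "closure {x. \<phi> x \<noteq> 0} \<subseteq> cball a \<rho>" "compact (closure {x. \<phi> x \<noteq> 0})"
    by (auto simp: closure_minimal compact_closure bounded_ball)
  then have "test_fun \<Omega> \<phi>"
    using smooth \<rho> by (auto simp: test_fun_def)
  then show ?thesis
    using that[of \<phi> \<rho> a] nonneg pos \<rho> ball_subset_cball by blast
qed

section \<open>Integration by parts\<close>

lemma integrable_lborel_compact_support:
  fixes F :: "real^'n::finite \<Rightarrow> real"
  assumes "continuous_on UNIV F" "compact K" "\<And>x. x \<notin> K \<Longrightarrow> F x = 0"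
  shows "integrable lborel F"
proof -
  have "integrable lborel (\<lambda>x. indicator K x *\<^sub>R F x)"
    using assms by (intro borel_integrable_compact) (auto intro: continuous_on_subset)
  also have "(\<lambda>x. indicator K x *\<^sub>R F x) = F"
    using assms(3) by (auto simp: fun_eq_iff indicator_def of_bool_def)
  finally show ?thesis .
qed

text \<open>For functions that vanish off the domain, such as test functions and their gradients,
  integrals may be moved to the whole space, where translations and affine substitutions are
  available.\<close>

lemma integral_lebesgue_on_eq_lborel:
  fixes F :: "real^'n::finite \<Rightarrow> real"
  assumes "\<Omega> \<in> sets lebesgue" "F \<in> borel_measurable borel" "\<And>x. x \<notin> \<Omega> \<Longrightarrow> F x = 0"
  shows "integral\<^sup>L (lebesgue_on \<Omega>) F = integral\<^sup>L lborel F"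
    and "integrable (lebesgue_on \<Omega>) F \<longleftrightarrow> integrable lborel F"
proof -
  have eq: "(\<lambda>x. indicator \<Omega> x * F x) = F"
    using assms(3) by (auto simp: fun_eq_iff indicator_def of_bool_def)
  show "integral\<^sup>L (lebesgue_on \<Omega>) F = integral\<^sup>L lborel F"
    using assms(1,2) by (subst integral_restrict_space) (auto simp add: eq integral_completion)
  show "integrable (lebesgue_on \<Omega>) F \<longleftrightarrow> integrable lborel F"
    using assms(1,2) by (subst integrable_restrict_space) (auto simp: eq integrable_completion)
qed

text \<open>Difference quotients have integral zero by translation invariance, and they converge to
  the partial derivative under a common compactly supported bound.\<close>

lemma integral_partial_eq_0:
  fixes F :: "real^'n::finite \<Rightarrow> real" and G :: "real^'n \<Rightarrow> real^'n"
  assumes D: "\<And>x. (F has_derivative (\<lambda>h. G x \<bullet> h)) (at x)" and G: "continuous_on UNIV G"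
    and K: "compact K" "\<And>x. x \<notin> K \<Longrightarrow> F x = 0" "\<And>x. x \<notin> K \<Longrightarrow> G x = 0"
  shows "(\<integral>x. G x $ i \<partial>lborel) = 0"
proof -
  let ?e = "axis i 1 :: real^'n"
  have F: "continuous_on UNIV F"
    using D by (meson continuous_at_imp_continuous_on has_derivative_continuous)
  have "bounded (G ` K)"
    using K G by (intro compact_imp_bounded compact_continuous_image) (auto intro: continuous_on_subset)
  then obtain B0 where B0: "\<And>x. x \<in> K \<Longrightarrow> norm (G x) \<le> B0" by (auto simp: bounded_iff)
  define B where "B = max 0 B0"
  have B: "norm (G x) \<le> B" for x
    using B0[of x] K(3)[of x] by (cases "x \<in> K") (auto simp: B_def)
  have lip: "\<bar>F x - F y\<bar> \<le> B * norm (x - y)" for x y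
  proof -
    have "onorm (\<lambda>h. G x \<bullet> h) \<le> B" for x
    proof (rule onorm_bound)
      show "0 \<le> B" by (simp add: B_def)
      fix h
      have "\<bar>G x \<bullet> h\<bar> \<le> norm (G x) * norm h" by (rule Cauchy_Schwarz_ineq2)
      also have "\<dots> \<le> B * norm h" using B by (intro mult_right_mono) auto
      finally show "norm (G x \<bullet> h) \<le> B * norm h" by simp
    qed
    then show ?thesis
      using differentiable_bound[of UNIV F "\<lambda>x h. G x \<bullet> h" B x y] D by simp
  qed
  define t where "t n = inverse (real (Suc n))" for n
  have t: "t n > 0" "t n \<le> 1" for n by (auto simp: t_def divide_simps)
  have t0: "t \<longlonglongrightarrow> 0" unfolding t_def by (rule LIMSEQ_inverse_real_of_nat)
  define q where "q n x = (F (x + t n *\<^sub>R ?e) - F x) / t n" for n x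
  \<comment> \<open>Contains the supports of all difference quotients at once, since the steps
    \<open>t n\<close> are at most 1.\<close>
  define K' where "K' = {x - y |x y. x \<in> K \<and> y \<in> cball 0 1}"
  have K': "compact K'"
    unfolding K'_def using K(1) by (intro compact_differences compact_cball)
  have "K \<subseteq> K'"
    unfolding K'_def by force
  have qK: "q n x = 0" if "x \<notin> K'" for n x
  proof -
    have "x + t n *\<^sub>R ?e \<notin> K"
    proof
      assume a: "x + t n *\<^sub>R ?e \<in> K"
      have "x = (x + t n *\<^sub>R ?e) - t n *\<^sub>R ?e" by simp
      moreover have "t n *\<^sub>R ?e \<in> cball 0 1" using t[of n] by simp
      ultimately have "x \<in> K'" unfolding K'_def using a by blast
      then show False using that by blast
    qed
    then show ?thesis using K(2) that \<open>K \<subseteq> K'\<close> by (auto simp: q_def)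
  qed
  have int_F: "integrable lborel F"
    by (rule integrable_lborel_compact_support[OF F K(1,2)])
  have int_Fs: "integrable lborel (\<lambda>x. F (x + c))" for c
    using F K(2)
    by (intro integrable_lborel_compact_support[where K = "(\<lambda>y. y - c) ` K"] compact_continuous_image K(1)
        continuous_on_compose2[OF F] continuous_intros) force+
  have shift: "(\<integral>x. F (x + c) \<partial>lborel) = (\<integral>x. F x \<partial>lborel)" for c
  proof -
    have "F \<in> borel_measurable borel" using F by (rule borel_measurable_continuous_onI)
    then have "(\<integral>x. F x \<partial>distr lborel borel ((+) c)) = (\<integral>x. F (c + x) \<partial>lborel)"
      by (intro integral_distr) auto
    then show ?thesis by (simp add: lborel_distr_plus add.commute)
  qed
  have "(\<integral>x. q n x \<partial>lborel) = 0" for n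
    unfolding q_def using int_F int_Fs shift by simp
  moreover have "(\<lambda>n. \<integral>x. q n x \<partial>lborel) \<longlonglongrightarrow> (\<integral>x. G x $ i \<partial>lborel)"
  proof (rule integral_dominated_convergence[where w = "\<lambda>x. indicator K' x *\<^sub>R B"])
    show "(\<lambda>x. G x $ i) \<in> borel_measurable lborel"
      using G by (auto intro!: borel_measurable_continuous_onI continuous_intros)
    show "q n \<in> borel_measurable lborel" for n
      unfolding q_def using F by (auto intro!: borel_measurable_continuous_onI continuous_intros
         continuous_on_compose2[OF F] simp: t_def)
    show "integrable lborel (\<lambda>x. indicator K' x *\<^sub>R B)"
      using K' by (intro borel_integrable_compact) auto
    show "AE x in lborel. norm (q n x) \<le> indicator K' x *\<^sub>R B" for n
    proof (rule AE_I2)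
      fix x
      have "\<bar>F (x + t n *\<^sub>R ?e) - F x\<bar> \<le> B * t n"
        using lip[of "x + t n *\<^sub>R ?e" x] t[of n] by simp
      then show "norm (q n x) \<le> indicator K' x *\<^sub>R B"
        using t[of n] qK[of x n] by (cases "x \<in> K'") (auto simp: q_def field_simps)
    qed
    show "AE x in lborel. (\<lambda>n. q n x) \<longlonglongrightarrow> G x $ i"
    proof (rule AE_I2)
      fix x
      have "((\<lambda>s. x + s *\<^sub>R ?e) has_derivative (\<lambda>s. s *\<^sub>R ?e)) (at 0)"
        by (auto intro!: derivative_eq_intros)
      moreover have "(F has_derivative (\<lambda>h. G x \<bullet> h)) (at (x + 0 *\<^sub>R ?e))"
        using D[of x] by simp
      ultimately have "((\<lambda>s. F (x + s *\<^sub>R ?e)) has_derivative (\<lambda>s. G x \<bullet> (s *\<^sub>R ?e))) (at 0)"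
        by (rule has_derivative_compose)
      then have "((\<lambda>s. F (x + s *\<^sub>R ?e)) has_real_derivative G x $ i) (at 0)"
        unfolding has_field_derivative_def by (rule has_derivative_eq_rhs) (auto simp: inner_axis fun_eq_iff)
      then have "((\<lambda>s. (F (x + s *\<^sub>R ?e) - F x) / s) \<longlongrightarrow> G x $ i) (at 0)"
        by (simp add: DERIV_def)
      moreover have "filterlim t (at 0) sequentially"
        unfolding filterlim_at using t0 t by (auto simp: less_imp_neq[symmetric] eventually_sequentially t_def)
      ultimately show "(\<lambda>n. q n x) \<longlonglongrightarrow> G x $ i"
        unfolding q_def by (rule filterlim_compose)
    qed
  qed
  ultimately show ?thesis by (simp add: LIMSEQ_const_iff)
qed

lemma test_fun_measurable:
  assumes "test_fun \<Omega> \<phi>"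
  shows "\<phi> \<in> borel_measurable borel" "grad \<phi> \<in> borel_measurable borel" "partial i \<phi> \<in> borel_measurable borel"
  using test_fun_smooth[OF assms]
  by (intro borel_measurable_continuous_onI smooth_fun_continuous smooth_fun_continuous_grad
      smooth_fun_partial; simp)+

text \<open>The product \<open>\<phi> * \<psi>\<close> has compact support, so the integral of its
  partial derivative vanishes. This identity is what survives in the limit as the weak
  derivative.\<close>

lemma test_fun_integral_by_parts:
  fixes \<phi> \<psi> :: "real^'n::finite \<Rightarrow> real"
  assumes \<Omega>: "open \<Omega>" and \<phi>: "test_fun \<Omega> \<phi>" and \<psi>: "test_fun \<Omega> \<psi>"
  shows "(\<integral>x. \<phi> x * partial i \<psi> x \<partial>lebesgue_on \<Omega>) = - (\<integral>x. partial i \<phi> x * \<psi> x \<partial>lebesgue_on \<Omega>)"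
proof -
  note s = test_fun_smooth[OF \<phi>] test_fun_smooth[OF \<psi>]
  note cont = smooth_fun_continuous smooth_fun_continuous_grad smooth_fun_partial
  obtain K where K: "compact K" "K \<subseteq> \<Omega>" "\<And>x. x \<notin> K \<Longrightarrow> \<phi> x = 0" "\<And>x. x \<notin> K \<Longrightarrow> grad \<phi> x = 0"
    using test_fun_compact_support[OF \<phi>] by blast
  have pK: "partial i \<phi> x = 0" if "x \<notin> K" for x
    using K(4)[OF that] by (metis grad_nth zero_index)
  define G where "G x = \<phi> x *\<^sub>R grad \<psi> x + \<psi> x *\<^sub>R grad \<phi> x" for x
  have "(\<integral>x. G x $ i \<partial>lborel) = 0"
  proof (rule integral_partial_eq_0[where F = "\<lambda>x. \<phi> x * \<psi> x", OF _ _ K(1)])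
    show "((\<lambda>x. \<phi> x * \<psi> x) has_derivative (\<lambda>h. G x \<bullet> h)) (at x)" for x
      by (rule has_derivative_eq_rhs[OF has_derivative_mult[OF s[THEN smooth_fun_has_derivative]]])
         (auto simp: G_def inner_add_left)
    show "continuous_on UNIV G"
      unfolding G_def by (intro continuous_intros cont s)
  qed (auto simp: K G_def)
  moreover have "integrable lborel (\<lambda>x. \<phi> x * partial i \<psi> x)" "integrable lborel (\<lambda>x. partial i \<phi> x * \<psi> x)"
    by (rule integrable_lborel_compact_support[OF continuous_on_mult K(1)],
        auto simp: K pK intro: smooth_fun_continuous smooth_fun_partial s)+
  ultimately have "(\<integral>x. \<phi> x * partial i \<psi> x \<partial>lborel) + (\<integral>x. partial i \<phi> x * \<psi> x \<partial>lborel) = 0"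
    by (subst Bochner_Integration.integral_add[symmetric]) (auto simp: G_def mult.commute)
  moreover have "(\<integral>x. \<phi> x * partial i \<psi> x \<partial>lebesgue_on \<Omega>) = (\<integral>x. \<phi> x * partial i \<psi> x \<partial>lborel)"
    "(\<integral>x. partial i \<phi> x * \<psi> x \<partial>lebesgue_on \<Omega>) = (\<integral>x. partial i \<phi> x * \<psi> x \<partial>lborel)"
    using \<Omega> K(2) test_fun_measurable[OF \<phi>] test_fun_measurable[OF \<psi>]
    by (intro integral_lebesgue_on_eq_lborel(1); auto simp: test_fun_outside[OF \<phi>] test_fun_outside[OF \<psi>])+
  ultimately show ?thesis by simp
qed

section \<open>Morrey's inequality\<close>

text \<open>The substitution has Jacobian \<open>t ^ CARD('n)\<close>. Since \<open>E\<close> bounds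
  the integral over every box, the position of the image box is irrelevant.\<close>

lemma integral_scaled_cube_le:
  fixes g :: "real^'n::finite \<Rightarrow> real"
  assumes g: "continuous_on UNIV g" "\<And>x. g x \<ge> 0" and E: "\<And>a b. integral (cbox a b) g \<le> E"
    and t: "t > 0"
  shows "integral (cbox a b) (\<lambda>y. g (x0 + t *\<^sub>R (y - x0))) \<le> E / t ^ CARD('n)"
proof -
  let ?T = "\<lambda>y. t *\<^sub>R y + (x0 - t *\<^sub>R x0)"
  obtain u v where uv: "?T ` cbox a b = cbox u v"
    using interval_image_affinity_interval by blast
  \<comment> \<open>The affine substitution rule describes the new domain as an inverse image of
    \<open>cbox u v\<close>; this identifies it with the original box.\<close>
  have inv: "(\<lambda>x. (1 / t) *\<^sub>R x + - ((1 / t) *\<^sub>R (x0 - t *\<^sub>R x0))) ` cbox u v = cbox a b"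
  proof -
    have "(\<lambda>x. (1 / t) *\<^sub>R x + - ((1 / t) *\<^sub>R (x0 - t *\<^sub>R x0))) ` cbox u v
      = (\<lambda>y. (1 / t) *\<^sub>R ?T y + - ((1 / t) *\<^sub>R (x0 - t *\<^sub>R x0))) ` cbox a b"
      unfolding uv[symmetric] image_image ..
    also have "\<dots> = cbox a b"
      using t by (simp add: algebra_simps)
    finally show ?thesis .
  qed
  have "(g has_integral integral (cbox u v) g) (cbox u v)"
    using g(1) by (intro integrable_integral integrable_continuous) (auto intro: continuous_on_subset)
  from has_integral_affinity[OF this, of t "x0 - t *\<^sub>R x0"] t
  have "((\<lambda>y. g (?T y)) has_integral (1 / t ^ CARD('n)) * integral (cbox u v) g) (cbox a b)"
    unfolding inv by simp
  then have "integral (cbox a b) (\<lambda>y. g (?T y)) = (1 / t ^ CARD('n)) * integral (cbox u v) g"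
    by (rule integral_unique)
  also have "\<dots> \<le> (1 / t ^ CARD('n)) * E"
    using E t by (intro mult_left_mono) auto
  finally show ?thesis by (simp add: algebra_simps)
qed

lemma integral_scaled_norm_le:
  fixes g :: "real^'n::finite \<Rightarrow> real"
  assumes g: "continuous_on UNIV g" "\<And>x. g x \<ge> 0" and q: "q > real CARD('n)"
    and E: "\<And>a b. integral (cbox a b) (\<lambda>x. g x powr q) \<le> E"
    and t: "t > 0" and \<nu>: "\<nu> > 0"
  shows "integral (cbox a b) (\<lambda>y. g (x0 + t *\<^sub>R (y - x0)))
     \<le> t powr (- (real CARD('n) / q)) * (measure lborel (cbox a b) / \<nu> + \<nu> powr (q - 1) * E)"
proof -
  define \<beta> where "\<beta> = real CARD('n) / q"
  have q1: "q \<ge> 1" "q > 0" using q by (auto simp: order_less_le_trans[OF _ less_imp_le[OF q]]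
      intro: order_trans[OF _ less_imp_le[OF q]] simp: Suc_leI)
  have \<beta>q: "\<beta> * q = real CARD('n)" using q1 by (simp add: \<beta>_def)
  \<comment> \<open>With \<beta> = N / q, where N is the dimension, both summands of Young's
    inequality scale like \<open>t powr (-\<beta>)\<close>, a singularity integrable on the unit
    interval because q > N. The factor \<nu> remains free for the size of the cube.\<close>
  define m where "m = t powr \<beta> * \<nu>"
  have m: "m > 0" using t \<nu> by (simp add: m_def)
  have gq: "continuous_on UNIV (\<lambda>x. g x powr q)"
    using g q1 by (intro continuous_on_powr') (auto intro: continuous_intros)
  let ?T = "\<lambda>y. x0 + t *\<^sub>R (y - x0)"
  have cT: "continuous_on (cbox a b) ?T" by (intro continuous_intros)
  have c1: "continuous_on (cbox a b) (\<lambda>y. g (?T y))" "continuous_on (cbox a b) (\<lambda>y. g (?T y) powr q)"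
    by (rule continuous_on_compose2[OF g(1) cT] continuous_on_compose2[OF gq cT]; simp)+
  have "integral (cbox a b) (\<lambda>y. g (?T y)) \<le>
      integral (cbox a b) (\<lambda>y. 1/m + m powr (q-1) * g (?T y) powr q)"
    by (intro integral_le integrable_continuous continuous_intros c1 le_inverse_plus_powr g m q1)
  also have "\<dots> = measure lborel (cbox a b) / m + m powr (q-1) * integral (cbox a b) (\<lambda>y. g (?T y) powr q)"
    by (subst integral_add) (auto intro!: integrable_continuous continuous_intros c1)
  also have "\<dots> \<le> measure lborel (cbox a b) / m + m powr (q-1) * (E / t ^ CARD('n))"
    by (intro add_left_mono mult_left_mono integral_scaled_cube_le gq E t) auto
  also have "\<dots> = t powr (-\<beta>) * (measure lborel (cbox a b) / \<nu> + \<nu> powr (q - 1) * E)"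
  proof -
    have "t ^ CARD('n) = t powr (\<beta> * q)"
      using t by (simp add: \<beta>q powr_realpow)
    moreover have "m powr (q-1) = t powr (\<beta> * q - \<beta>) * \<nu> powr (q - 1)"
      using t \<nu> by (simp add: m_def powr_mult powr_powr algebra_simps)
    ultimately have "m powr (q-1) * (E / t ^ CARD('n)) = t powr (-\<beta>) * (\<nu> powr (q - 1) * E)"
      using t by (simp add: powr_diff powr_minus field_simps)
    moreover have "measure lborel (cbox a b) / m = t powr (-\<beta>) * (measure lborel (cbox a b) / \<nu>)"
      using t by (simp add: m_def powr_minus field_simps)
    ultimately show ?thesis by (simp add: distrib_left)
  qed
  finally show ?thesis by (simp add: \<beta>_def)
qed

text \<open>Write \<open>\<phi> y - \<phi> x0\<close> as the integral of the gradient along the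
  segment, integrate over the cube, exchange the two integrals and estimate the inner one over
  scaled cubes.\<close>

lemma average_difference_le:
  fixes \<phi> :: "real^'n::finite \<Rightarrow> real"
  assumes \<phi>: "smooth_fun \<phi>" and q: "q > real CARD('n)"
    and E: "\<And>a b. integral (cbox a b) (\<lambda>x. norm (grad \<phi> x) powr q) \<le> E"
    and s: "s > 0" and x0: "x0 \<in> cbox (z - s *\<^sub>R One) (z + s *\<^sub>R One)"
  shows "\<bar>integral (cbox (z - s *\<^sub>R One) (z + s *\<^sub>R One)) \<phi> / (2 * s) ^ CARD('n) - \<phi> x0\<bar>
     \<le> 2 * real CARD('n) / (1 - real CARD('n) / q) * s powr (1 - real CARD('n) / q) * (1 + E)"
proof -
  define N where "N = CARD('n)"
  define \<beta> where "\<beta> = real N / q"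
  have q1: "q > 0" using q by (simp add: order_le_less_trans[OF _ q])
  have N: "N > 0" by (simp add: N_def)
  have \<beta>: "0 < \<beta>" "\<beta> < 1" using q q1 N by (auto simp: \<beta>_def N_def)
  define a b where "a = z - s *\<^sub>R One" and "b = z + s *\<^sub>R One"
  define Q where "Q = cbox a b"
  have x0Q: "x0 \<in> Q" using x0 by (simp add: Q_def a_def b_def)
  have cQ: "measure lborel Q = (2 * s) ^ N"
  proof -
    have "measure lborel Q = (\<Prod>i\<in>(Basis :: (real^'n) set). b \<bullet> i - a \<bullet> i)"
      unfolding Q_def by (rule content_cbox) (use s in \<open>auto simp: a_def b_def inner_diff_left inner_add_left\<close>)
    also have "\<dots> = (\<Prod>i\<in>(Basis :: (real^'n) set). 2 * s)"
      by (rule prod.cong) (auto simp: a_def b_def inner_diff_left inner_add_left)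
    finally show ?thesis by (simp add: N_def)
  qed
  \<comment> \<open>A crude diameter of the cube, obtained from the sum norm.\<close>
  define L where "L = 2 * s * real N"
  have L: "norm (y - x0) \<le> L" if "y \<in> Q" for y
  proof -
    have "norm (y - x0) \<le> (\<Sum>i\<in>Basis. \<bar>(y - x0) \<bullet> i\<bar>)" by (rule norm_le_l1)
    also have "\<dots> \<le> (\<Sum>i\<in>(Basis :: (real^'n) set). 2 * s)"
    proof (rule sum_mono)
      fix i :: "real^'n" assume i: "i \<in> Basis"
      have "a \<bullet> i = z \<bullet> i - s" "b \<bullet> i = z \<bullet> i + s"
        using i by (auto simp: a_def b_def inner_diff_left inner_add_left)
      moreover have "a \<bullet> i \<le> y \<bullet> i" "y \<bullet> i \<le> b \<bullet> i" "a \<bullet> i \<le> x0 \<bullet> i" "x0 \<bullet> i \<le> b \<bullet> i"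
        using that x0Q i by (auto simp: Q_def mem_box)
      ultimately show "\<bar>(y - x0) \<bullet> i\<bar> \<le> 2 * s" by (simp add: inner_diff_left)
    qed
    finally show ?thesis by (simp add: L_def N_def mult.commute)
  qed
  have L0: "L \<ge> 0" using s by (simp add: L_def)
  define H where "H y t = grad \<phi> (x0 + t *\<^sub>R (y - x0)) \<bullet> (y - x0)" for y t
  have cg: "continuous_on UNIV (grad \<phi>)" using \<phi> by (rule smooth_fun_continuous_grad)
  have cH: "continuous_on X (\<lambda>(y, t). H y t)" for X
    unfolding H_def split_beta
    by (intro continuous_intros continuous_on_compose2[OF cg]) auto
  have cH': "continuous_on X (\<lambda>(t, y). H y t)" for X
    unfolding H_def split_beta
    by (intro continuous_intros continuous_on_compose2[OF cg]) auto
  have ftc: "\<phi> y - \<phi> x0 = integral {0..1} (H y)" for y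
  proof -
    have "((\<lambda>t. \<phi> (x0 + t *\<^sub>R (y - x0))) has_vector_derivative H y t) (at t within {0..1})" for t
    proof -
      have "((\<lambda>t. x0 + t *\<^sub>R (y - x0)) has_derivative (\<lambda>h. h *\<^sub>R (y - x0))) (at t within {0..1})"
        by (auto intro!: derivative_eq_intros)
      from has_derivative_compose[OF this smooth_fun_has_derivative[OF \<phi>]]
      show ?thesis by (simp add: has_vector_derivative_def H_def)
    qed
    then have "(H y has_integral \<phi> (x0 + 1 *\<^sub>R (y - x0)) - \<phi> (x0 + 0 *\<^sub>R (y - x0))) {0..1}"
      by (intro fundamental_theorem_of_calculus) auto
    then show ?thesis by (simp add: integral_unique)
  qed
  \<comment> \<open>This choice gives both summands in \<open>B\<close> the same order in
    \<open>s\<close>: division by the volume of the cube leaves \<open>L / \<nu>\<close>, which is a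
    multiple of \<open>s powr (1 - \<beta>)\<close>.\<close>
  define \<nu> where "\<nu> = s powr \<beta>"
  have \<nu>: "\<nu> > 0" using s by (simp add: \<nu>_def)
  define B where "B = L * (measure lborel Q / \<nu> + \<nu> powr (q - 1) * E)"
  have "\<phi> integrable_on Q" unfolding Q_def using \<phi> by (intro integrable_continuous smooth_fun_continuous)
  then have "integral Q \<phi> - measure lborel Q * \<phi> x0 = integral Q (\<lambda>y. \<phi> y - \<phi> x0)"
    unfolding Q_def by (subst integral_diff) auto
  also have "\<dots> = integral Q (\<lambda>y. integral {0..1} (H y))"
    unfolding ftc ..
  also have "\<dots> = integral {0..1} (\<lambda>t. integral Q (\<lambda>y. H y t))"
    using integral_swap_continuous[of a 0 b "1::real" H] cH by (simp add: Q_def)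
  finally have eq: "integral Q \<phi> - measure lborel Q * \<phi> x0 = integral {0..1} (\<lambda>t. integral Q (\<lambda>y. H y t))" .
  \<comment> \<open>The integrand is reset at \<open>t = 0\<close> because there the majorant is 0,
    by the convention for powers of 0. One point does not affect the integral.\<close>
  have "norm (integral {0..1} (\<lambda>t. if t = 0 then 0 else integral Q (\<lambda>y. H y t)))
      \<le> integral {0..1} (\<lambda>t. t powr (-\<beta>) * B)"
  proof (rule integral_norm_bound_integral)
    have "continuous_on {0..1} (\<lambda>t. integral (cbox a b) (\<lambda>y. H y t))"
      by (rule integral_continuous_on_param) (use cH' in \<open>simp add: case_prod_beta\<close>)
    then have "(\<lambda>t. integral Q (\<lambda>y. H y t)) integrable_on {0..1}"
      unfolding Q_def by (rule integrable_continuous_real)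
    then show "(\<lambda>t. if t = 0 then 0 else integral Q (\<lambda>y. H y t)) integrable_on {0..1}"
      by (rule integrable_spike[of _ _ "{0}"]) auto
    show "(\<lambda>t. t powr (-\<beta>) * B) integrable_on {0..1}"
      using has_integral_mult_left[OF has_integral_powr_from_0[of "-\<beta>" 1], of B] \<beta>
      by (auto simp: integrable_on_def)
    fix t :: real assume t: "t \<in> {0..1}"
    show "norm (if t = 0 then 0 else integral Q (\<lambda>y. H y t)) \<le> t powr (-\<beta>) * B"
    proof (cases "t = 0")
      case False
      then have t0: "t > 0" using t by auto
      have "norm (integral Q (\<lambda>y. H y t)) \<le> integral Q (\<lambda>y. L * norm (grad \<phi> (x0 + t *\<^sub>R (y - x0))))"
      proof (rule integral_norm_bound_integral)
        show "(\<lambda>y. H y t) integrable_on Q"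
          unfolding Q_def H_def
          by (intro integrable_continuous continuous_intros continuous_on_compose2[OF cg]) auto
        show "(\<lambda>y. L * norm (grad \<phi> (x0 + t *\<^sub>R (y - x0)))) integrable_on Q"
          unfolding Q_def
          by (intro integrable_continuous continuous_intros continuous_on_compose2[OF cg]) auto
        fix y assume "y \<in> Q"
        have "\<bar>H y t\<bar> \<le> norm (grad \<phi> (x0 + t *\<^sub>R (y - x0))) * norm (y - x0)"
          unfolding H_def by (rule Cauchy_Schwarz_ineq2)
        also have "\<dots> \<le> norm (grad \<phi> (x0 + t *\<^sub>R (y - x0))) * L"
          using L[OF \<open>y \<in> Q\<close>] by (intro mult_left_mono) auto
        finally show "norm (H y t) \<le> L * norm (grad \<phi> (x0 + t *\<^sub>R (y - x0)))" by (simp add: mult.commute)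
      qed
      also have "\<dots> = L * integral Q (\<lambda>y. norm (grad \<phi> (x0 + t *\<^sub>R (y - x0))))" by simp
      also have "\<dots> \<le> L * (t powr (- \<beta>) * (measure lborel Q / \<nu> + \<nu> powr (q - 1) * E))"
        unfolding Q_def \<beta>_def N_def
        by (intro mult_left_mono integral_scaled_norm_le continuous_intros cg q E t0 \<nu> L0) auto
      finally show ?thesis using False by (simp add: B_def mult_ac)
    qed simp
  qed
  also have "integral {0..1} (\<lambda>t. t powr (-\<beta>) * B) = B / (1 - \<beta>)"
    using integral_unique[OF has_integral_powr_from_0[of "-\<beta>" 1]] \<beta> by simp
  also have "integral {0..1} (\<lambda>t. if t = 0 then 0 else integral Q (\<lambda>y. H y t))
      = integral {0..1} (\<lambda>t. integral Q (\<lambda>y. H y t))"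
    by (rule integral_spike[of "{0}"]) auto
  finally have "\<bar>integral Q \<phi> - measure lborel Q * \<phi> x0\<bar> \<le> B / (1 - \<beta>)"
    unfolding eq by simp
  then have "\<bar>integral Q \<phi> - measure lborel Q * \<phi> x0\<bar> / measure lborel Q \<le> B / (1 - \<beta>) / measure lborel Q"
    by (rule divide_right_mono) simp
  moreover have "integral Q \<phi> / measure lborel Q - \<phi> x0 = (integral Q \<phi> - measure lborel Q * \<phi> x0) / measure lborel Q"
    using cQ s by (simp add: diff_divide_distrib)
  ultimately have 1: "\<bar>integral Q \<phi> / measure lborel Q - \<phi> x0\<bar> \<le> B / (1 - \<beta>) / measure lborel Q"
    by (simp add: abs_divide)
  \<comment> \<open>The degenerate box \<open>cbox 0 0\<close> has integral zero.\<close>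
  have E0: "E \<ge> 0"
    using E[of 0 0] by simp
  have pw: "E \<le> E * 2 ^ N"
    using mult_left_mono[of 1 "2 ^ N :: real" E] E0 by simp
  have "B / measure lborel Q = L * (1 / \<nu> + \<nu> powr (q - 1) * E / measure lborel Q)"
    using cQ s by (simp add: B_def field_simps)
  also have "\<nu> powr (q - 1) = s ^ N / \<nu>"
    using s \<nu> q1 by (simp add: \<nu>_def powr_powr powr_diff[symmetric] powr_realpow[symmetric] \<beta>_def field_simps)
  also have "L * (1 / \<nu> + s ^ N / \<nu> * E / measure lborel Q) = L / \<nu> * (1 + E / 2 ^ N)"
    using cQ s \<nu> by (simp add: power_mult_distrib field_simps)
  also have "\<dots> \<le> L / \<nu> * (1 + E)"
    using L0 \<nu> E0 by (intro mult_left_mono) (auto simp: divide_le_eq pw)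
  also have "L / \<nu> = 2 * real N * s powr (1 - \<beta>)"
    using s by (simp add: L_def \<nu>_def powr_diff)
  finally have "B / measure lborel Q / (1 - \<beta>) \<le> 2 * real N * s powr (1 - \<beta>) * (1 + E) / (1 - \<beta>)"
    using \<beta> by (intro divide_right_mono) auto
  then have "\<bar>integral Q \<phi> / measure lborel Q - \<phi> x0\<bar> \<le> 2 * real N / (1 - \<beta>) * s powr (1 - \<beta>) * (1 + E)"
    using 1 by (simp add: field_simps)
  then show ?thesis
    unfolding cQ by (simp add: Q_def a_def b_def \<beta>_def N_def)
qed

text \<open>Both points lie in the cube around \<open>x\<close> with half side
  \<open>norm (x - y)\<close>, so each is compared with the mean over that cube. The summand 1 is
  left over from Young's inequality.\<close>

lemma morrey_inhomogeneous:
  fixes \<phi> :: "real^'n::finite \<Rightarrow> real"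
  assumes \<phi>: "smooth_fun \<phi>" and q: "q > real CARD('n)"
    and E: "\<And>a b. integral (cbox a b) (\<lambda>x. norm (grad \<phi> x) powr q) \<le> E"
  shows "\<bar>\<phi> x - \<phi> y\<bar> \<le> 4 * real CARD('n) / (1 - real CARD('n) / q) * norm (x - y) powr (1 - real CARD('n) / q) * (1 + E)"
proof (cases "x = y")
  case False
  define s where "s = norm (x - y)"
  define A where "A = integral (cbox (x - s *\<^sub>R One) (x + s *\<^sub>R One)) \<phi> / (2 * s) ^ CARD('n)"
  define R where "R = 2 * real CARD('n) / (1 - real CARD('n) / q) * s powr (1 - real CARD('n) / q) * (1 + E)"
  have s: "s > 0" using False by (simp add: s_def)
  have "x \<in> cbox (x - s *\<^sub>R One) (x + s *\<^sub>R One)"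
    using s by (auto simp: mem_box inner_diff_left inner_add_left)
  from average_difference_le[OF \<phi> q E s this] have 1: "\<bar>A - \<phi> x\<bar> \<le> R"
    by (simp add: A_def R_def)
  have "\<bar>(x - y) \<bullet> i\<bar> \<le> s" if "i \<in> Basis" for i
    using Basis_le_norm[OF that] by (simp add: s_def)
  then have "y \<in> cbox (x - s *\<^sub>R One) (x + s *\<^sub>R One)"
    by (auto simp: mem_box inner_diff_left inner_add_left abs_le_iff algebra_simps)
  from average_difference_le[OF \<phi> q E s this] have "\<bar>A - \<phi> y\<bar> \<le> R"
    by (simp add: A_def R_def)
  with 1 have "\<bar>\<phi> x - \<phi> y\<bar> \<le> 2 * R" by linarith
  also have "2 * R = 4 * real CARD('n) / (1 - real CARD('n) / q) * norm (x - y) powr (1 - real CARD('n) / q) * (1 + E)"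
    by (simp add: R_def s_def)
  finally show ?thesis .
qed simp

text \<open>The inhomogeneous bound, applied to \<open>m * \<phi>\<close> and optimised in
  \<open>m\<close>, becomes homogeneous. Only this form makes functions of small energy uniformly
  small.\<close>

lemma morrey:
  fixes \<phi> :: "real^'n::finite \<Rightarrow> real"
  assumes \<phi>: "smooth_fun \<phi>" and q: "q > real CARD('n)"
    and E: "\<And>a b. integral (cbox a b) (\<lambda>x. norm (grad \<phi> x) powr q) \<le> E"
  shows "\<bar>\<phi> x - \<phi> y\<bar> \<le> 8 * real CARD('n) / (1 - real CARD('n) / q) * norm (x - y) powr (1 - real CARD('n) / q) * E powr (1 / q)"
proof -
  define R where "R = 4 * real CARD('n) / (1 - real CARD('n) / q) * norm (x - y) powr (1 - real CARD('n) / q)"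
  have q1: "q > 0" using q by (simp add: order_le_less_trans[OF _ q])
  have R: "R \<ge> 0" using q q1 by (auto simp: R_def)
  have E0: "E \<ge> 0"
    using E[of 0 0] by simp
  have sc: "m * \<bar>\<phi> x - \<phi> y\<bar> \<le> R * (1 + m powr q * E)" if m: "m > 0" for m
  proof -
    have "\<bar>m * \<phi> x - m * \<phi> y\<bar> \<le> 4 * real CARD('n) / (1 - real CARD('n) / q) * norm (x - y) powr (1 - real CARD('n) / q) * (1 + m powr q * E)"
    proof (rule morrey_inhomogeneous[of "\<lambda>x. m * \<phi> x"])
      show "smooth_fun (\<lambda>x. m * \<phi> x)"
        using smooth_fun_lincomb[OF \<phi> \<phi>, of m 0] by simp
      fix a b
      have "integral (cbox a b) (\<lambda>x. norm (grad (\<lambda>x. m * \<phi> x) x) powr q)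
          = m powr q * integral (cbox a b) (\<lambda>x. norm (grad \<phi> x) powr q)"
        using m by (simp add: grad_scale[OF \<phi>] powr_mult)
      also have "\<dots> \<le> m powr q * E" using E by (intro mult_left_mono) auto
      finally show "integral (cbox a b) (\<lambda>x. norm (grad (\<lambda>x. m * \<phi> x) x) powr q) \<le> m powr q * E" .
    qed (rule q)
    moreover have "\<bar>m * \<phi> x - m * \<phi> y\<bar> = m * \<bar>\<phi> x - \<phi> y\<bar>"
      using m by (simp flip: right_diff_distrib add: abs_mult)
    ultimately show ?thesis by (simp add: R_def)
  qed
  have "\<bar>\<phi> x - \<phi> y\<bar> \<le> 2 * R * E powr (1 / q)"
  proof (cases "E = 0")
    case True
    have "\<bar>\<phi> x - \<phi> y\<bar> \<le> 0"
    proof (rule ccontr)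
      assume "\<not> ?thesis"
      then have d: "\<bar>\<phi> x - \<phi> y\<bar> > 0" by simp
      \<comment> \<open>With zero energy the scaled inequality bounds every multiple of the
        difference by \<open>R\<close>; this multiple exceeds it.\<close>
      then have "(R + 1) / \<bar>\<phi> x - \<phi> y\<bar> * \<bar>\<phi> x - \<phi> y\<bar> \<le> R"
        using sc[of "(R + 1) / \<bar>\<phi> x - \<phi> y\<bar>"] R True by (simp del: abs_0_eq)
      then show False using d by simp
    qed
    then show ?thesis using True by simp
  next
    case False
    \<comment> \<open>Normalises the energy of \<open>m * \<phi>\<close> to at most 1, which turns
      the bracket \<open>1 + m powr q * E\<close> into 2.\<close>
    define m where "m = E powr (- 1 / q)"
    have "m powr q = E powr (- 1)"
      using q1 by (simp add: m_def powr_powr)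
    then have "m powr q * E = 1"
      using False E0 by (simp add: powr_minus)
    moreover have "E powr (1 / q) = 1 / m"
      by (simp add: m_def powr_minus_divide)
    ultimately have m: "m > 0" "m powr q * E = 1" "E powr (1 / q) = 1 / m"
      using False by (auto simp: m_def)
    have "m * \<bar>\<phi> x - \<phi> y\<bar> \<le> 2 * R"
      using sc[OF m(1)] m(2) by simp
    then show ?thesis
      using m(1) unfolding m(3) by (simp add: field_simps)
  qed
  then show ?thesis by (simp add: R_def)
qed

section \<open>Measurability of compositions with Caratheodory functions\<close>

lemma borel_measurable_lebesgue_on:
  fixes g :: "real^'n::finite \<Rightarrow> 'b::euclidean_space"
  shows "g \<in> borel_measurable borel \<Longrightarrow> g \<in> borel_measurable (lebesgue_on S)"
  by (intro measurable_restrict_space1 measurable_completion) simp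

text \<open>Holds because Lebesgue measure is complete.\<close>

lemma borel_measurable_lebesgue_on_AE:
  fixes g h :: "real^'n::finite \<Rightarrow> 'b::euclidean_space"
  assumes S: "S \<in> sets lebesgue" and g: "g \<in> borel_measurable (lebesgue_on S)"
    and ae: "AE x in lebesgue_on S. g x = h x"
  shows "h \<in> borel_measurable (lebesgue_on S)"
proof -
  have "(\<lambda>x. if x \<in> S then g x else 0) \<in> borel_measurable lebesgue"
    using borel_measurable_if[OF S, of g] g by simp
  moreover have "AE x in lebesgue. (if x \<in> S then g x else 0) = (if x \<in> S then h x else 0)"
    using ae S by (subst (asm) AE_restrict_space_iff) (auto elim!: eventually_mono)
  ultimately have "(\<lambda>x. if x \<in> S then h x else 0) \<in> borel_measurable lebesgue"
    by (rule borel_measurable_AE)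
  then show ?thesis using borel_measurable_if[OF S, of h] by simp
qed

lemma borel_measurable_lebesgue_on_AE_limit:
  fixes g :: "nat \<Rightarrow> real^'n::finite \<Rightarrow> real"
  assumes S: "S \<in> sets lebesgue" and g: "\<And>k. g k \<in> borel_measurable (lebesgue_on S)"
    and ae: "AE x in lebesgue_on S. (\<lambda>k. g k x) \<longlonglongrightarrow> h x"
  shows "h \<in> borel_measurable (lebesgue_on S)"
proof (rule borel_measurable_lebesgue_on_AE[OF S])
  show "(\<lambda>x. lim (\<lambda>k. g k x)) \<in> borel_measurable (lebesgue_on S)"
    using g by (rule borel_measurable_lim_metric)
  show "AE x in lebesgue_on S. lim (\<lambda>k. g k x) = h x"
    using ae by eventually_elim (rule limI)
qed

text \<open>For simple \<open>s k\<close> the composite takes countably many sections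
  \<open>\<lambda>x. f x t\<close>, each of them measurable. Continuity of \<open>f x\<close> for
  almost every \<open>x\<close> passes this to the limit.\<close>

lemma caratheodory_measurable:
  fixes f :: "real^'n::finite \<Rightarrow> real \<Rightarrow> real"
  assumes S: "S \<in> sets lebesgue" and f: "caratheodory S f" and u: "u \<in> borel_measurable (lebesgue_on S)"
  shows "(\<lambda>x. f x (u x)) \<in> borel_measurable (lebesgue_on S)"
proof -
  obtain s where s: "\<And>k. simple_function (lebesgue_on S) (s k)"
    and lim: "\<And>x. x \<in> space (lebesgue_on S) \<Longrightarrow> (\<lambda>k. s k x) \<longlonglongrightarrow> u x"
    using borel_measurable_implies_sequence_metric[OF u, of 0] by metis
  show ?thesis
  proof (rule borel_measurable_lebesgue_on_AE_limit[OF S])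
    fix k
    show "(\<lambda>x. f x (s k x)) \<in> borel_measurable (lebesgue_on S)"
    proof (rule measurable_compose_countable'[where f = "\<lambda>t x. f x t" and g = "s k" and I = "s k ` space (lebesgue_on S)"])
      show "s k \<in> lebesgue_on S \<rightarrow>\<^sub>M count_space (s k ` space (lebesgue_on S))"
        using s[of k] by (auto simp: simple_function_def measurable_count_space_eq2)
      show "countable (s k ` space (lebesgue_on S))"
        using s[of k] by (simp add: simple_function_def countable_finite)
      show "(\<lambda>x. f x t) \<in> borel_measurable (lebesgue_on S)" for t
        using f by (simp add: caratheodory_def)
    qed
  next
    have "AE x in lebesgue_on S. continuous_on UNIV (f x)"
      using f by (simp add: caratheodory_def)
    then show "AE x in lebesgue_on S. (\<lambda>k. f x (s k x)) \<longlonglongrightarrow> f x (u x)"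
      using AE_space
    proof eventually_elim
      case (elim x)
      then show ?case
        using lim[OF elim(2)] continuous_on_tendsto_compose[of UNIV "f x"] by simp
    qed
  qed
qed

section \<open>The frozen problem\<close>

lemma integrable_dominated:
  fixes g h :: "'a \<Rightarrow> real"
  assumes "integrable M h" "g \<in> borel_measurable M" "\<And>x. x \<in> space M \<Longrightarrow> \<bar>g x\<bar> \<le> h x"
  shows "integrable M g"
proof (rule Bochner_Integration.integrable_bound[OF assms(1,2)], rule AE_I2)
  fix x assume "x \<in> space M"
  then show "norm (g x) \<le> norm (h x)" using assms(3)[of x] by simp
qed

text \<open>Growth is stated on balls of radius at least 1: this is how it is used, and it covers
  \<open>r = 1\<close>, where \<open>\<bar>t\<bar> powr (r - 1)\<close> would be 0 at
  \<open>t = 0\<close>.\<close>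

locale quasilinear =
  fixes \<Omega> :: "(real^'n::finite) set"
    and p :: "'n \<Rightarrow> real \<Rightarrow> real"
    and f :: "real^'n \<Rightarrow> real \<Rightarrow> real"
    and c r \<epsilon> q :: real
  assumes open_Omega: "open \<Omega>" and bounded_Omega: "bounded \<Omega>" and nonempty_Omega: "\<Omega> \<noteq> {}"
    and p_cont: "\<And>i. continuous_on UNIV (p i)"
    and p_ge: "\<And>i t. p i t \<ge> 2" and p_le: "\<And>i t. p i t \<le> q"
    and q_gt: "real CARD('n) < q" and cara: "caratheodory \<Omega> f"
    and c_pos: "c > 0" and r_ge: "1 \<le> r" and r_less: "r < q"
    and growth: "\<And>x t R. x \<in> \<Omega> \<Longrightarrow> 1 \<le> R \<Longrightarrow> \<bar>t\<bar> \<le> R \<Longrightarrow> \<bar>f x t\<bar> \<le> c * (1 + R powr (r - 1))"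
    and eps_pos: "\<epsilon> > 0"
begin

abbreviation "M \<equiv> lebesgue_on \<Omega>"

lemma q_ge: "q \<ge> 2"
  using p_ge p_le order_trans by blast

lemma Omega_lebesgue [simp]: "\<Omega> \<in> sets lebesgue"
  using open_Omega by simp

lemma space_M [simp]: "space M = \<Omega>"
  by simp

lemma finite_M: "finite_measure M"
proof
  have "emeasure M \<Omega> = emeasure lebesgue \<Omega>" by (simp add: emeasure_restrict_space)
  also have "\<dots> < \<infinity>"
    using bounded_set_imp_lmeasurable[OF bounded_Omega] by (simp add: fmeasurable_def)
  finally show "emeasure M (space M) \<noteq> \<infinity>" by simp
qed

sublocale finite_measure M by (rule finite_M)

lemma integrable_bounded:
  fixes g :: "real^'n \<Rightarrow> real"
  assumes "g \<in> borel_measurable M" "\<And>x. x \<in> \<Omega> \<Longrightarrow> \<bar>g x\<bar> \<le> B"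
  shows "integrable M g"
  by (rule integrable_const_bound[of _ B]) (use assms in \<open>auto intro!: AE_I2\<close>)

lemma test_fun_measurable_M:
  assumes "test_fun \<Omega> \<phi>"
  shows "\<phi> \<in> borel_measurable M" "grad \<phi> \<in> borel_measurable M" "partial i \<phi> \<in> borel_measurable M"
  by (rule borel_measurable_lebesgue_on[OF test_fun_measurable(1)[OF assms]]
      borel_measurable_lebesgue_on[OF test_fun_measurable(2)[OF assms]]
      borel_measurable_lebesgue_on[OF test_fun_measurable(3)[OF assms]])+

subsection \<open>The Dirichlet energy and Morrey bounds\<close>

definition energy :: "(real^'n \<Rightarrow> real) \<Rightarrow> real" where
  "energy \<phi> = (\<integral>x. norm (grad \<phi> x) powr q \<partial>M)"

lemma energy_nonneg [simp]: "energy \<phi> \<ge> 0"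
  by (simp add: energy_def)

lemma energy_scale:
  assumes "test_fun \<Omega> \<phi>"
  shows "energy (\<lambda>x. a * \<phi> x) = \<bar>a\<bar> powr q * energy \<phi>"
  by (simp add: energy_def grad_scale[OF test_fun_smooth[OF assms]] powr_mult)

lemma integrable_energy:
  assumes "test_fun \<Omega> \<phi>"
  shows "integrable M (\<lambda>x. norm (grad \<phi> x) powr q)"
proof -
  obtain B where B: "B > 0" "\<And>x. norm (grad \<phi> x) \<le> B" using test_fun_bounded[OF assms] by metis
  show ?thesis
    using test_fun_measurable_M[OF assms] q_ge B
    by (intro integrable_bounded[where B = "B powr q"]) (auto intro!: powr_mono2)
qed

text \<open>The gradient vanishes off the domain, so the integral over any box is part of the
  whole-space integral. This supplies the hypothesis of \<open>morrey\<close>.\<close>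

lemma cbox_energy_le:
  assumes "test_fun \<Omega> \<phi>"
  shows "integral (cbox a b) (\<lambda>x. norm (grad \<phi> x) powr q) \<le> energy \<phi>"
proof -
  let ?g = "\<lambda>x. norm (grad \<phi> x) powr q"
  have g: "continuous_on UNIV ?g"
    using smooth_fun_continuous_grad[OF test_fun_smooth[OF assms]] q_ge
    by (intro continuous_on_powr') (auto intro: continuous_intros)
  have g0: "?g x = 0" if "x \<notin> \<Omega>" for x
    using test_fun_outside[OF assms that] by simp
  note eq = integral_lebesgue_on_eq_lborel[OF Omega_lebesgue borel_measurable_continuous_onI[OF g] g0]
  have "integrable lborel ?g" using integrable_energy[OF assms] eq(2) by simp
  then have "(?g has_integral energy \<phi>) UNIV"
    using has_integral_integral_lborel[of ?g] eq(1) by (simp add: energy_def)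
  moreover have "?g integrable_on cbox a b"
    using g by (intro integrable_continuous) (auto intro: continuous_on_subset)
  ultimately show ?thesis
    by (intro has_integral_subset_le[of "cbox a b" UNIV ?g]) auto
qed

definition KM :: real where "KM = 8 * real CARD('n) / (1 - real CARD('n) / q)"
definition \<alpha> :: real where "\<alpha> = 1 - real CARD('n) / q"

lemma alpha_pos: "\<alpha> > 0" and KM_pos: "KM > 0"
proof -
  have "real CARD('n) / q < 1" using q_gt q_ge by simp
  then show "\<alpha> > 0" "KM > 0" by (auto simp: \<alpha>_def KM_def zero_less_card_finite)
qed

lemma holder_bound:
  assumes "test_fun \<Omega> \<phi>"
  shows "\<bar>\<phi> x - \<phi> y\<bar> \<le> KM * norm (x - y) powr \<alpha> * energy \<phi> powr (1 / q)"
  using morrey[OF test_fun_smooth[OF assms] q_gt cbox_energy_le[OF assms]]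
  by (simp add: KM_def \<alpha>_def)

text \<open>A Poincare-type bound: compare \<open>x\<close> with a fixed point outside the domain,
  where test functions vanish. \<open>C \<ge> 1\<close> is arranged so that the constant can later
  be dropped or divided by.\<close>

lemma sup_bound_ex: "\<exists>C\<ge>1. \<forall>\<phi> x. test_fun \<Omega> \<phi> \<longrightarrow> \<bar>\<phi> x\<bar> \<le> C * energy \<phi> powr (1 / q)"
proof -
  obtain D where D: "D > 0" "\<And>x. x \<in> \<Omega> \<Longrightarrow> norm x \<le> D"
    using bounded_Omega bounded_pos by metis
  \<comment> \<open>Its norm is twice the bound for the domain, hence it lies outside, at distance
    at most \<open>3 * D\<close> from each point inside.\<close>
  let ?y = "(2 * D) *\<^sub>R axis undefined 1 :: real^'n"
  have y: "norm ?y = 2 * D" using D by simp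
  then have yO: "?y \<notin> \<Omega>" using D(2)[of ?y] D(1) by auto
  define C where "C = max 1 (KM * (3 * D) powr \<alpha>)"
  have "\<bar>\<phi> x\<bar> \<le> C * energy \<phi> powr (1 / q)" if \<phi>: "test_fun \<Omega> \<phi>" for \<phi> x
  proof (cases "x \<in> \<Omega>")
    case True
    have "norm (x - ?y) \<le> 3 * D" using norm_triangle_ineq4[of x ?y] y D(2)[OF True] by linarith
    then have "KM * norm (x - ?y) powr \<alpha> \<le> KM * (3 * D) powr \<alpha>"
      using alpha_pos KM_pos by (intro mult_left_mono powr_mono2) auto
    also have "\<dots> \<le> C" by (simp add: C_def)
    finally have "KM * norm (x - ?y) powr \<alpha> * energy \<phi> powr (1 / q) \<le> C * energy \<phi> powr (1 / q)"
      by (intro mult_right_mono) auto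
    then show ?thesis
      using holder_bound[OF \<phi>, of x ?y] test_fun_outside(1)[OF \<phi> yO] by simp
  next
    case False
    then show ?thesis using test_fun_outside(1)[OF \<phi>] by (simp add: C_def)
  qed
  moreover have "C \<ge> 1" by (simp add: C_def)
  ultimately show ?thesis by blast
qed

definition CS :: real where
  "CS = (SOME C. C \<ge> 1 \<and> (\<forall>\<phi> x. test_fun \<Omega> \<phi> \<longrightarrow> \<bar>\<phi> x\<bar> \<le> C * energy \<phi> powr (1 / q)))"

lemma CS_ge: "CS \<ge> 1"
  and sup_bound: "test_fun \<Omega> \<phi> \<Longrightarrow> \<bar>\<phi> x\<bar> \<le> CS * energy \<phi> powr (1 / q)"
  unfolding CS_def using someI_ex[OF sup_bound_ex] by blast+

text \<open>Linear in the energy, to match the error term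
  \<open>\<theta> * (1 + energy \<psi>)\<close>.\<close>

lemma sup_bound': "test_fun \<Omega> \<phi> \<Longrightarrow> \<bar>\<phi> x\<bar> \<le> CS * (1 + energy \<phi>)"
proof -
  assume \<phi>: "test_fun \<Omega> \<phi>"
  have "energy \<phi> powr (1 / q) \<le> 1 + energy \<phi> powr 1"
    using q_ge by (intro powr_le_one_plus) auto
  then have "CS * energy \<phi> powr (1 / q) \<le> CS * (1 + energy \<phi>)"
    using CS_ge by (intro mult_left_mono) (auto simp: powr_one_gt_zero_iff)
  then show ?thesis using sup_bound[OF \<phi>, of x] by linarith
qed

subsection \<open>The vector field of the operator\<close>

definition field :: "real \<Rightarrow> real^'n \<Rightarrow> real^'n" where
  "field t \<xi> = (\<chi> i. flux (p i t) (\<xi> $ i)) + \<epsilon> *\<^sub>R flux q \<xi>"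

lemma field_inner:
  "field t \<xi> \<bullet> \<eta> = (\<Sum>i\<in>UNIV. flux (p i t) (\<xi> $ i) * \<eta> $ i) + \<epsilon> * (flux q \<xi> \<bullet> \<eta>)"
  by (simp add: field_def inner_vec_def sum.distrib distrib_right sum_distrib_left mult.assoc)

lemma p_tendsto: "(w \<longlongrightarrow> t) F \<Longrightarrow> ((\<lambda>n. p i (w n)) \<longlongrightarrow> p i t) F"
  using continuous_on_tendsto_compose[OF p_cont[of i], of w t F] by simp

lemma tendsto_field:
  assumes "(w \<longlongrightarrow> t) F" "(\<xi> \<longlongrightarrow> \<eta>) F"
  shows "((\<lambda>n. field (w n) (\<xi> n)) \<longlongrightarrow> field t \<eta>) F"
  unfolding field_def
proof (rule tendsto_add)
  show "((\<lambda>n. \<chi> i. flux (p i (w n)) (\<xi> n $ i)) \<longlongrightarrow> (\<chi> i. flux (p i t) (\<eta> $ i))) F"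
    by (rule tendsto_vec_lambda, rule tendsto_flux[OF p_tendsto[OF assms(1)] tendsto_vec_nth[OF assms(2)] p_ge])
  show "((\<lambda>n. \<epsilon> *\<^sub>R flux q (\<xi> n)) \<longlongrightarrow> \<epsilon> *\<^sub>R flux q \<eta>) F"
    by (intro tendsto_scaleR tendsto_const tendsto_flux[OF tendsto_const assms(2) q_ge])
qed

text \<open>Joint continuity in \<open>t\<close> and the gradient variable makes the composite
  measurable.\<close>

lemma field_measurable:
  assumes "w \<in> borel_measurable N" "G \<in> borel_measurable N"
  shows "(\<lambda>x. field (w x) (G x)) \<in> borel_measurable N"
proof -
  have "continuous_on UNIV (\<lambda>z. field (fst z) (snd z))"
    unfolding continuous_on_def
    by (intro ballI tendsto_field tendsto_fst[OF tendsto_ident_at] tendsto_snd[OF tendsto_ident_at])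
  then have "(\<lambda>z. field (fst z) (snd z)) \<in> borel_measurable borel"
    by (rule borel_measurable_continuous_onI)
  moreover have "(\<lambda>x. (w x, G x)) \<in> borel_measurable N"
    using assms by simp
  ultimately have "(\<lambda>x. (\<lambda>z. field (fst z) (snd z)) (w x, G x)) \<in> borel_measurable N"
    by (rule measurable_compose[rotated])
  then show ?thesis by simp
qed

lemma field_bound: "norm (field t \<xi>) \<le> (CARD('n) + \<epsilon>) * (1 + norm \<xi>) powr (q - 1)"
proof -
  have b: "norm (flux s \<zeta>) \<le> (1 + norm \<xi>) powr (q - 1)" if "norm \<zeta> \<le> norm \<xi>" "2 \<le> s" "s \<le> q"
    for s and \<zeta> :: "'b::real_inner"
  proof -
    have "norm \<zeta> powr (s - 1) \<le> (1 + norm \<xi>) powr (s - 1)"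
      using that by (intro powr_mono2) auto
    also have "\<dots> \<le> (1 + norm \<xi>) powr (q - 1)" using that by (intro powr_mono) auto
    finally show ?thesis by (simp add: norm_flux)
  qed
  have "norm (\<chi> i. flux (p i t) (\<xi> $ i)) \<le> (\<Sum>i\<in>UNIV. \<bar>flux (p i t) (\<xi> $ i)\<bar>)"
    using norm_le_l1_cart[of "\<chi> i. flux (p i t) (\<xi> $ i)"] by simp
  also have "\<dots> \<le> (\<Sum>i\<in>(UNIV::'n set). (1 + norm \<xi>) powr (q - 1))"
    using b[OF _ p_ge p_le, of "\<xi> $ i" for i] component_le_norm_cart[of \<xi>]
    by (intro sum_mono) (auto simp flip: real_norm_def)
  finally have "norm (\<chi> i. flux (p i t) (\<xi> $ i)) \<le> CARD('n) * (1 + norm \<xi>) powr (q - 1)" by simp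
  moreover have "norm (\<epsilon> *\<^sub>R flux q \<xi>) \<le> \<epsilon> * (1 + norm \<xi>) powr (q - 1)"
    using b[of \<xi> q] eps_pos q_ge by simp
  ultimately show ?thesis
    unfolding field_def by (intro norm_triangle_le) (simp add: algebra_simps)
qed

text \<open>The component fluxes contribute a nonnegative amount; the quantitative part comes from
  the \<epsilon>-term, uniformly in \<open>t\<close>.\<close>

lemma field_strongly_monotone:
  "(field t \<xi> - field t \<eta>) \<bullet> (\<xi> - \<eta>) \<ge> \<epsilon> * 2 powr (1 - q) * norm (\<xi> - \<eta>) powr q"
proof -
  have "(field t \<xi> - field t \<eta>) \<bullet> (\<xi> - \<eta>)
      = (\<Sum>i\<in>UNIV. (flux (p i t) (\<xi> $ i) - flux (p i t) (\<eta> $ i)) \<bullet> (\<xi> $ i - \<eta> $ i))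
        + \<epsilon> * ((flux q \<xi> - flux q \<eta>) \<bullet> (\<xi> - \<eta>))"
    by (simp add: inner_diff_left field_inner sum_subtractf left_diff_distrib right_diff_distrib)
  moreover have "(\<Sum>i\<in>UNIV. (flux (p i t) (\<xi> $ i) - flux (p i t) (\<eta> $ i)) \<bullet> (\<xi> $ i - \<eta> $ i)) \<ge> 0"
    by (intro sum_nonneg flux_monotone p_ge)
  moreover have "\<epsilon> * ((flux q \<xi> - flux q \<eta>) \<bullet> (\<xi> - \<eta>)) \<ge> \<epsilon> * (2 powr (1 - q) * norm (\<xi> - \<eta>) powr q)"
    using eps_pos q_ge by (intro mult_left_mono flux_strongly_monotone) auto
  ultimately show ?thesis by simp
qed

lemma field_coercive: "field t \<xi> \<bullet> \<xi> \<ge> \<epsilon> * norm \<xi> powr q"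
proof -
  have "(\<Sum>i\<in>UNIV. flux (p i t) (\<xi> $ i) * \<xi> $ i) \<ge> 0"
    using flux_inner_self[of _ "\<xi> $ _"] by (intro sum_nonneg) simp
  then show ?thesis by (simp add: field_inner flux_inner_self)
qed

lemma field_increment:
  assumes "0 \<le> s" "s \<le> 1"
  shows "\<bar>(field t (\<xi> + s *\<^sub>R \<eta>) - field t \<xi>) \<bullet> \<eta>\<bar>
     \<le> s * ((CARD('n) + \<epsilon>) * (q - 1) * (1 + 2 powr q * (norm \<xi> powr q + norm \<eta> powr q)))"
proof -
  define K where "K = (q - 1) * (1 + 2 powr q * (norm \<xi> powr q + norm \<eta> powr q))"
  have le: "\<bar>(flux (p i t) (\<xi> $ i + s * \<eta> $ i) - flux (p i t) (\<xi> $ i)) * \<eta> $ i\<bar> \<le> s * K" for i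
  proof -
    have "\<bar>(flux (p i t) (\<xi> $ i + s *\<^sub>R \<eta> $ i) - flux (p i t) (\<xi> $ i)) \<bullet> \<eta> $ i\<bar>
       \<le> s * (q - 1) * (1 + 2 powr q * (norm (\<xi> $ i) powr q + norm (\<eta> $ i) powr q))"
      by (rule flux_increment_le[OF p_ge p_le assms])
    also have "\<dots> \<le> s * (q - 1) * (1 + 2 powr q * (norm \<xi> powr q + norm \<eta> powr q))"
      using assms q_ge component_le_norm_cart[of \<xi> i] component_le_norm_cart[of \<eta> i]
      by (intro mult_left_mono add_left_mono add_mono powr_mono2) auto
    finally show ?thesis by (simp add: K_def)
  qed
  have "\<bar>(flux q (\<xi> + s *\<^sub>R \<eta>) - flux q \<xi>) \<bullet> \<eta>\<bar> \<le> s * K"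
    unfolding K_def using flux_increment_le[OF q_ge order_refl assms, of \<xi> \<eta>] by (simp add: mult.assoc)
  then have "\<bar>\<epsilon> * ((flux q (\<xi> + s *\<^sub>R \<eta>) - flux q \<xi>) \<bullet> \<eta>)\<bar> \<le> \<epsilon> * (s * K)"
    using eps_pos by (simp add: abs_mult)
  moreover have "\<bar>\<Sum>i\<in>UNIV. (flux (p i t) (\<xi> $ i + s * \<eta> $ i) - flux (p i t) (\<xi> $ i)) * \<eta> $ i\<bar>
      \<le> (\<Sum>i\<in>(UNIV :: 'n set). s * K)"
    by (intro order_trans[OF sum_abs] sum_mono le)
  moreover have "(field t (\<xi> + s *\<^sub>R \<eta>) - field t \<xi>) \<bullet> \<eta>
     = (\<Sum>i\<in>UNIV. (flux (p i t) (\<xi> $ i + s * \<eta> $ i) - flux (p i t) (\<xi> $ i)) * \<eta> $ i)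
      + \<epsilon> * ((flux q (\<xi> + s *\<^sub>R \<eta>) - flux q \<xi>) \<bullet> \<eta>)"
    by (simp add: inner_diff_left field_inner sum_subtractf left_diff_distrib right_diff_distrib)
  ultimately have "\<bar>(field t (\<xi> + s *\<^sub>R \<eta>) - field t \<xi>) \<bullet> \<eta>\<bar> \<le> CARD('n) * (s * K) + \<epsilon> * (s * K)"
    by simp
  also have "\<dots> = s * ((CARD('n) + \<epsilon>) * K)" by (simp add: algebra_simps)
  finally show ?thesis by (simp add: K_def mult.assoc)
qed

text \<open>A primitive of \<open>field t\<close> in the gradient variable, convex by
  \<open>potential_tangent\<close>. It is available only because \<open>t\<close> is frozen.\<close>

definition potential :: "real \<Rightarrow> real^'n \<Rightarrow> real" where
  "potential t \<xi> = (\<Sum>i\<in>UNIV. norm (\<xi> $ i) powr p i t / p i t) + \<epsilon> * (norm \<xi> powr q / q)"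

lemma potential_tangent: "potential t \<xi> + field t \<xi> \<bullet> (\<eta> - \<xi>) \<le> potential t \<eta>"
proof -
  have "(\<Sum>i\<in>UNIV. norm (\<xi> $ i) powr p i t / p i t + flux (p i t) (\<xi> $ i) \<bullet> (\<eta> $ i - \<xi> $ i))
      \<le> (\<Sum>i\<in>UNIV. norm (\<eta> $ i) powr p i t / p i t)"
    by (intro sum_mono norm_powr_tangent p_ge)
  moreover have "\<epsilon> * (norm \<xi> powr q / q + flux q \<xi> \<bullet> (\<eta> - \<xi>)) \<le> \<epsilon> * (norm \<eta> powr q / q)"
    using eps_pos by (intro mult_left_mono norm_powr_tangent q_ge) auto
  ultimately show ?thesis
    by (simp add: potential_def field_inner sum.distrib distrib_left)
qed

lemma potential_ge: "potential t \<xi> \<ge> \<epsilon> / q * norm \<xi> powr q"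
proof -
  have "(\<Sum>i\<in>UNIV. norm (\<xi> $ i) powr p i t / p i t) \<ge> 0"
    using p_ge by (intro sum_nonneg divide_nonneg_nonneg) (auto intro: order_trans[of 0 2])
  then show ?thesis by (simp add: potential_def)
qed

lemma potential_zero [simp]: "potential t 0 = 0"
  by (simp add: potential_def)

lemma potential_bound: "potential t \<xi> \<le> (CARD('n) + \<epsilon>) * (1 + norm \<xi> powr q)"
proof -
  have "norm (\<xi> $ i) powr p i t / p i t \<le> 1 + norm \<xi> powr q" for i
  proof -
    have "norm (\<xi> $ i) powr p i t / p i t \<le> norm (\<xi> $ i) powr p i t / 1"
      using p_ge[of i t] by (intro divide_left_mono) auto
    also have "\<dots> \<le> norm \<xi> powr p i t"
      using p_ge[of i t] component_le_norm_cart[of \<xi> i] by (auto intro!: powr_mono2)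
    also have "\<dots> \<le> 1 + norm \<xi> powr q" using p_ge[of i t] p_le by (intro powr_le_one_plus) auto
    finally show ?thesis .
  qed
  then have "(\<Sum>i\<in>UNIV. norm (\<xi> $ i) powr p i t / p i t) \<le> (\<Sum>i\<in>(UNIV::'n set). 1 + norm \<xi> powr q)"
    by (intro sum_mono) auto
  moreover have "\<epsilon> * (norm \<xi> powr q / q) \<le> \<epsilon> * (1 + norm \<xi> powr q)"
  proof -
    have "norm \<xi> powr q / q \<le> norm \<xi> powr q / 1" using q_ge by (intro divide_left_mono) auto
    then show ?thesis using eps_pos by (intro mult_left_mono) auto
  qed
  ultimately show ?thesis by (simp add: potential_def distrib_right)
qed

lemma potential_measurable:
  assumes "w \<in> borel_measurable N" "\<And>i. (\<lambda>x. G x $ i) \<in> borel_measurable N" "(\<lambda>x. norm (G x)) \<in> borel_measurable N"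
  shows "(\<lambda>x. potential (w x) (G x)) \<in> borel_measurable N"
proof -
  have "(\<lambda>x. p i (w x)) \<in> borel_measurable N" for i
    using measurable_compose[OF assms(1) borel_measurable_continuous_onI[OF p_cont[of i]]] .
  then show ?thesis
    unfolding potential_def using assms by measurable
qed


subsection \<open>Approximate solutions of the frozen problem\<close>

text \<open>The condition \<open>R \<ge> 1\<close> is carried along because the growth hypothesis is
  formulated for such radii.\<close>

definition admissible :: "real \<Rightarrow> (real^'n \<Rightarrow> real) \<Rightarrow> bool" where
  "admissible R w \<longleftrightarrow> w \<in> borel_measurable M \<and> R \<ge> 1 \<and> (\<forall>x\<in>\<Omega>. \<bar>w x\<bar> \<le> R)"

definition FB :: "real \<Rightarrow> real" where "FB R = c * (1 + R powr (r - 1))"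

definition form :: "(real^'n \<Rightarrow> real) \<Rightarrow> (real^'n \<Rightarrow> real) \<Rightarrow> (real^'n \<Rightarrow> real) \<Rightarrow> real" where
  "form w \<phi> \<psi> = (\<integral>x. field (w x) (grad \<phi> x) \<bullet> grad \<psi> x - f x (w x) * \<psi> x \<partial>M)"

text \<open>One-sided on purpose: minimisation yields a lower bound directly, and testing with the
  negative restores the absolute value. The single tolerance \<theta> serves all test functions
  simultaneously.\<close>

definition approx_sol :: "(real^'n \<Rightarrow> real) \<Rightarrow> real \<Rightarrow> (real^'n \<Rightarrow> real) \<Rightarrow> bool" where
  "approx_sol w \<theta> \<phi> \<longleftrightarrow> test_fun \<Omega> \<phi> \<and> (\<forall>\<psi>. test_fun \<Omega> \<psi> \<longrightarrow> - \<theta> * (1 + energy \<psi>) \<le> form w \<phi> \<psi>)"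

definition functional :: "(real^'n \<Rightarrow> real) \<Rightarrow> (real^'n \<Rightarrow> real) \<Rightarrow> real" where
  "functional w \<phi> = (\<integral>x. potential (w x) (grad \<phi> x) - f x (w x) * \<phi> x \<partial>M)"

lemma FB_pos: "FB R > 0"
  unfolding FB_def using c_pos by (intro mult_pos_pos) (auto simp: add_pos_nonneg)

lemma admissible_bound: "admissible R w \<Longrightarrow> x \<in> \<Omega> \<Longrightarrow> \<bar>f x (w x)\<bar> \<le> FB R"
  unfolding FB_def admissible_def by (intro growth) auto

lemma rhs_measurable: "admissible R w \<Longrightarrow> (\<lambda>x. f x (w x)) \<in> borel_measurable M"
  unfolding admissible_def by (rule caratheodory_measurable[OF Omega_lebesgue cara]) simp

lemma integrable_rhs:
  assumes "admissible R w" "test_fun \<Omega> \<psi>"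
  shows "integrable M (\<lambda>x. f x (w x) * \<psi> x)"
proof -
  obtain B where B: "B > 0" "\<And>x. \<bar>\<psi> x\<bar> \<le> B" using test_fun_bounded[OF assms(2)] by metis
  have "\<bar>f x (w x) * \<psi> x\<bar> \<le> FB R * B" if "x \<in> \<Omega>" for x
    unfolding abs_mult using admissible_bound[OF assms(1) that] B by (intro mult_mono) auto
  then show ?thesis
    using rhs_measurable[OF assms(1)] test_fun_measurable_M(1)[OF assms(2)]
    by (intro integrable_bounded) auto
qed

lemma field_grad_measurable:
  assumes "admissible R w" "test_fun \<Omega> \<phi>"
  shows "(\<lambda>x. field (w x) (grad \<phi> x)) \<in> borel_measurable M"
  by (rule field_measurable[OF _ test_fun_measurable_M(2)[OF assms(2)]])
     (use assms(1) in \<open>simp add: admissible_def\<close>)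

lemma field_grad_bounded:
  assumes "test_fun \<Omega> \<phi>"
  obtains B where "B > 0" "\<And>t x. norm (field t (grad \<phi> x)) \<le> B"
proof -
  obtain B where B: "B > 0" "\<And>x. norm (grad \<phi> x) \<le> B" using test_fun_bounded[OF assms] by metis
  show ?thesis
  proof (rule that)
    show "0 < (CARD('n) + \<epsilon>) * (1 + B) powr (q - 1)"
      using eps_pos B by (intro mult_pos_pos) auto
    fix t x
    have "norm (field t (grad \<phi> x)) \<le> (CARD('n) + \<epsilon>) * (1 + norm (grad \<phi> x)) powr (q - 1)"
      by (rule field_bound)
    also have "\<dots> \<le> (CARD('n) + \<epsilon>) * (1 + B) powr (q - 1)"
      using eps_pos B q_ge by (intro mult_left_mono powr_mono2) auto
    finally show "norm (field t (grad \<phi> x)) \<le> (CARD('n) + \<epsilon>) * (1 + B) powr (q - 1)" .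
  qed
qed

lemma integrable_field:
  assumes "admissible R w" "test_fun \<Omega> \<phi>" "test_fun \<Omega> \<psi>"
  shows "integrable M (\<lambda>x. field (w x) (grad \<phi> x) \<bullet> grad \<psi> x)"
proof -
  obtain B where B: "B > 0" "\<And>x. norm (grad \<psi> x) \<le> B" using test_fun_bounded[OF assms(3)] by metis
  obtain D where D: "D > 0" "\<And>t x. norm (field t (grad \<phi> x)) \<le> D"
    using field_grad_bounded[OF assms(2)] by metis
  have "\<bar>field (w x) (grad \<phi> x) \<bullet> grad \<psi> x\<bar> \<le> D * B" for x
    using B D by (intro order_trans[OF Cauchy_Schwarz_ineq2] mult_mono) (auto intro: less_imp_le)
  then show ?thesis
    using field_grad_measurable[OF assms(1,2)] test_fun_measurable_M(2)[OF assms(3)]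
    by (intro integrable_bounded) auto
qed

lemma form_lincomb:
  assumes w: "admissible R w" and \<phi>: "test_fun \<Omega> \<phi>" and \<psi>: "test_fun \<Omega> \<psi>" "test_fun \<Omega> \<psi>'"
  shows "form w \<phi> (\<lambda>x. a * \<psi> x + b * \<psi>' x) = a * form w \<phi> \<psi> + b * form w \<phi> \<psi>'"
proof -
  have "form w \<phi> (\<lambda>x. a * \<psi> x + b * \<psi>' x) =
     (\<integral>x. a * (field (w x) (grad \<phi> x) \<bullet> grad \<psi> x - f x (w x) * \<psi> x)
        + b * (field (w x) (grad \<phi> x) \<bullet> grad \<psi>' x - f x (w x) * \<psi>' x) \<partial>M)"
    unfolding form_def grad_lincomb[OF \<psi>[THEN test_fun_smooth]]
    by (intro Bochner_Integration.integral_cong) (auto simp: inner_add_right algebra_simps)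
  also have "\<dots> = a * form w \<phi> \<psi> + b * form w \<phi> \<psi>'"
    unfolding form_def using integrable_field[OF w \<phi>] integrable_rhs[OF w] \<psi>
    by (subst Bochner_Integration.integral_add) auto
  finally show ?thesis .
qed

lemma form_minus:
  assumes "admissible R w" "test_fun \<Omega> \<phi>" "test_fun \<Omega> \<psi>"
  shows "form w \<phi> (\<lambda>x. - \<psi> x) = - form w \<phi> \<psi>"
  using form_lincomb[OF assms assms(3), of "-1" 0] by simp

lemma test_fun_minus: "test_fun \<Omega> \<psi> \<Longrightarrow> test_fun \<Omega> (\<lambda>x. - \<psi> x)"
  using test_fun_scale[of \<Omega> \<psi> "-1"] by simp

lemma energy_minus: "test_fun \<Omega> \<psi> \<Longrightarrow> energy (\<lambda>x. - \<psi> x) = energy \<psi>"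
  using energy_scale[of \<psi> "-1"] by simp

lemma approx_sol_abs:
  assumes "admissible R w" "approx_sol w \<theta> \<phi>" "test_fun \<Omega> \<psi>"
  shows "\<bar>form w \<phi> \<psi>\<bar> \<le> \<theta> * (1 + energy \<psi>)"
proof -
  have \<phi>: "test_fun \<Omega> \<phi>" using assms(2) by (simp add: approx_sol_def)
  have "- \<theta> * (1 + energy \<psi>) \<le> form w \<phi> \<psi>"
    using assms(2,3) by (simp add: approx_sol_def)
  moreover have "- \<theta> * (1 + energy (\<lambda>x. - \<psi> x)) \<le> form w \<phi> (\<lambda>x. - \<psi> x)"
    using assms(2) test_fun_minus[OF assms(3)] unfolding approx_sol_def by blast
  ultimately show ?thesis
    using form_minus[OF assms(1) \<phi> assms(3)] energy_minus[OF assms(3)] by simp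
qed

lemma approx_sol_mono:
  assumes "approx_sol w \<theta> \<phi>" "\<theta> \<le> \<theta>'"
  shows "approx_sol w \<theta>' \<phi>"
  unfolding approx_sol_def
proof (intro conjI allI impI)
  show "test_fun \<Omega> \<phi>" using assms by (simp add: approx_sol_def)
  fix \<psi> assume "test_fun \<Omega> \<psi>"
  then have "- \<theta> * (1 + energy \<psi>) \<le> form w \<phi> \<psi>" using assms by (simp add: approx_sol_def)
  moreover have "\<theta> * (1 + energy \<psi>) \<le> \<theta>' * (1 + energy \<psi>)"
    using assms by (intro mult_right_mono) auto
  ultimately show "- \<theta>' * (1 + energy \<psi>) \<le> form w \<phi> \<psi>" by simp
qed

lemma integrable_potential:
  assumes "admissible R w" "test_fun \<Omega> \<phi>"
  shows "integrable M (\<lambda>x. potential (w x) (grad \<phi> x))"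
proof -
  obtain B where B: "B > 0" "\<And>x. norm (grad \<phi> x) \<le> B" using test_fun_bounded[OF assms(2)] by metis
  have "\<bar>potential (w x) (grad \<phi> x)\<bar> \<le> (CARD('n) + \<epsilon>) * (1 + B powr q)" for x
  proof -
    have "0 \<le> \<epsilon> / q * norm (grad \<phi> x) powr q" using eps_pos q_ge by simp
    also have "\<dots> \<le> potential (w x) (grad \<phi> x)" by (rule potential_ge)
    finally have "\<bar>potential (w x) (grad \<phi> x)\<bar> = potential (w x) (grad \<phi> x)" by simp
    also have "\<dots> \<le> (CARD('n) + \<epsilon>) * (1 + norm (grad \<phi> x) powr q)" by (rule potential_bound)
    also have "\<dots> \<le> (CARD('n) + \<epsilon>) * (1 + B powr q)"
      using B eps_pos q_ge by (intro mult_left_mono add_left_mono powr_mono2) auto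
    finally show ?thesis .
  qed
  moreover have "(\<lambda>x. potential (w x) (grad \<phi> x)) \<in> borel_measurable M"
    using assms(1) test_fun_measurable_M[OF assms(2)]
    by (intro potential_measurable) (auto simp: admissible_def)
  ultimately show ?thesis by (intro integrable_bounded)
qed

lemma integral_rhs_bound:
  assumes w: "admissible R w" and \<phi>: "test_fun \<Omega> \<phi>"
  shows "\<bar>\<integral>x. f x (w x) * \<phi> x \<partial>M\<bar> \<le> FB R * measure M \<Omega> * CS * energy \<phi> powr (1 / q)"
proof -
  have "\<bar>\<integral>x. f x (w x) * \<phi> x \<partial>M\<bar> \<le> (\<integral>x. \<bar>f x (w x) * \<phi> x\<bar> \<partial>M)"
    by (rule integral_abs_bound)
  also have "\<dots> \<le> (\<integral>x. FB R * (CS * energy \<phi> powr (1 / q)) \<partial>M)"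
  proof (rule integral_mono)
    fix x assume "x \<in> space M"
    then show "\<bar>f x (w x) * \<phi> x\<bar> \<le> FB R * (CS * energy \<phi> powr (1 / q))"
      unfolding abs_mult using admissible_bound[OF w] sup_bound[OF \<phi>, of x] FB_pos[of R]
      by (intro mult_mono) auto
  qed (use integrable_rhs[OF w \<phi>] in auto)
  finally show ?thesis by (simp add: mult_ac)
qed

text \<open>The linear term grows only like the \<open>q\<close>-th root of the energy, so Young's
  inequality absorbs it into half of the coercive term.\<close>

lemma functional_coercive:
  assumes w: "admissible R w"
  obtains C where "C > 0" "\<And>\<phi>. test_fun \<Omega> \<phi> \<Longrightarrow> functional w \<phi> \<ge> \<epsilon> / (2 * q) * energy \<phi> - C"
proof -
  define K where "K = FB R * measure M \<Omega> * CS"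
  have K: "K \<ge> 0" using FB_pos[of R] CS_ge by (simp add: K_def)
  \<comment> \<open>Makes \<open>K * m powr (q - 1)\<close> at most \<epsilon> / (2 q), half of the
    coercivity constant; the \<open>+ 1\<close> guards against \<open>K = 0\<close>.\<close>
  define m where "m = (\<epsilon> / (2 * q * (K + 1))) powr (1 / (q - 1))"
  have m: "m > 0" using eps_pos q_ge K by (simp add: m_def)
  have "K * m powr (q - 1) = K * (\<epsilon> / (2 * q * (K + 1)))"
    using eps_pos q_ge K by (simp add: m_def powr_powr)
  also have "\<dots> \<le> (K + 1) * (\<epsilon> / (2 * q * (K + 1)))"
    using eps_pos q_ge K by (intro mult_right_mono) auto
  also have "\<dots> = \<epsilon> / (2 * q)" using K by simp
  finally have Km: "K * m powr (q - 1) \<le> \<epsilon> / (2 * q)" .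
  show ?thesis
  proof (rule that[of "K / m + 1"])
    show "K / m + 1 > 0" using K m by (simp add: add_nonneg_pos)
    fix \<phi> assume \<phi>: "test_fun \<Omega> \<phi>"
    define X where "X = energy \<phi> powr (1 / q)"
    have X: "X \<ge> 0" "X powr q = energy \<phi>"
      using q_ge by (auto simp: X_def powr_powr)
    have "K * X \<le> K * (1 / m + m powr (q - 1) * X powr q)"
      using X K m q_ge by (intro mult_left_mono le_inverse_plus_powr) auto
    also have "\<dots> = K / m + K * m powr (q - 1) * energy \<phi>" using X by (simp add: distrib_left)
    also have "\<dots> \<le> K / m + \<epsilon> / (2 * q) * energy \<phi>"
      using Km by (intro add_left_mono mult_right_mono) auto
    finally have KX: "K * X \<le> K / m + \<epsilon> / (2 * q) * energy \<phi>" .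
    have "functional w \<phi> = (\<integral>x. potential (w x) (grad \<phi> x) \<partial>M) - (\<integral>x. f x (w x) * \<phi> x \<partial>M)"
      unfolding functional_def using integrable_potential[OF w \<phi>] integrable_rhs[OF w \<phi>] by simp
    moreover have "(\<integral>x. potential (w x) (grad \<phi> x) \<partial>M) \<ge> (\<integral>x. \<epsilon> / q * norm (grad \<phi> x) powr q \<partial>M)"
      using integrable_potential[OF w \<phi>] integrable_energy[OF \<phi>] potential_ge by (intro integral_mono) auto
    moreover have "\<bar>\<integral>x. f x (w x) * \<phi> x \<partial>M\<bar> \<le> K * X"
      using integral_rhs_bound[OF w \<phi>] by (simp add: K_def X_def)
    moreover have "(\<integral>x. \<epsilon> / q * norm (grad \<phi> x) powr q \<partial>M) = \<epsilon> / q * energy \<phi>"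
      by (simp add: energy_def)
    moreover have "\<epsilon> / q * energy \<phi> = \<epsilon> / (2 * q) * energy \<phi> + \<epsilon> / (2 * q) * energy \<phi>"
      by (simp add: field_simps)
    ultimately show "functional w \<phi> \<ge> \<epsilon> / (2 * q) * energy \<phi> - (K / m + 1)"
      using KX by linarith
  qed
qed

text \<open>The tangent inequality is taken at the displaced point and read at
  \<open>\<phi>\<close>. If \<open>\<phi>\<close> is within \<open>\<eta>\<close> of the infimum, it
  gives \<open>t * form w (\<lambda>x. \<phi> x + t * \<psi> x) \<psi> \<ge> -\<eta>\<close> without
  differentiating the functional.\<close>

lemma functional_tangent:
  assumes w: "admissible R w" and \<phi>: "test_fun \<Omega> \<phi>" and \<psi>: "test_fun \<Omega> \<psi>"
  shows "functional w (\<lambda>x. \<phi> x + t * \<psi> x) - t * form w (\<lambda>x. \<phi> x + t * \<psi> x) \<psi> \<le> functional w \<phi>"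
proof -
  let ?\<chi> = "\<lambda>x. \<phi> x + t * \<psi> x"
  have \<chi>: "test_fun \<Omega> ?\<chi>" using test_fun_add_scale[OF \<phi> \<psi>] .
  note g = grad_add_scale[OF test_fun_smooth[OF \<phi>] test_fun_smooth[OF \<psi>], of t]
  note ints = integrable_potential[OF w \<chi>] integrable_potential[OF w \<phi>] integrable_rhs[OF w \<chi>]
    integrable_rhs[OF w \<psi>] integrable_rhs[OF w \<phi>] integrable_field[OF w \<chi> \<psi>]
  have "functional w ?\<chi> - t * form w ?\<chi> \<psi> = (\<integral>x. (potential (w x) (grad ?\<chi> x) - f x (w x) * ?\<chi> x)
      - t * (field (w x) (grad ?\<chi> x) \<bullet> grad \<psi> x - f x (w x) * \<psi> x) \<partial>M)"
    unfolding functional_def form_def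
    by (subst Bochner_Integration.integral_diff) (use ints in auto)
  also have "\<dots> \<le> functional w \<phi>"
    unfolding functional_def
  proof (rule integral_mono)
    fix x
    have "potential (w x) (grad ?\<chi> x) + field (w x) (grad ?\<chi> x) \<bullet> (grad \<phi> x - grad ?\<chi> x) \<le> potential (w x) (grad \<phi> x)"
      by (rule potential_tangent)
    then show "(potential (w x) (grad ?\<chi> x) - f x (w x) * ?\<chi> x)
      - t * (field (w x) (grad ?\<chi> x) \<bullet> grad \<psi> x - f x (w x) * \<psi> x)
      \<le> potential (w x) (grad \<phi> x) - f x (w x) * \<phi> x"
      by (simp add: g algebra_simps)
  qed (use ints in auto)
  finally show ?thesis .
qed

text \<open>Brings the information from the displaced point back to \<open>\<phi>\<close>, at a cost
  linear in \<open>t\<close>.\<close>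

lemma form_increment:
  assumes w: "admissible R w" and \<phi>: "test_fun \<Omega> \<phi>" and \<psi>: "test_fun \<Omega> \<psi>" and t: "0 \<le> t" "t \<le> 1"
  shows "\<bar>form w (\<lambda>x. \<phi> x + t * \<psi> x) \<psi> - form w \<phi> \<psi>\<bar>
     \<le> t * ((CARD('n) + \<epsilon>) * (q - 1) * (measure M \<Omega> + 2 powr q * (energy \<phi> + energy \<psi>)))"
proof -
  let ?\<chi> = "\<lambda>x. \<phi> x + t * \<psi> x"
  have \<chi>: "test_fun \<Omega> ?\<chi>" using test_fun_add_scale[OF \<phi> \<psi>] .
  note g = grad_add_scale[OF test_fun_smooth[OF \<phi>] test_fun_smooth[OF \<psi>], of t]
  note ints = integrable_rhs[OF w \<psi>] integrable_field[OF w \<chi> \<psi>] integrable_field[OF w \<phi> \<psi>]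
  define L where "L = (CARD('n) + \<epsilon>) * (q - 1)"
  note E = integrable_energy[OF \<phi>] integrable_energy[OF \<psi>]
  have i2: "integrable M (\<lambda>x. 2 powr q * (norm (grad \<phi> x) powr q + norm (grad \<psi> x) powr q))"
    by (rule integrable_mult_right) (rule Bochner_Integration.integrable_add[OF E])
  have iE: "integrable M (\<lambda>x. 1 + 2 powr q * (norm (grad \<phi> x) powr q + norm (grad \<psi> x) powr q))"
    by (rule Bochner_Integration.integrable_add[OF integrable_const i2])
  have iT: "integrable M (\<lambda>x. t * (L * (1 + 2 powr q * (norm (grad \<phi> x) powr q + norm (grad \<psi> x) powr q))))"
    using iE by (simp only: integrable_mult_right)
  have le: "\<bar>(field (w x) (grad ?\<chi> x) - field (w x) (grad \<phi> x)) \<bullet> grad \<psi> x\<bar>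
      \<le> t * (L * (1 + 2 powr q * (norm (grad \<phi> x) powr q + norm (grad \<psi> x) powr q)))" for x
    unfolding g L_def by (rule field_increment[OF t])
  have iA: "integrable M (\<lambda>x. \<bar>(field (w x) (grad ?\<chi> x) - field (w x) (grad \<phi> x)) \<bullet> grad \<psi> x\<bar>)"
    unfolding inner_diff_left by (rule integrable_abs[OF Bochner_Integration.integrable_diff[OF ints(2,3)]])
  have eq: "form w ?\<chi> \<psi> - form w \<phi> \<psi> = (\<integral>x. (field (w x) (grad ?\<chi> x) - field (w x) (grad \<phi> x)) \<bullet> grad \<psi> x \<partial>M)"
    unfolding form_def using ints
    by (subst Bochner_Integration.integral_diff[symmetric]) (auto simp: inner_diff_left)
  have "\<bar>form w ?\<chi> \<psi> - form w \<phi> \<psi>\<bar> \<le> (\<integral>x. \<bar>(field (w x) (grad ?\<chi> x) - field (w x) (grad \<phi> x)) \<bullet> grad \<psi> x\<bar> \<partial>M)"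
    unfolding eq by (rule integral_abs_bound)
  also have "\<dots> \<le> (\<integral>x. t * (L * (1 + 2 powr q * (norm (grad \<phi> x) powr q + norm (grad \<psi> x) powr q))) \<partial>M)"
    by (rule integral_mono[OF iA iT le])
  also have "\<dots> = t * (L * (measure M \<Omega> + 2 powr q * (energy \<phi> + energy \<psi>)))"
    unfolding integral_mult_right_zero Bochner_Integration.integral_add[OF integrable_const i2]
      Bochner_Integration.integral_add[OF E] energy_def by simp
  finally show ?thesis by (simp add: L_def)
qed

text \<open>A near-minimiser of the convex functional is an approximate critical point, uniformly over
  directions of bounded energy; this replaces the exact minimiser and keeps everything inside the
  space of test functions.\<close>
lemma approx_sol_exists:
  assumes w: "admissible R w" and \<theta>: "\<theta> > 0"
  shows "\<exists>\<phi>. approx_sol w \<theta> \<phi>"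
proof -
  obtain C where C: "C > 0" "\<And>\<phi>. test_fun \<Omega> \<phi> \<Longrightarrow> functional w \<phi> \<ge> \<epsilon> / (2 * q) * energy \<phi> - C"
    using functional_coercive[OF w] by blast
  define V where "V = functional w ` {\<phi>. test_fun \<Omega> \<phi>}"
  define m where "m = Inf V"
  have bb: "bdd_below V"
  proof (rule bdd_belowI[of _ "-C"])
    fix v assume "v \<in> V"
    then obtain \<phi> where \<phi>: "test_fun \<Omega> \<phi>" "v = functional w \<phi>" by (auto simp: V_def)
    have "0 \<le> \<epsilon> / (2 * q) * energy \<phi>" using eps_pos q_ge by simp
    then show "- C \<le> v" using C(2)[OF \<phi>(1)] \<phi>(2) by linarith
  qed
  have "functional w (\<lambda>x. 0) = 0" by (simp add: functional_def)
  then have V0: "0 \<in> V" unfolding V_def by (metis (mono_tags) image_eqI mem_Collect_eq test_fun_zero)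
  have m_le: "m \<le> functional w \<phi>" if "test_fun \<Omega> \<phi>" for \<phi>
    unfolding m_def using that bb by (intro cInf_lower) (auto simp: V_def)
  have m0: "m \<le> 0" unfolding m_def using V0 bb by (rule cInf_lower)
  define L where "L = (CARD('n) + \<epsilon>) * (q - 1)"
  have L: "L \<ge> 0" using eps_pos q_ge by (simp add: L_def)
  \<comment> \<open>Bounds the energy of every function whose functional value is below 1. It is
    independent of \<open>\<phi>\<close>, so \<open>t\<close> and \<open>\<eta>\<close> can be fixed
    before \<open>\<phi>\<close> is chosen.\<close>
  define E0 where "E0 = (1 + C) * (2 * q) / \<epsilon>"
  have E0: "E0 \<ge> 0" using C eps_pos q_ge by (simp add: E0_def)
  define C5 where "C5 = L * (measure M \<Omega> + 2 powr q * (E0 + 1)) + 1"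
  have C5: "C5 > 0" using L E0 by (simp add: C5_def add_nonneg_pos)
  \<comment> \<open>The tolerance is spent in two halves: \<open>t * C5\<close> pays for returning
    from the displaced point, and \<open>\<eta> / t\<close> pays for missing the infimum.\<close>
  define t where "t = min 1 (\<theta> / (2 * C5))"
  have t: "0 < t" "t \<le> 1" "t * C5 \<le> \<theta> / 2"
    using \<theta> C5 by (auto simp: t_def min_def field_simps)
  define \<eta> where "\<eta> = min 1 (t * (\<theta> / 2))"
  have \<eta>: "\<eta> > 0" "\<eta> \<le> 1" "\<eta> / t \<le> \<theta> / 2"
    using \<theta> t by (auto simp: \<eta>_def pos_divide_le_eq mult.commute)
  have "\<exists>v\<in>V. v < m + \<eta>"
    using cInf_lessD[of V "m + \<eta>"] V0 \<eta> by (auto simp: m_def)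
  then obtain \<phi> where \<phi>: "test_fun \<Omega> \<phi>" "functional w \<phi> < m + \<eta>" by (auto simp: V_def)
  have E: "energy \<phi> \<le> E0"
  proof -
    have "\<epsilon> / (2 * q) * energy \<phi> \<le> 1 + C" using C(2)[OF \<phi>(1)] \<phi>(2) m0 \<eta> by linarith
    then show ?thesis using eps_pos q_ge by (simp add: E0_def field_simps)
  qed
  have "approx_sol w \<theta> \<phi>"
    unfolding approx_sol_def
  proof (intro conjI allI impI \<phi>(1))
    fix \<psi> assume \<psi>: "test_fun \<Omega> \<psi>"
    let ?\<chi> = "\<lambda>x. \<phi> x + t * \<psi> x"
    have "m \<le> functional w ?\<chi>" by (intro m_le test_fun_add_scale \<phi> \<psi>)
    then have "- \<eta> \<le> t * form w ?\<chi> \<psi>"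
      using functional_tangent[OF w \<phi>(1) \<psi>, of t] \<phi>(2) by linarith
    then have 1: "- (\<eta> / t) \<le> form w ?\<chi> \<psi>" using t by (simp add: field_simps)
    have "measure M \<Omega> + 2 powr q * (energy \<phi> + energy \<psi>) \<le> (measure M \<Omega> + 2 powr q * (E0 + 1)) * (1 + energy \<psi>)"
    proof -
      have "measure M \<Omega> + 2 powr q * (energy \<phi> + energy \<psi>) \<le> measure M \<Omega> + 2 powr q * (E0 + energy \<psi>)"
        using E by simp
      also have "\<dots> \<le> measure M \<Omega> * (1 + energy \<psi>) + 2 powr q * ((E0 + 1) * (1 + energy \<psi>))"
        using E0 by (intro add_mono mult_left_mono) (auto simp: algebra_simps)
      finally show ?thesis by (simp add: algebra_simps)
    qed
    then have "L * (measure M \<Omega> + 2 powr q * (energy \<phi> + energy \<psi>))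
       \<le> L * ((measure M \<Omega> + 2 powr q * (E0 + 1)) * (1 + energy \<psi>))"
      using L by (intro mult_left_mono)
    also have "\<dots> \<le> C5 * (1 + energy \<psi>)"
      unfolding C5_def mult.assoc[symmetric] by (intro mult_right_mono) auto
    finally have "t * (L * (measure M \<Omega> + 2 powr q * (energy \<phi> + energy \<psi>))) \<le> t * (C5 * (1 + energy \<psi>))"
      using t by (intro mult_left_mono) auto
    also have "\<dots> \<le> \<theta> / 2 * (1 + energy \<psi>)"
      unfolding mult.assoc[symmetric] using t by (intro mult_right_mono) auto
    finally have "\<bar>form w ?\<chi> \<psi> - form w \<phi> \<psi>\<bar> \<le> \<theta> / 2 * (1 + energy \<psi>)"
      using form_increment[OF w \<phi>(1) \<psi>, of t] t by (simp add: L_def)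
    have "\<eta> / t \<le> \<theta> / 2 * (1 + energy \<psi>)"
      using \<eta> \<theta> by (intro order_trans[OF \<eta>(3)]) (simp add: algebra_simps)
    show "- \<theta> * (1 + energy \<psi>) \<le> form w \<phi> \<psi>"
    proof -
      have "- \<theta> * (1 + energy \<psi>) = - (\<theta> / 2 * (1 + energy \<psi>)) - \<theta> / 2 * (1 + energy \<psi>)"
        by (simp add: algebra_simps)
      then show ?thesis
        using 1 \<open>\<eta> / t \<le> \<theta> / 2 * (1 + energy \<psi>)\<close>
          \<open>\<bar>form w ?\<chi> \<psi> - form w \<phi> \<psi>\<bar> \<le> \<theta> / 2 * (1 + energy \<psi>)\<close> by linarith
    qed
  qed
  then show ?thesis by blast
qed


subsection \<open>Stability of approximate solutions\<close>

text \<open>The point is uniformity: the index does not depend on \<open>\<psi>\<close>. Since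
  \<open>\<phi>\<close> is fixed, its fluxes are bounded, and dominated convergence acts on the
  coefficients \<open>d\<close> and \<open>e\<close> alone; \<open>\<psi>\<close> enters only
  through its energy.\<close>

lemma form_stability:
  assumes wn: "\<And>n. admissible R (w n)" and w: "admissible R v"
    and lim: "\<And>x. x \<in> \<Omega> \<Longrightarrow> (\<lambda>n. w n x) \<longlonglongrightarrow> v x"
    and \<phi>: "test_fun \<Omega> \<phi>" and \<theta>: "\<theta> > 0"
  shows "\<forall>\<^sub>F n in sequentially. \<forall>\<psi>. test_fun \<Omega> \<psi> \<longrightarrow> \<bar>form (w n) \<phi> \<psi> - form v \<phi> \<psi>\<bar> \<le> \<theta> * (1 + energy \<psi>)"
proof -
  obtain B where B: "B > 0" "\<And>t x. norm (field t (grad \<phi> x)) \<le> B"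
    using field_grad_bounded[OF \<phi>] by metis
  define d where "d n x = norm (field (w n x) (grad \<phi> x) - field (v x) (grad \<phi> x))" for n x
  define e where "e n x = \<bar>f x (w n x) - f x (v x)\<bar>" for n x
  have d_bound: "0 \<le> d n x" "d n x \<le> 2 * B" for n x
    using norm_triangle_ineq4[of "field (w n x) (grad \<phi> x)" "field (v x) (grad \<phi> x)"]
      B(2)[of "w n x" x] B(2)[of "v x" x] by (simp_all add: d_def)
  have e_bound: "0 \<le> e n x" "x \<in> \<Omega> \<Longrightarrow> e n x \<le> 2 * FB R" for n x
    using admissible_bound[OF wn, of x n] admissible_bound[OF w, of x] by (simp_all add: e_def)
  have d_meas: "d n \<in> borel_measurable M" for n
    unfolding d_def using field_grad_measurable[OF wn \<phi>] field_grad_measurable[OF w \<phi>] by simp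
  have e_meas: "e n \<in> borel_measurable M" for n
    unfolding e_def using rhs_measurable[OF wn] rhs_measurable[OF w] by simp
  have d_int: "integrable M (d n)" for n
    using d_meas d_bound by (intro integrable_bounded[where B = "2 * B"]) auto
  have e_int: "integrable M (e n)" for n
    using e_meas e_bound by (intro integrable_bounded[where B = "2 * FB R"]) auto
  have d_lim: "(\<lambda>n. \<integral>x. d n x \<partial>M) \<longlonglongrightarrow> 0"
  proof -
    have "(\<lambda>n. \<integral>x. d n x \<partial>M) \<longlonglongrightarrow> (\<integral>x. 0 \<partial>M)"
    proof (rule integral_dominated_convergence[where w = "\<lambda>x. 2 * B"])
      show "AE x in M. (\<lambda>n. d n x) \<longlonglongrightarrow> 0"
      proof (rule AE_I2)
        fix x assume "x \<in> space M"
        then have "(\<lambda>n. field (w n x) (grad \<phi> x)) \<longlonglongrightarrow> field (v x) (grad \<phi> x)"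
          by (intro tendsto_field lim tendsto_const) simp
        then show "(\<lambda>n. d n x) \<longlonglongrightarrow> 0"
          unfolding d_def by (simp add: LIM_zero tendsto_norm_zero)
      qed
    qed (use d_meas d_bound in auto)
    then show ?thesis by simp
  qed
  have e_lim: "(\<lambda>n. \<integral>x. e n x \<partial>M) \<longlonglongrightarrow> 0"
  proof -
    have "(\<lambda>n. \<integral>x. e n x \<partial>M) \<longlonglongrightarrow> (\<integral>x. 0 \<partial>M)"
    proof (rule integral_dominated_convergence[where w = "\<lambda>x. 2 * FB R"])
      have "AE x in M. continuous_on UNIV (f x)" using cara by (simp add: caratheodory_def)
      then show "AE x in M. (\<lambda>n. e n x) \<longlonglongrightarrow> 0"
        using AE_space
      proof eventually_elim
        case (elim x)
        have "(\<lambda>n. f x (w n x)) \<longlonglongrightarrow> f x (v x)"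
          using elim by (intro continuous_on_tendsto_compose[OF elim(1)] lim) auto
        then show ?case
          unfolding e_def by (simp add: LIM_zero tendsto_rabs_zero)
      qed
      show "AE x in M. norm (e n x) \<le> 2 * FB R" for n
        using e_bound by (intro AE_I2) auto
    qed (use e_meas in auto)
    then show ?thesis by simp
  qed
  \<comment> \<open>Chosen so that the gradient part of Young's inequality costs exactly half of the
    tolerance; the rest is multiplied by integrals that tend to 0.\<close>
  define m where "m = (\<theta> / (4 * B)) powr (1 / (q - 1))"
  have m: "m > 0" using \<theta> B by (simp add: m_def)
  have mq: "2 * B * m powr (q - 1) = \<theta> / 2"
    using \<theta> B q_ge by (simp add: m_def powr_powr)
  have "(\<lambda>n. (1 / m) * (\<integral>x. d n x \<partial>M) + CS * (\<integral>x. e n x \<partial>M)) \<longlonglongrightarrow> (1 / m) * 0 + CS * 0"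
    by (intro tendsto_intros d_lim e_lim)
  then have "\<forall>\<^sub>F n in sequentially. (1 / m) * (\<integral>x. d n x \<partial>M) + CS * (\<integral>x. e n x \<partial>M) < \<theta> / 2"
    using \<theta> by (intro order_tendstoD) auto
  then show ?thesis
  proof eventually_elim
    case (elim n)
    show ?case
    proof (intro allI impI)
      fix \<psi> assume \<psi>: "test_fun \<Omega> \<psi>"
      define S where "S = CS * (1 + energy \<psi>)"
      note i = integrable_field[OF wn \<phi> \<psi>, of n] integrable_rhs[OF wn \<psi>, of n]
        integrable_field[OF w \<phi> \<psi>] integrable_rhs[OF w \<psi>]
      note E = integrable_energy[OF \<psi>]
      let ?h = "\<lambda>x. (field (w n x) (grad \<phi> x) \<bullet> grad \<psi> x - f x (w n x) * \<psi> x)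
        - (field (v x) (grad \<phi> x) \<bullet> grad \<psi> x - f x (v x) * \<psi> x)"
      let ?g = "\<lambda>x. ((1 / m) * d n x + (\<theta> / 2) * norm (grad \<psi> x) powr q) + S * e n x"
      note i12 = Bochner_Integration.integrable_diff[OF i(1,2)]
      note i34 = Bochner_Integration.integrable_diff[OF i(3,4)]
      note ih = Bochner_Integration.integrable_diff[OF i12 i34]
      have h_eq: "form (w n) \<phi> \<psi> - form v \<phi> \<psi> = integral\<^sup>L M ?h"
        unfolding form_def by (rule Bochner_Integration.integral_diff[OF i12 i34, symmetric])
      have j1: "integrable M (\<lambda>x. (1 / m) * d n x)" by (rule integrable_mult_right) (rule d_int)
      have j2: "integrable M (\<lambda>x. (\<theta> / 2) * norm (grad \<psi> x) powr q)"
        by (rule integrable_mult_right) (rule E)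
      have j3: "integrable M (\<lambda>x. S * e n x)" by (rule integrable_mult_right) (rule e_int)
      note j12 = Bochner_Integration.integrable_add[OF j1 j2]
      note jg = Bochner_Integration.integrable_add[OF j12 j3]
      have le: "\<bar>?h x\<bar> \<le> ?g x" for x
      proof -
        have "?h x = (field (w n x) (grad \<phi> x) - field (v x) (grad \<phi> x)) \<bullet> grad \<psi> x - (f x (w n x) - f x (v x)) * \<psi> x"
          by (simp add: inner_diff_left algebra_simps)
        moreover have "\<bar>(field (w n x) (grad \<phi> x) - field (v x) (grad \<phi> x)) \<bullet> grad \<psi> x\<bar> \<le> d n x * norm (grad \<psi> x)"
          unfolding d_def by (rule Cauchy_Schwarz_ineq2)
        moreover have "\<bar>(f x (w n x) - f x (v x)) * \<psi> x\<bar> \<le> e n x * S"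
          unfolding abs_mult S_def e_def using sup_bound'[OF \<psi>, of x] by (intro mult_left_mono) auto
        moreover have "d n x * norm (grad \<psi> x) \<le> (1 / m) * d n x + (\<theta> / 2) * norm (grad \<psi> x) powr q"
        proof -
          have "d n x * norm (grad \<psi> x) \<le> d n x * (1 / m + m powr (q - 1) * norm (grad \<psi> x) powr q)"
            using d_bound m q_ge by (intro mult_left_mono le_inverse_plus_powr) auto
          also have "\<dots> = (1 / m) * d n x + d n x * (m powr (q - 1) * norm (grad \<psi> x) powr q)"
            by (simp add: distrib_left)
          also have "\<dots> \<le> (1 / m) * d n x + 2 * B * (m powr (q - 1) * norm (grad \<psi> x) powr q)"
            using d_bound by (intro add_left_mono mult_right_mono) auto
          finally show ?thesis unfolding mq[symmetric] by (simp add: mult.assoc)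
        qed
        ultimately show ?thesis by (simp only: mult.commute[of S])
      qed
      have "\<bar>integral\<^sup>L M ?h\<bar> \<le> (\<integral>x. \<bar>?h x\<bar> \<partial>M)" by (rule integral_abs_bound)
      also have "\<dots> \<le> integral\<^sup>L M ?g"
        by (rule integral_mono[OF integrable_abs[OF ih] jg le])
      also have "\<dots> = (1 / m) * (\<integral>x. d n x \<partial>M) + \<theta> / 2 * energy \<psi> + S * (\<integral>x. e n x \<partial>M)"
        unfolding Bochner_Integration.integral_add[OF j12 j3] Bochner_Integration.integral_add[OF j1 j2]
          integral_mult_right_zero energy_def ..
      also have "\<dots> \<le> ((1 / m) * (\<integral>x. d n x \<partial>M) + CS * (\<integral>x. e n x \<partial>M)) * (1 + energy \<psi>) + \<theta> / 2 * energy \<psi>"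
      proof -
        have "0 \<le> (1 / m) * (\<integral>x. d n x \<partial>M) * energy \<psi>"
          using m d_bound by (intro mult_nonneg_nonneg integral_nonneg_AE) auto
        then show ?thesis by (simp add: S_def algebra_simps add_divide_distrib)
      qed
      also have "\<dots> \<le> \<theta> / 2 * (1 + energy \<psi>) + \<theta> / 2 * (1 + energy \<psi>)"
        using elim \<theta> by (intro add_mono mult_right_mono mult_left_mono) auto
      finally show "\<bar>form (w n) \<phi> \<psi> - form v \<phi> \<psi>\<bar> \<le> \<theta> * (1 + energy \<psi>)"
        unfolding h_eq by (simp add: field_simps)
    qed
  qed
qed

lemma approx_sol_stable:
  assumes "\<And>n. admissible R (w n)" "admissible R v" "\<And>x. x \<in> \<Omega> \<Longrightarrow> (\<lambda>n. w n x) \<longlonglongrightarrow> v x"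
    and \<phi>: "approx_sol v \<theta> \<phi>" and \<theta>: "\<theta> > 0"
  shows "\<forall>\<^sub>F n in sequentially. approx_sol (w n) (2 * \<theta>) \<phi>"
proof -
  have t: "test_fun \<Omega> \<phi>" using \<phi> by (simp add: approx_sol_def)
  have "\<forall>\<^sub>F n in sequentially. \<forall>\<psi>. test_fun \<Omega> \<psi> \<longrightarrow> \<bar>form (w n) \<phi> \<psi> - form v \<phi> \<psi>\<bar> \<le> \<theta> * (1 + energy \<psi>)"
    by (rule form_stability[OF assms(1-3) t \<theta>])
  then show ?thesis
  proof eventually_elim
    case (elim n)
    show ?case
      unfolding approx_sol_def
    proof (intro conjI allI impI t)
      fix \<psi> assume \<psi>: "test_fun \<Omega> \<psi>"
      have "\<bar>form (w n) \<phi> \<psi> - form v \<phi> \<psi>\<bar> \<le> \<theta> * (1 + energy \<psi>)" using elim \<psi> by simp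
      moreover have "- \<theta> * (1 + energy \<psi>) \<le> form v \<phi> \<psi>" using \<phi> \<psi> by (simp add: approx_sol_def)
      ultimately show "- (2 * \<theta>) * (1 + energy \<psi>) \<le> form (w n) \<phi> \<psi>" by (simp add: algebra_simps)
    qed
  qed
qed

definition \<kappa> :: real where "\<kappa> = \<epsilon> * 2 powr (1 - q)"

lemma kappa_pos: "\<kappa> > 0" using eps_pos by (simp add: \<kappa>_def)

text \<open>Test both residuals with the difference and use strong monotonicity:
  \<open>\<kappa>\<close> times its energy is at most \<open>2 * \<theta> * (1 + energy)\<close>,
  and \<open>\<theta> \<le> \<kappa> / 4\<close> absorbs the energy on the right.\<close>

lemma approx_sol_compare:
  assumes v: "admissible R v" and \<phi>: "approx_sol v \<theta> \<phi>" and \<psi>: "approx_sol v \<theta> \<psi>"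
    and \<theta>: "0 < \<theta>" "\<theta> \<le> \<kappa> / 4"
  shows "energy (\<lambda>x. \<phi> x - \<psi> x) \<le> 4 * \<theta> / \<kappa>"
proof -
  have t: "test_fun \<Omega> \<phi>" "test_fun \<Omega> \<psi>" using \<phi> \<psi> by (auto simp: approx_sol_def)
  let ?d = "\<lambda>x. \<phi> x - \<psi> x"
  have d: "test_fun \<Omega> ?d" by (rule test_fun_diff[OF t])
  note g = grad_diff[OF t[THEN test_fun_smooth]]
  note i = integrable_field[OF v t(1) d] integrable_field[OF v t(2) d] integrable_rhs[OF v d]
  have iE: "integrable M (\<lambda>x. \<kappa> * norm (grad ?d x) powr q)"
    by (rule integrable_mult_right) (rule integrable_energy[OF d])
  have "\<kappa> * energy ?d = (\<integral>x. \<kappa> * norm (grad ?d x) powr q \<partial>M)"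
    unfolding energy_def integral_mult_right_zero ..
  also have "\<dots> \<le> (\<integral>x. field (v x) (grad \<phi> x) \<bullet> grad ?d x - field (v x) (grad \<psi> x) \<bullet> grad ?d x \<partial>M)"
  proof (rule integral_mono[OF iE Bochner_Integration.integrable_diff[OF i(1,2)]])
    fix x
    show "\<kappa> * norm (grad ?d x) powr q \<le> field (v x) (grad \<phi> x) \<bullet> grad ?d x - field (v x) (grad \<psi> x) \<bullet> grad ?d x"
      using field_strongly_monotone[of "grad \<phi> x" "grad \<psi> x" "v x"]
      unfolding g \<kappa>_def inner_diff_left .
  qed
  also have "\<dots> = form v \<phi> ?d - form v \<psi> ?d"
    unfolding form_def Bochner_Integration.integral_diff[OF i(1,2)]
      Bochner_Integration.integral_diff[OF i(1,3)] Bochner_Integration.integral_diff[OF i(2,3)] by simp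
  also have "\<dots> \<le> \<theta> * (1 + energy ?d) + \<theta> * (1 + energy ?d)"
    using approx_sol_abs[OF v \<phi> d] approx_sol_abs[OF v \<psi> d] by linarith
  also have "\<dots> \<le> 2 * \<theta> + \<kappa> / 2 * energy ?d"
  proof -
    have "2 * \<theta> * energy ?d \<le> \<kappa> / 2 * energy ?d" using \<theta> by (intro mult_right_mono) auto
    then show ?thesis by (simp add: algebra_simps)
  qed
  finally show ?thesis using kappa_pos by (simp add: field_simps)
qed

text \<open>The uniform distance that the Morrey bound allows between two \<theta>-approximate
  solutions of one frozen problem.\<close>

definition rad :: "real \<Rightarrow> real" where "rad \<theta> = CS * (4 * \<theta> / \<kappa>) powr (1 / q)"

lemma approx_sol_close:
  assumes v: "admissible R v" and \<phi>: "approx_sol v \<theta> \<phi>" and \<psi>: "approx_sol v \<theta> \<psi>"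
    and \<theta>: "0 < \<theta>" "\<theta> \<le> \<kappa> / 4"
  shows "\<bar>\<phi> x - \<psi> x\<bar> \<le> rad \<theta>"
proof -
  have t: "test_fun \<Omega> \<phi>" "test_fun \<Omega> \<psi>" using \<phi> \<psi> by (auto simp: approx_sol_def)
  have "\<bar>\<phi> x - \<psi> x\<bar> \<le> CS * energy (\<lambda>x. \<phi> x - \<psi> x) powr (1 / q)"
    using sup_bound[OF test_fun_diff[OF t]] by simp
  also have "\<dots> \<le> rad \<theta>"
    unfolding rad_def using CS_ge q_ge approx_sol_compare[OF assms]
    by (intro mult_left_mono powr_mono2) auto
  finally show ?thesis .
qed

lemma rad_small:
  assumes "\<eta> > 0"
  obtains \<theta> where "0 < \<theta>" "\<theta> \<le> \<kappa> / 4" "rad \<theta> \<le> \<eta>"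
proof -
  define \<theta> where "\<theta> = min (\<kappa> / 4) (\<kappa> / 4 * (\<eta> / CS) powr q)"
  have CS: "CS > 0" using CS_ge by simp
  have \<theta>: "0 < \<theta>" "\<theta> \<le> \<kappa> / 4" using kappa_pos assms CS by (auto simp: \<theta>_def)
  have "4 * \<theta> / \<kappa> \<le> (\<eta> / CS) powr q"
    using kappa_pos by (simp add: \<theta>_def min_def field_simps)
  then have "(4 * \<theta> / \<kappa>) powr (1 / q) \<le> ((\<eta> / CS) powr q) powr (1 / q)"
    using \<theta> kappa_pos q_ge by (intro powr_mono2) auto
  also have "\<dots> = \<eta> / CS" using q_ge assms CS by (simp add: powr_powr)
  finally have "rad \<theta> \<le> CS * (\<eta> / CS)"
    unfolding rad_def using CS by (intro mult_left_mono) auto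
  then show ?thesis using that \<theta> CS by simp
qed

text \<open>Approximate solutions with tolerances tending to 0 are uniformly Cauchy by
  \<open>approx_sol_close\<close>. Only closeness of the limit to every approximate solution is
  recorded; no derivative is attached to it at this stage.\<close>

lemma solution_exists:
  assumes v: "admissible R v"
  shows "\<exists>u. \<forall>\<theta> \<phi> x. 0 < \<theta> \<longrightarrow> \<theta> \<le> \<kappa> / 4 \<longrightarrow> approx_sol v \<theta> \<phi> \<longrightarrow> \<bar>\<phi> x - u x\<bar> \<le> rad \<theta>"
proof -
  define t where "t k = \<kappa> / 4 * inverse (real (Suc k))" for k
  have t: "t k > 0" for k using kappa_pos by (simp add: t_def)
  have t0: "t \<longlonglongrightarrow> 0"
    unfolding t_def using tendsto_mult_right_zero[OF LIMSEQ_inverse_real_of_nat] by blast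
  have "\<forall>k. \<exists>\<phi>. approx_sol v (t k) \<phi>" using approx_sol_exists[OF v t] by blast
  then obtain \<phi> where \<phi>: "\<And>k. approx_sol v (t k) (\<phi> k)" by metis
  have ev: "\<forall>\<^sub>F k in sequentially. approx_sol v \<theta> (\<phi> k)" if "\<theta> > 0" for \<theta>
    using order_tendstoD(2)[OF t0 that]
  proof eventually_elim
    case (elim k)
    then show ?case using approx_sol_mono[OF \<phi>[of k], of \<theta>] by simp
  qed
  have "Cauchy (\<lambda>k. \<phi> k x)" for x
  proof (rule metric_CauchyI)
    fix e :: real assume "e > 0"
    then obtain \<theta> where \<theta>: "0 < \<theta>" "\<theta> \<le> \<kappa> / 4" "rad \<theta> \<le> e / 2" using rad_small[of "e / 2"] by auto
    obtain N where N: "\<And>k. k \<ge> N \<Longrightarrow> approx_sol v \<theta> (\<phi> k)"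
      using ev[OF \<theta>(1)] unfolding eventually_sequentially by blast
    have "dist (\<phi> k x) (\<phi> l x) < e" if "k \<ge> N" "l \<ge> N" for k l
      using approx_sol_close[OF v N[OF that(1)] N[OF that(2)] \<theta>(1,2), of x] \<theta>(3) \<open>e > 0\<close>
      by (simp add: dist_real_def)
    then show "\<exists>N. \<forall>k\<ge>N. \<forall>l\<ge>N. dist (\<phi> k x) (\<phi> l x) < e" by blast
  qed
  then have "\<forall>x. \<exists>l. (\<lambda>k. \<phi> k x) \<longlonglongrightarrow> l" by (simp add: Cauchy_convergent_iff convergent_def)
  then obtain u where u: "\<And>x. (\<lambda>k. \<phi> k x) \<longlonglongrightarrow> u x" by metis
  have "\<bar>\<psi> x - u x\<bar> \<le> rad \<theta>" if \<theta>: "0 < \<theta>" "\<theta> \<le> \<kappa> / 4" and \<psi>: "approx_sol v \<theta> \<psi>" for \<theta> \<psi> x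
  proof (rule tendsto_upperbound)
    show "(\<lambda>k. \<bar>\<psi> x - \<phi> k x\<bar>) \<longlonglongrightarrow> \<bar>\<psi> x - u x\<bar>" by (intro tendsto_intros u)
    show "\<forall>\<^sub>F k in sequentially. \<bar>\<psi> x - \<phi> k x\<bar> \<le> rad \<theta>"
      using ev[OF \<theta>(1)] by eventually_elim (rule approx_sol_close[OF v \<psi> _ \<theta>])
  qed simp
  then show ?thesis by blast
qed

text \<open>A choice in form only: since \<open>rad\<close> can be made arbitrarily small and
  approximate solutions exist for every tolerance, this property determines \<open>u\<close> for
  admissible \<open>v\<close>.\<close>

definition sol :: "(real^'n \<Rightarrow> real) \<Rightarrow> real^'n \<Rightarrow> real" where
  "sol v = (SOME u. \<forall>\<theta> \<phi> x. 0 < \<theta> \<longrightarrow> \<theta> \<le> \<kappa> / 4 \<longrightarrow> approx_sol v \<theta> \<phi> \<longrightarrow> \<bar>\<phi> x - u x\<bar> \<le> rad \<theta>)"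

lemma approx_sol_near_sol:
  assumes v: "admissible R v" and "0 < \<theta>" "\<theta> \<le> \<kappa> / 4" "approx_sol v \<theta> \<phi>"
  shows "\<bar>\<phi> x - sol v x\<bar> \<le> rad \<theta>"
  using someI_ex[OF solution_exists[OF v], folded sol_def] assms(2-) by blast

text \<open>One test function serves both problems: an approximate solution for the limit
  \<open>v\<close> is, with doubled tolerance, one for all late \<open>w n\<close>, so both exact
  solutions are near it.\<close>

lemma sol_continuous:
  assumes "\<And>n. admissible R (w n)" "admissible R v" "\<And>x. x \<in> \<Omega> \<Longrightarrow> (\<lambda>n. w n x) \<longlonglongrightarrow> v x"
  shows "(\<lambda>n. sol (w n) x) \<longlonglongrightarrow> sol v x"
proof (rule tendstoI)
  fix e :: real assume "e > 0"
  then obtain \<theta> where \<theta>: "0 < \<theta>" "\<theta> \<le> \<kappa> / 4" "rad \<theta> \<le> e / 3" using rad_small[of "e / 3"] by auto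
  obtain \<phi> where \<phi>: "approx_sol v (\<theta> / 2) \<phi>" using approx_sol_exists[OF assms(2), of "\<theta> / 2"] \<theta> by auto
  have "\<forall>\<^sub>F n in sequentially. approx_sol (w n) (2 * (\<theta> / 2)) \<phi>"
    using \<theta> by (intro approx_sol_stable[OF assms \<phi>]) auto
  then show "\<forall>\<^sub>F n in sequentially. dist (sol (w n) x) (sol v x) < e"
  proof eventually_elim
    case (elim n)
    then have "approx_sol (w n) \<theta> \<phi>" by simp
    then have "\<bar>\<phi> x - sol (w n) x\<bar> \<le> rad \<theta>" by (intro approx_sol_near_sol[OF assms(1)] \<theta>(1,2))
    moreover have "approx_sol v \<theta> \<phi>" using approx_sol_mono[OF \<phi>, of \<theta>] \<theta> by simp
    then have "\<bar>\<phi> x - sol v x\<bar> \<le> rad \<theta>" by (intro approx_sol_near_sol[OF assms(2)] \<theta>(1,2))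
    ultimately show ?case using \<theta>(3) \<open>e > 0\<close> unfolding dist_real_def by linarith
  qed
qed

subsection \<open>The a priori bound\<close>

text \<open>Testing with \<open>\<phi>\<close> itself gives
  \<open>X powr (q - 1) \<le> const * R powr (r - 1)\<close> for the \<open>q\<close>-th root
  \<open>X\<close> of the energy. If \<open>CS * X\<close> exceeded \<open>R\<close>, then
  \<open>R powr (q - r)\<close> would be bounded by a constant.\<close>

lemma a_priori_radius:
  obtains R where "R \<ge> 1" "\<And>w \<theta> \<phi>. admissible R w \<Longrightarrow> 0 < \<theta> \<Longrightarrow> \<theta> \<le> min 1 (\<epsilon> / 2) \<Longrightarrow> approx_sol w \<theta> \<phi>
    \<Longrightarrow> CS * energy \<phi> powr (1 / q) \<le> R"
proof -
  define K where "K = c * measure M \<Omega> * CS"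
  have CS: "CS \<ge> 1" "CS > 0" using CS_ge by auto
  have K: "K \<ge> 0" using CS c_pos by (simp add: K_def)
  \<comment> \<open>A failure would force \<open>R powr (q - r) \<le> Z - 1\<close>, while
    \<open>R\<close> is chosen so that this power is at least \<open>Z\<close>.\<close>
  define Z where "Z = 2 / \<epsilon> * (1 + 2 * K) * CS powr (q - 1) + 1"
  have Z: "Z > 0" using eps_pos K by (simp add: Z_def add_nonneg_pos)
  \<comment> \<open>The lower bound \<open>CS\<close> makes \<open>X > 1\<close> in the case of
    failure, so that the constant 1 in the energy estimate can be absorbed into
    \<open>X\<close>.\<close>
  define R where "R = max CS (Z powr (1 / (q - r)))"
  have R: "R \<ge> 1" "R \<ge> CS" using CS by (auto simp: R_def)
  have "Z = (Z powr (1 / (q - r))) powr (q - r)" using Z r_less by (simp add: powr_powr)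
  also have "\<dots> \<le> R powr (q - r)" using r_less by (intro powr_mono2) (auto simp: R_def)
  finally have ZR: "2 / \<epsilon> * (1 + 2 * K) * CS powr (q - 1) < R powr (q - r)" by (simp add: Z_def)
  show ?thesis
  proof (rule that[OF R(1)], rule ccontr)
    fix w \<theta> \<phi>
    assume w: "admissible R w" and \<theta>: "0 < \<theta>" "\<theta> \<le> min 1 (\<epsilon> / 2)" and \<phi>: "approx_sol w \<theta> \<phi>"
      and gt: "\<not> CS * energy \<phi> powr (1 / q) \<le> R"
    have t: "test_fun \<Omega> \<phi>" using \<phi> by (simp add: approx_sol_def)
    define X where "X = energy \<phi> powr (1 / q)"
    have X: "X \<ge> 0" "X powr q = energy \<phi>"
      using q_ge by (auto simp: X_def powr_powr)
    have Xgt: "X > R / CS" using gt CS by (simp add: X_def field_simps)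
    have "R / CS \<ge> 1" using R(2) CS by simp
    then have X1: "X > 1" using Xgt by linarith
    have Rr: "R powr (r - 1) \<ge> 1" using R r_ge by (simp add: ge_one_powr_ge_zero)
    define K1 where "K1 = FB R * measure M \<Omega> * CS"
    have K1: "K1 = K * (1 + R powr (r - 1))" by (simp add: K1_def K_def FB_def)
    have "\<epsilon> * energy \<phi> = (\<integral>x. \<epsilon> * norm (grad \<phi> x) powr q \<partial>M)"
      unfolding energy_def integral_mult_right_zero ..
    also have "\<dots> \<le> (\<integral>x. field (w x) (grad \<phi> x) \<bullet> grad \<phi> x \<partial>M)"
    proof (rule integral_mono)
      show "integrable M (\<lambda>x. \<epsilon> * norm (grad \<phi> x) powr q)"
        by (rule integrable_mult_right) (rule integrable_energy[OF t])
    qed (rule integrable_field[OF w t t], rule field_coercive)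
    also have "\<dots> = form w \<phi> \<phi> + (\<integral>x. f x (w x) * \<phi> x \<partial>M)"
      unfolding form_def Bochner_Integration.integral_diff[OF integrable_field[OF w t t] integrable_rhs[OF w t]] by simp
    also have "\<dots> \<le> \<theta> * (1 + energy \<phi>) + K1 * X"
      using approx_sol_abs[OF w \<phi> t] integral_rhs_bound[OF w t] unfolding K1_def X_def by linarith
    also have "\<dots> \<le> 1 + \<epsilon> / 2 * energy \<phi> + K1 * X"
    proof -
      have "\<theta> * energy \<phi> \<le> \<epsilon> / 2 * energy \<phi>" using \<theta> by (intro mult_right_mono) auto
      then show ?thesis using \<theta> by (simp add: distrib_left)
    qed
    finally have "\<epsilon> / 2 * energy \<phi> \<le> 1 + K1 * X" by simp
    also have "\<dots> \<le> (1 + K1) * X" using X1 by (simp add: distrib_right)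
    also have "energy \<phi> = X powr (q - 1) * X"
      using X X1 by (simp add: powr_diff)
    finally have "\<epsilon> / 2 * X powr (q - 1) \<le> 1 + K1"
      using X1 by simp
    also have "1 + K1 \<le> (1 + 2 * K) * R powr (r - 1)"
    proof -
      have "K * 1 \<le> K * R powr (r - 1)" using K Rr by (intro mult_left_mono)
      then show ?thesis using Rr by (simp add: K1 algebra_simps)
    qed
    finally have "X powr (q - 1) \<le> 2 / \<epsilon> * (1 + 2 * K) * R powr (r - 1)"
      using eps_pos by (simp add: field_simps)
    moreover have "(R / CS) powr (q - 1) \<le> X powr (q - 1)"
      using Xgt R CS q_ge by (intro powr_mono2) auto
    ultimately have "(R / CS) powr (q - 1) \<le> 2 / \<epsilon> * (1 + 2 * K) * R powr (r - 1)" by linarith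
    then have "(R / CS) powr (q - 1) * CS powr (q - 1) \<le> 2 / \<epsilon> * (1 + 2 * K) * R powr (r - 1) * CS powr (q - 1)"
      by (rule mult_right_mono) simp
    moreover have "(R / CS) powr (q - 1) * CS powr (q - 1) = R powr (q - 1)"
      using CS R by (simp flip: powr_mult)
    ultimately have "R powr (q - 1) \<le> 2 / \<epsilon> * (1 + 2 * K) * R powr (r - 1) * CS powr (q - 1)"
      by simp
    then have "R powr (q - r) * R powr (r - 1) \<le> 2 / \<epsilon> * (1 + 2 * K) * CS powr (q - 1) * R powr (r - 1)"
      by (simp flip: powr_add add: mult_ac)
    then have "R powr (q - r) \<le> 2 / \<epsilon> * (1 + 2 * K) * CS powr (q - 1)"
      by (rule mult_right_le_imp_le) (use R in simp)
    then show False using ZR by simp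
  qed
qed

end

text \<open>The Riesz-Fischer argument, keeping what is usually discarded: a majorant
  \<open>h\<close> of the whole subsequence with integrable \<open>q\<close>-th power. It is what
  permits dominated convergence in the nonlinear terms later.\<close>

lemma powr_cauchy_dominated_subseq:
  fixes g :: "nat \<Rightarrow> 'a \<Rightarrow> 'b::{banach, second_countable_topology}"
  assumes q: "q \<ge> 1"
    and meas: "\<And>n. g n \<in> borel_measurable M"
    and int: "\<And>n. integrable M (\<lambda>x. norm (g n x) powr q)"
    and cauchy: "\<And>e. e > 0 \<Longrightarrow> \<exists>N. \<forall>m\<ge>N. \<forall>n\<ge>N. (\<integral>x. norm (g m x - g n x) powr q \<partial>M) \<le> e"
  obtains k G h where "strict_mono (k :: nat \<Rightarrow> nat)" "G \<in> borel_measurable M" "h \<in> borel_measurable M"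
    "integrable M (\<lambda>x. h x powr q)" "AE x in M. \<forall>n. norm (g (k n) x) \<le> h x" "AE x in M. (\<lambda>n. g (k n) x) \<longlonglongrightarrow> G x"
    "AE x in M. norm (G x) \<le> h x" "(\<lambda>n. \<integral>x. norm (g (k n) x - G x) powr q \<partial>M) \<longlonglongrightarrow> 0"
proof -
  have meas_powr: "(\<lambda>x. norm (F x) powr q) \<in> borel_measurable M" if "F \<in> borel_measurable M" for F :: "'a \<Rightarrow> 'b"
    using that by measurable
  have int_diff: "integrable M (\<lambda>x. norm (g m x - g n x) powr q)" for m n
  proof (rule Bochner_Integration.integrable_bound)
    show "integrable M (\<lambda>x. 2 powr q * (norm (g m x) powr q + norm (g n x) powr q))"
      by (rule integrable_mult_right) (rule Bochner_Integration.integrable_add[OF int int])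
    show "(\<lambda>x. norm (g m x - g n x) powr q) \<in> borel_measurable M"
      using meas by (intro meas_powr) simp
    show "AE x in M. norm (norm (g m x - g n x) powr q) \<le> norm (2 powr q * (norm (g m x) powr q + norm (g n x) powr q))"
    proof (rule AE_I2)
      fix x
      have "norm (g m x - g n x) powr q \<le> (norm (g m x) + norm (g n x)) powr q"
        using q by (intro powr_mono2 norm_triangle_ineq4) auto
      also have "\<dots> \<le> 2 powr q * (norm (g m x) powr q + norm (g n x) powr q)"
        using q by (intro powr_add_le) auto
      finally show "norm (norm (g m x - g n x) powr q) \<le> norm (2 powr q * (norm (g m x) powr q + norm (g n x) powr q))"
        by simp
    qed
  qed
  \<comment> \<open>Tolerance for the n-th increment: multiplied by the weight
    \<open>(2 powr q) ^ n\<close> in \<open>cc\<close> it still leaves the summable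
    \<open>(1 / 2) ^ n\<close>.\<close>
  define b where "b n = (2 powr (- q)) ^ n * (1 / 2) ^ n" for n :: nat
  have b: "b n > 0" for n by (simp add: b_def)
  have "\<forall>n. \<exists>N. \<forall>i\<ge>N. \<forall>j\<ge>N. (\<integral>x. norm (g i x - g j x) powr q \<partial>M) \<le> b n"
    using cauchy[OF b] by blast
  then obtain N where N: "\<And>n i j. i \<ge> N n \<Longrightarrow> j \<ge> N n \<Longrightarrow> (\<integral>x. norm (g i x - g j x) powr q \<partial>M) \<le> b n"
    by metis
  \<comment> \<open>Summing the thresholds gives indices that increase strictly and still dominate
    each \<open>N n\<close>.\<close>
  define k where "k n = (\<Sum>i\<le>n. N i + 1)" for n
  have k: "strict_mono k" unfolding strict_mono_Suc_iff by (simp add: k_def)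
  have kN: "k n \<ge> N n" for n
    using member_le_sum[of n "{..n}" "\<lambda>i. N i + 1"] by (simp add: k_def)
  define a where "a n x = norm (g (k (Suc n)) x - g (k n) x)" for n x
  define cc where "cc n x = (2 powr q) ^ n * a n x powr q" for n x
  have cc0: "cc n x \<ge> 0" for n x by (simp add: cc_def)
  have int_cc: "integrable M (cc n)" for n
    unfolding cc_def a_def by (rule integrable_mult_right) (rule int_diff)
  have cc_le: "(\<integral>x. cc n x \<partial>M) \<le> (1 / 2) ^ n" for n
  proof -
    have "(\<integral>x. cc n x \<partial>M) = (2 powr q) ^ n * (\<integral>x. a n x powr q \<partial>M)"
      unfolding cc_def by (rule integral_mult_right_zero)
    also have "\<dots> \<le> (2 powr q) ^ n * b n"
      unfolding a_def using kN[of n] strict_mono_leD[OF k, of n "Suc n"]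
      by (intro mult_left_mono N) auto
    also have "\<dots> = (2 powr q * 2 powr (- q)) ^ n * (1 / 2) ^ n"
      unfolding b_def power_mult_distrib by simp
    also have "\<dots> = (1 / 2) ^ n" by (simp flip: powr_add)
    finally show ?thesis .
  qed
  have half: "summable (\<lambda>n. (1 / 2 :: real) ^ n)" by (rule summable_geometric) simp
  have summ: "AE x in M. summable (\<lambda>n. cc n x)"
  proof -
    have "(\<integral>\<^sup>+x. (\<Sum>n. ennreal (cc n x)) \<partial>M) = (\<Sum>n. \<integral>\<^sup>+x. ennreal (cc n x) \<partial>M)"
      using int_cc by (intro nn_integral_suminf) auto
    also have "\<dots> = (\<Sum>n. ennreal (\<integral>x. cc n x \<partial>M))"
      using int_cc cc0 by (simp add: nn_integral_eq_integral)
    also have "\<dots> \<le> (\<Sum>n. ennreal ((1 / 2) ^ n))"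
      using cc_le by (intro suminf_le ennreal_leI summableI) auto
    also have "\<dots> = ennreal (\<Sum>n. (1 / 2) ^ n)" by (rule suminf_ennreal2[OF _ half]) simp
    also have "\<dots> < \<infinity>" by simp
    finally have "(\<integral>\<^sup>+x. (\<Sum>n. ennreal (cc n x)) \<partial>M) \<noteq> \<infinity>" by simp
    moreover have "(\<lambda>x. \<Sum>n. ennreal (cc n x)) \<in> borel_measurable M"
      using int_cc by (intro borel_measurable_suminf_order) auto
    ultimately have "AE x in M. (\<Sum>n. ennreal (cc n x)) \<noteq> \<infinity>"
      by (rule nn_integral_PInf_AE[rotated])
    then show ?thesis
      by eventually_elim (use cc0 in \<open>auto intro: summable_suminf_not_top\<close>)
  qed
  \<comment> \<open>\<open>T powr (1 / q)\<close> controls all increments at once, with factors \<open>2 powr - n\<close>; no Minkowski inequality is needed.\<close>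
  define T where "T x = (\<Sum>n. cc n x)" for x
  have int_T: "integrable M T"
    unfolding T_def
  proof (rule integrable_suminf[OF int_cc])
    show "AE x in M. summable (\<lambda>n. norm (cc n x))" using summ cc0 by simp
    show "summable (\<lambda>n. \<integral>x. norm (cc n x) \<partial>M)"
      using cc_le cc0 by (intro summable_comparison_test'[OF half]) auto
  qed
  define h where "h x = norm (g (k 0) x) + 2 * T x powr (1 / q)" for x
  define G where "G x = lim (\<lambda>n. g (k n) x)" for x
  have G_meas: "G \<in> borel_measurable M"
    unfolding G_def using meas by (rule borel_measurable_lim_metric)
  have h_meas: "h \<in> borel_measurable M"
    unfolding h_def using meas int_T by measurable
  have ptw: "(\<lambda>n. g (k n) x) \<longlonglongrightarrow> G x" "\<forall>n. norm (g (k n) x) \<le> h x" "T x \<ge> 0"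
    if s: "summable (\<lambda>n. cc n x)" for x
  proof -
    show T0: "T x \<ge> 0" unfolding T_def using s cc0 by (simp add: suminf_nonneg)
    define S where "S = T x powr (1 / q)"
    have a_le: "a n x \<le> S * (1 / 2) ^ n" for n
    proof -
      have "cc n x \<le> T x"
        unfolding T_def using sum_le_suminf[OF s, of "{n}"] cc0 by simp
      then have "cc n x powr (1 / q) \<le> S" unfolding S_def using q cc0 by (intro powr_mono2) auto
      moreover have "cc n x powr (1 / q) = 2 ^ n * a n x"
      proof -
        have "(2 powr q) ^ n = (2 ^ n) powr q"
          by (simp add: powr_powr powr_realpow[symmetric] mult.commute)
        then have "cc n x = (2 ^ n * a n x) powr q" by (simp add: cc_def a_def powr_mult)
        then show ?thesis using q by (simp add: powr_powr a_def)
      qed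
      ultimately show ?thesis by (simp add: field_simps power_divide)
    qed
    have a_sum: "summable (\<lambda>n. a n x)"
      by (rule summable_comparison_test'[where g = "\<lambda>n. S * (1 / 2) ^ n" and N = 0])
         (use a_le half in \<open>auto simp: a_def intro: summable_mult\<close>)
    have "summable (\<lambda>n. g (k (Suc n)) x - g (k n) x)"
      by (rule summable_norm_cancel) (use a_sum in \<open>simp add: a_def\<close>)
    then obtain L where "(\<lambda>n. \<Sum>i<n. g (k (Suc i)) x - g (k i) x) \<longlonglongrightarrow> L"
      by (auto simp: summable_def sums_def)
    then have "(\<lambda>n. g (k 0) x + (\<Sum>i<n. g (k (Suc i)) x - g (k i) x)) \<longlonglongrightarrow> g (k 0) x + L"
      by (intro tendsto_add tendsto_const)
    moreover have "g (k 0) x + (\<Sum>i<n. g (k (Suc i)) x - g (k i) x) = g (k n) x" for n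
      using sum_lessThan_telescope[of "\<lambda>i. g (k i) x" n] by simp
    ultimately have "convergent (\<lambda>n. g (k n) x)" by (auto simp: convergent_def)
    then show "(\<lambda>n. g (k n) x) \<longlonglongrightarrow> G x" unfolding G_def by (simp add: convergent_LIMSEQ_iff)
    show "\<forall>n. norm (g (k n) x) \<le> h x"
    proof
      fix n
      have "g (k n) x = g (k 0) x + (\<Sum>i<n. g (k (Suc i)) x - g (k i) x)"
        using sum_lessThan_telescope[of "\<lambda>i. g (k i) x" n] by simp
      then have "norm (g (k n) x) \<le> norm (g (k 0) x) + norm (\<Sum>i<n. g (k (Suc i)) x - g (k i) x)"
        by (metis norm_triangle_ineq)
      also have "norm (\<Sum>i<n. g (k (Suc i)) x - g (k i) x) \<le> (\<Sum>i<n. a i x)"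
        unfolding a_def by (rule norm_sum)
      also have "\<dots> \<le> (\<Sum>i<n. S * (1 / 2) ^ i)" by (intro sum_mono a_le)
      also have "\<dots> \<le> (\<Sum>i. S * (1 / 2) ^ i)"
        by (intro sum_le_suminf summable_mult half) (auto simp: S_def)
      also have "\<dots> = 2 * S" using suminf_geometric[of "1 / 2 :: real"] by (subst suminf_mult[OF half]) simp
      finally show "norm (g (k n) x) \<le> h x" by (simp add: h_def S_def)
    qed
  qed
  have ae_lim: "AE x in M. (\<lambda>n. g (k n) x) \<longlonglongrightarrow> G x"
    using summ by eventually_elim (rule ptw)
  have ae_dom: "AE x in M. \<forall>n. norm (g (k n) x) \<le> h x"
    using summ by eventually_elim (rule ptw)
  have ae_G: "AE x in M. norm (G x) \<le> h x"
    using ae_lim ae_dom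
  proof eventually_elim
    case (elim x)
    show ?case by (rule tendsto_upperbound[OF tendsto_norm[OF elim(1)]]) (use elim(2) in auto)
  qed
  have int_h: "integrable M (\<lambda>x. h x powr q)"
  proof (rule Bochner_Integration.integrable_bound)
    show "integrable M (\<lambda>x. 2 powr q * (norm (g (k 0) x) powr q + 2 powr q * T x))"
      by (rule integrable_mult_right, rule Bochner_Integration.integrable_add[OF int], rule integrable_mult_right[OF int_T])
    show "(\<lambda>x. h x powr q) \<in> borel_measurable M" using h_meas by measurable
    show "AE x in M. norm (h x powr q) \<le> norm (2 powr q * (norm (g (k 0) x) powr q + 2 powr q * T x))"
      using summ
    proof eventually_elim
      case (elim x)
      note T0 = ptw(3)[OF elim]
      have "h x powr q \<le> 2 powr q * (norm (g (k 0) x) powr q + (2 * T x powr (1 / q)) powr q)"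
        unfolding h_def using q by (intro powr_add_le) auto
      also have "(2 * T x powr (1 / q)) powr q = 2 powr q * T x"
        using q T0 by (simp add: powr_mult powr_powr)
      finally show ?case using T0 by simp
    qed
  qed
  have lim0: "(\<lambda>n. \<integral>x. norm (g (k n) x - G x) powr q \<partial>M) \<longlonglongrightarrow> 0"
  proof -
    have "(\<lambda>n. \<integral>x. norm (g (k n) x - G x) powr q \<partial>M) \<longlonglongrightarrow> (\<integral>x. 0 \<partial>M)"
    proof (rule integral_dominated_convergence[where w = "\<lambda>x. 2 powr q * h x powr q"])
      show "integrable M (\<lambda>x. 2 powr q * h x powr q)" by (rule integrable_mult_right[OF int_h])
      show "(\<lambda>x. norm (g (k n) x - G x) powr q) \<in> borel_measurable M" for n
        using meas G_meas by (intro meas_powr) simp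
      show "AE x in M. (\<lambda>n. norm (g (k n) x - G x) powr q) \<longlonglongrightarrow> 0"
        using ae_lim
      proof eventually_elim
        case (elim x)
        have "(\<lambda>n. norm (g (k n) x - G x)) \<longlonglongrightarrow> 0" using elim by (simp add: LIM_zero tendsto_norm_zero)
        then have "(\<lambda>n. norm (g (k n) x - G x) powr q) \<longlonglongrightarrow> 0 powr q"
          using q by (intro tendsto_powr2 tendsto_const) auto
        then show ?case using q by simp
      qed
      show "AE x in M. norm (norm (g (k n) x - G x) powr q) \<le> 2 powr q * h x powr q" for n
        using ae_dom ae_G
      proof eventually_elim
        case (elim x)
        have n: "norm (g (k n) x) \<le> h x" using elim by blast
        have "norm (g (k n) x - G x) \<le> 2 * h x"
          using norm_triangle_ineq4[of "g (k n) x" "G x"] n elim(2) by linarith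
        then have "norm (g (k n) x - G x) powr q \<le> (2 * h x) powr q" using q by (intro powr_mono2) auto
        moreover have "h x \<ge> 0" using n norm_ge_zero order_trans by blast
        ultimately show ?case by (simp add: powr_mult)
      qed
    qed auto
    then show ?thesis by simp
  qed
  show ?thesis by (rule that[OF k G_meas h_meas int_h ae_dom ae_lim ae_G lim0])
qed

context quasilinear
begin

subsection \<open>Fixed points of the discretised solution map\<close>

lemma finite_net:
  assumes "\<delta> > 0"
  obtains m and X :: "nat \<Rightarrow> real^'n" where "\<And>x. x \<in> \<Omega> \<Longrightarrow> \<exists>j<m. dist x (X j) < \<delta>"
proof -
  have c: "compact (closure \<Omega>)" using bounded_Omega by (simp add: compact_closure)
  have cov: "closure \<Omega> \<subseteq> (\<Union>x\<in>\<Omega>. ball x \<delta>)"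
  proof
    fix y assume "y \<in> closure \<Omega>"
    then obtain x where "x \<in> \<Omega>" "dist x y < \<delta>" using assms closure_approachable by blast
    then show "y \<in> (\<Union>x\<in>\<Omega>. ball x \<delta>)" by auto
  qed
  obtain C where C: "C \<subseteq> \<Omega>" "finite C" "closure \<Omega> \<subseteq> (\<Union>x\<in>C. ball x \<delta>)"
    by (rule compactE_image[where f = "\<lambda>x. ball x \<delta>", OF c _ cov]) auto
  obtain m X where X: "C = X ` {i::nat. i < m}"
    using finite_imp_nat_seg_image_inj_on[OF C(2)] by blast
  show ?thesis
  proof (rule that[of m X])
    fix x assume "x \<in> \<Omega>"
    then have "x \<in> (\<Union>x\<in>C. ball x \<delta>)" using C(3) closure_subset[of \<Omega>] by blast
    then show "\<exists>j<m. dist x (X j) < \<delta>" unfolding X by (auto simp: dist_commute)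
  qed
qed

text \<open>The ceiling on the tolerance is the one under which the residual can be absorbed by
  coercivity.\<close>

definition invariant_radius :: "real \<Rightarrow> bool" where
  "invariant_radius R \<longleftrightarrow> R \<ge> 1 \<and> (\<forall>w \<theta> \<phi>. admissible R w \<longrightarrow> 0 < \<theta> \<longrightarrow> \<theta> \<le> min 1 (\<epsilon> / 2) \<longrightarrow>
     approx_sol w \<theta> \<phi> \<longrightarrow> CS * energy \<phi> powr (1 / q) \<le> R)"

lemma invariant_radiusD:
  assumes "invariant_radius R" "admissible R w" "0 < \<theta>" "\<theta> \<le> min 1 (\<epsilon> / 2)" "approx_sol w \<theta> \<phi>"
  shows "CS * energy \<phi> powr (1 / q) \<le> R"
  using assms unfolding invariant_radius_def by blast

text \<open>The bound holds for accurate approximate solutions and passes to \<open>sol w\<close> up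
  to an arbitrarily small \<open>rad \<theta>\<close>.\<close>

lemma sol_bounded:
  assumes R: "invariant_radius R"
    and w: "admissible R w"
  shows "\<bar>sol w x\<bar> \<le> R"
proof (rule field_le_epsilon)
  fix e :: real assume "e > 0"
  then obtain \<theta> where \<theta>: "0 < \<theta>" "\<theta> \<le> \<kappa> / 4" "rad \<theta> \<le> e" using rad_small[of e] by auto
  define \<theta>' where "\<theta>' = min \<theta> (min 1 (\<epsilon> / 2))"
  have \<theta>': "0 < \<theta>'" "\<theta>' \<le> min 1 (\<epsilon> / 2)" "\<theta>' \<le> \<theta>" using \<theta> eps_pos by (auto simp: \<theta>'_def)
  obtain \<phi> where \<phi>: "approx_sol w \<theta>' \<phi>" using approx_sol_exists[OF w \<theta>'(1)] by blast
  have "\<bar>\<phi> x\<bar> \<le> CS * energy \<phi> powr (1 / q)" using \<phi> by (intro sup_bound) (simp add: approx_sol_def)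
  then have "\<bar>\<phi> x\<bar> \<le> R" using invariant_radiusD[OF R w \<theta>'(1,2) \<phi>] by linarith
  moreover have "\<bar>\<phi> x - sol w x\<bar> \<le> rad \<theta>"
    using approx_sol_near_sol[OF w \<theta>(1,2) approx_sol_mono[OF \<phi> \<theta>'(3)]] .
  ultimately show "\<bar>sol w x\<bar> \<le> R + e" using \<theta>(3) by linarith
qed

text \<open>The unknowns are the finitely many cell values. Pointwise convergence of the step
  functions is just convergence of these values, so \<open>sol_continuous\<close> provides the
  continuity that Brouwer's theorem asks for.\<close>

lemma discrete_fixed_point:
  assumes R1: "R \<ge> 1" and R: "\<And>w x. admissible R w \<Longrightarrow> \<bar>sol w x\<bar> \<le> R"
    and \<delta>: "\<delta> > 0"
  obtains w where "admissible R w" "\<And>x. x \<in> \<Omega> \<Longrightarrow> \<exists>z. dist x z < \<delta> \<and> w x = sol w z"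
proof -
  obtain m and X :: "nat \<Rightarrow> real^'n" where X: "\<And>x. x \<in> \<Omega> \<Longrightarrow> \<exists>j<m. dist x (X j) < \<delta>"
    using finite_net[OF \<delta>] by blast
  \<comment> \<open>The least index turns the overlapping balls into disjoint measurable
    cells.\<close>
  define idx where "idx x = (LEAST j. j < m \<and> dist x (X j) < \<delta>)" for x
  have idx: "idx x < m" "dist x (X (idx x)) < \<delta>" if "x \<in> \<Omega>" for x
    using LeastI_ex[OF X[OF that]] by (auto simp: idx_def)
  have pred: "Measurable.pred M (\<lambda>x. j < m \<and> dist x (X j) < \<delta>)" for j
  proof -
    have "(\<lambda>x. dist x (X j)) \<in> borel_measurable M"
      by (intro borel_measurable_lebesgue_on borel_measurable_continuous_onI continuous_intros)
    then show ?thesis by measurable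
  qed
  have idx_meas: "idx \<in> measurable M (count_space UNIV)"
    unfolding idx_def by (rule measurable_Least) (rule pred)
  \<comment> \<open>Rescales cell values from the unit interval to the range from \<open>-R\<close>
    to \<open>R\<close>; \<open>F\<close> below applies the inverse rescaling to
    \<open>sol\<close>.\<close>
  define w where "w y x = R * (2 * y (idx x) - 1)" for y :: "nat \<Rightarrow> real" and x
  have adm: "admissible R (w y)" if y: "\<forall>j<m. y j \<in> {0..1}" for y
    unfolding admissible_def
  proof (intro conjI ballI R1)
    show "w y \<in> borel_measurable M"
      unfolding w_def using measurable_compose[OF idx_meas, of "\<lambda>i. R * (2 * y i - 1)" borel] by simp
    fix x assume "x \<in> \<Omega>"
    then have "y (idx x) \<in> {0..1}" using y idx by blast
    then have "\<bar>2 * y (idx x) - 1\<bar> \<le> 1" by auto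
    then have "\<bar>R\<bar> * \<bar>2 * y (idx x) - 1\<bar> \<le> \<bar>R\<bar> * 1" by (rule mult_left_mono) simp
    then show "\<bar>w y x\<bar> \<le> R" using R1 by (simp add: w_def abs_mult)
  qed
  define F where "F y i = (sol (w y) (X i) + R) / (2 * R)" for y i
  have "\<exists>y. (\<forall>j<m. y j \<in> {0..1}) \<and> (\<forall>i<m. F y i = y i)"
  proof (rule brouwer_nat_cube)
    fix y :: "nat \<Rightarrow> real" and i assume "\<forall>j<m. y j \<in> {0..1}"
    then have "\<bar>sol (w y) (X i)\<bar> \<le> R" by (intro R adm)
    then show "F y i \<in> {0..1}" using R1 by (auto simp: F_def divide_le_eq)
  next
    fix Y :: "nat \<Rightarrow> nat \<Rightarrow> real" and y i
    assume Y: "\<And>n. \<forall>j<m. Y n j \<in> {0..1}" and lim: "\<forall>j<m. (\<lambda>n. Y n j) \<longlonglongrightarrow> y j" and "i < m"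
    have y: "\<forall>j<m. y j \<in> {0..1}"
    proof (intro allI impI)
      fix j assume j: "j < m"
      have "\<And>n. Y n j \<in> {0..1}" using Y j by blast
      moreover have "(\<lambda>n. Y n j) \<longlonglongrightarrow> y j" using lim j by blast
      ultimately show "y j \<in> {0..1}" by (rule closed_sequentially[OF closed_atLeastAtMost])
    qed
    have "(\<lambda>n. sol (w (Y n)) (X i)) \<longlonglongrightarrow> sol (w y) (X i)"
    proof (rule sol_continuous[OF adm[OF Y] adm[OF y]])
      fix x assume "x \<in> \<Omega>"
      then have "(\<lambda>n. Y n (idx x)) \<longlonglongrightarrow> y (idx x)" using lim idx by blast
      then show "(\<lambda>n. w (Y n) x) \<longlonglongrightarrow> w y x" unfolding w_def by (intro tendsto_intros)
    qed
    then show "(\<lambda>n. F (Y n) i) \<longlonglongrightarrow> F y i"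
      unfolding F_def using R1 by (intro tendsto_intros) auto
  qed
  then obtain y where y: "\<forall>j<m. y j \<in> {0..1}" "\<forall>i<m. F y i = y i" by blast
  show ?thesis
  proof (rule that[OF adm[OF y(1)]])
    fix x assume x: "x \<in> \<Omega>"
    have "F y (idx x) = y (idx x)" using y(2) idx[OF x] by blast
    then have "w y x = sol (w y) (X (idx x))"
      using R1 by (simp add: F_def w_def field_simps)
    then show "\<exists>z. dist x z < \<delta> \<and> w y x = sol (w y) z" using idx[OF x] by blast
  qed
qed

lemma approx_fixed_point:
  assumes R: "invariant_radius R"
    and \<eta>: "\<eta> > 0"
  shows "\<exists>w \<phi>. admissible R w \<and> approx_sol w \<eta> \<phi> \<and> energy \<phi> powr (1 / q) \<le> R \<and> (\<forall>x\<in>\<Omega>. \<bar>\<phi> x - w x\<bar> \<le> \<eta>)"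
proof -
  have R1: "R \<ge> 1" using R by (simp add: invariant_radius_def)
  obtain \<theta>0 where \<theta>0: "0 < \<theta>0" "\<theta>0 \<le> \<kappa> / 4" "rad \<theta>0 \<le> \<eta> / 2" using rad_small[of "\<eta> / 2"] \<eta> by auto
  define \<theta> where "\<theta> = min (min \<theta>0 \<eta>) (min 1 (\<epsilon> / 2))"
  have \<theta>: "0 < \<theta>" "\<theta> \<le> min 1 (\<epsilon> / 2)" "\<theta> \<le> \<theta>0" "\<theta> \<le> \<eta>" using \<theta>0 eps_pos \<eta> by (auto simp: \<theta>_def)
  \<comment> \<open>The distance at which the Hoelder bound, with energy root at most
    \<open>R\<close>, amounts to half of \<eta>.\<close>
  define \<delta> where "\<delta> = (\<eta> / (2 * KM * R)) powr (1 / \<alpha>)"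
  have \<delta>: "\<delta> > 0" using \<eta> KM_pos R1 by (simp add: \<delta>_def)
  have \<delta>\<alpha>: "KM * \<delta> powr \<alpha> * R = \<eta> / 2"
    using \<eta> KM_pos R1 alpha_pos by (simp add: \<delta>_def powr_powr)
  obtain w where w: "admissible R w" "\<And>x. x \<in> \<Omega> \<Longrightarrow> \<exists>z. dist x z < \<delta> \<and> w x = sol w z"
    using discrete_fixed_point[OF R1 sol_bounded[OF R] \<delta>] by blast
  obtain \<phi> where \<phi>: "approx_sol w \<theta> \<phi>" using approx_sol_exists[OF w(1) \<theta>(1)] by blast
  have t: "test_fun \<Omega> \<phi>" using \<phi> by (simp add: approx_sol_def)
  have "1 * energy \<phi> powr (1 / q) \<le> CS * energy \<phi> powr (1 / q)"
    using CS_ge by (intro mult_right_mono) auto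
  then have E: "energy \<phi> powr (1 / q) \<le> R" using invariant_radiusD[OF R w(1) \<theta>(1,2) \<phi>] by simp
  have "\<bar>\<phi> x - w x\<bar> \<le> \<eta>" if "x \<in> \<Omega>" for x
  proof -
    obtain z where z: "dist x z < \<delta>" "w x = sol w z" using w(2) \<open>x \<in> \<Omega>\<close> by blast
    have "\<bar>\<phi> x - \<phi> z\<bar> \<le> KM * norm (x - z) powr \<alpha> * energy \<phi> powr (1 / q)" by (rule holder_bound[OF t])
    also have "\<dots> \<le> KM * \<delta> powr \<alpha> * R"
      using z(1) KM_pos alpha_pos E by (intro mult_mono powr_mono2) (auto simp: dist_norm)
    finally have "\<bar>\<phi> x - \<phi> z\<bar> \<le> \<eta> / 2" unfolding \<delta>\<alpha> .
    moreover have "\<bar>\<phi> z - sol w z\<bar> \<le> rad \<theta>0"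
      by (rule approx_sol_near_sol[OF w(1) \<theta>0(1,2) approx_sol_mono[OF \<phi> \<theta>(3)]])
    ultimately show ?thesis using \<theta>0(3) z(2) by linarith
  qed
  then show ?thesis using w(1) approx_sol_mono[OF \<phi> \<theta>(4)] E by blast
qed

text \<open>The energy bound makes the \<open>\<phi> n\<close> bounded and equi-Hoelder, so
  Arzela-Ascoli applies to them. The discontinuous step functions \<open>w n\<close> inherit the
  limit, because they differ from \<open>\<phi> n\<close> by at most the vanishing
  tolerance.\<close>

lemma approx_sequence:
  obtains R B w \<phi> u and t :: "nat \<Rightarrow> real" where "\<And>n. admissible R (w n)" "admissible R u" "\<And>n. approx_sol (w n) (t n) (\<phi> n)"
    "\<And>n. t n > 0" "t \<longlonglongrightarrow> 0" "\<And>x. x \<in> \<Omega> \<Longrightarrow> (\<lambda>n. w n x) \<longlonglongrightarrow> u x" "\<And>x. x \<in> \<Omega> \<Longrightarrow> (\<lambda>n. \<phi> n x) \<longlonglongrightarrow> u x" "\<And>n x. \<bar>\<phi> n x\<bar> \<le> B"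
proof -
  obtain R where R: "invariant_radius R"
    using a_priori_radius unfolding invariant_radius_def by metis
  then have R1: "R \<ge> 1" by (simp add: invariant_radius_def)
  define s where "s n = inverse (real (Suc n))" for n
  have s: "s n > 0" for n by (simp add: s_def)
  have s0: "s \<longlonglongrightarrow> 0" unfolding s_def by (rule LIMSEQ_inverse_real_of_nat)
  have "\<forall>n. \<exists>w \<phi>. admissible R w \<and> approx_sol w (s n) \<phi> \<and> energy \<phi> powr (1 / q) \<le> R \<and> (\<forall>x\<in>\<Omega>. \<bar>\<phi> x - w x\<bar> \<le> s n)"
    using approx_fixed_point[OF R s] by blast
  then obtain w \<phi> where w: "\<And>n. admissible R (w n)" and \<phi>: "\<And>n. approx_sol (w n) (s n) (\<phi> n)"
    and E: "\<And>n. energy (\<phi> n) powr (1 / q) \<le> R" and near: "\<And>n x. x \<in> \<Omega> \<Longrightarrow> \<bar>\<phi> n x - w n x\<bar> \<le> s n"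
    by metis
  have t: "test_fun \<Omega> (\<phi> n)" for n using \<phi>[of n] by (simp add: approx_sol_def)
  have hold: "\<bar>\<phi> n x - \<phi> n y\<bar> \<le> KM * norm (x - y) powr \<alpha> * R" for n x y
    by (rule order_trans[OF holder_bound[OF t]], rule mult_left_mono[OF E]) (use KM_pos in auto)
  have bd: "\<bar>\<phi> n x\<bar> \<le> CS * R" for n x
    using order_trans[OF sup_bound[OF t[of n], of x] mult_left_mono[OF E[of n], of CS]] CS_ge by simp
  obtain u k where u: "continuous_on (closure \<Omega>) u" and k: "strict_mono (k :: nat \<Rightarrow> nat)"
    and unif: "\<And>e. 0 < e \<Longrightarrow> \<exists>N. \<forall>n x. n \<ge> N \<and> x \<in> closure \<Omega> \<longrightarrow> norm (\<phi> (k n) x - u x) < e"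
  proof (rule Arzela_Ascoli[of "closure \<Omega>" \<phi> "CS * R"])
    show "compact (closure \<Omega>)" using bounded_Omega by (simp add: compact_closure)
    show "norm (\<phi> n x) \<le> CS * R" for n x using bd by simp
    fix x e assume "x \<in> closure \<Omega>" "0 < (e::real)"
    define d where "d = (e / (2 * KM * R)) powr (1 / \<alpha>)"
    have d: "d > 0" using \<open>0 < e\<close> KM_pos R1 by (simp add: d_def)
    have d\<alpha>: "KM * d powr \<alpha> * R = e / 2"
      using \<open>0 < e\<close> KM_pos R1 alpha_pos by (simp add: d_def powr_powr)
    have "norm (\<phi> n x - \<phi> n y) < e" if "norm (x - y) < d" for n y
    proof -
      have "KM * norm (x - y) powr \<alpha> * R \<le> KM * d powr \<alpha> * R"
        using that KM_pos alpha_pos R1 by (intro mult_mono powr_mono2) auto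
      then show ?thesis using hold[of n x y] d\<alpha> \<open>0 < e\<close> by simp
    qed
    then show "\<exists>d. 0 < d \<and> (\<forall>n y. y \<in> closure \<Omega> \<and> norm (x - y) < d \<longrightarrow> norm (\<phi> n x - \<phi> n y) < e)"
      using d by blast
  qed blast
  have philim: "(\<lambda>n. \<phi> (k n) x) \<longlonglongrightarrow> u x" if x: "x \<in> \<Omega>" for x
  proof (rule LIMSEQ_I)
    fix e :: real assume "e > 0"
    then show "\<exists>N. \<forall>n\<ge>N. norm (\<phi> (k n) x - u x) < e"
      using unif[of e] x closure_subset[of \<Omega>] by (meson subsetD)
  qed
  have sk: "(\<lambda>n. s (k n)) \<longlonglongrightarrow> 0" using LIMSEQ_subseq_LIMSEQ[OF s0 k] by (simp add: o_def)
  have wlim: "(\<lambda>n. w (k n) x) \<longlonglongrightarrow> u x" if x: "x \<in> \<Omega>" for x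
  proof -
    note philim[OF x]
    moreover have "(\<lambda>n. \<phi> (k n) x - w (k n) x) \<longlonglongrightarrow> 0"
      by (rule Lim_null_comparison[OF _ sk]) (use near[OF x] in auto)
    ultimately have "(\<lambda>n. \<phi> (k n) x - (\<phi> (k n) x - w (k n) x)) \<longlonglongrightarrow> u x - 0" by (rule tendsto_diff)
    then show ?thesis by simp
  qed
  have "admissible R u"
    unfolding admissible_def
  proof (intro conjI R1 ballI)
    have "continuous_on \<Omega> u" using u closure_subset continuous_on_subset by blast
    then show "u \<in> borel_measurable M"
      by (rule continuous_imp_measurable_on_sets_lebesgue) simp
    fix x assume x: "x \<in> \<Omega>"
    have "(\<lambda>n. \<bar>w (k n) x\<bar>) \<longlonglongrightarrow> \<bar>u x\<bar>" by (intro tendsto_rabs wlim x)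
    then show "\<bar>u x\<bar> \<le> R"
      by (rule tendsto_upperbound) (use w x in \<open>auto simp: admissible_def\<close>)
  qed
  then show ?thesis
    using that[of R "\<lambda>n. w (k n)" u "\<lambda>n. s (k n)" "\<lambda>n. \<phi> (k n)" "CS * R"] w \<phi> s sk wlim philim bd by blast
qed

end

section \<open>Passage to the limit\<close>

text \<open>Stands in for Hoelder's inequality: \<open>a\<close> has the size of a flux of order
  \<open>H powr (q - 1)\<close>, and \<open>m\<close> distributes the weight between it and
  \<open>b\<close>.\<close>

lemma integral_product_weighted:
  fixes a b H :: "'a \<Rightarrow> real"
  assumes q: "q > 1" and a: "a \<in> borel_measurable M" and b: "b \<in> borel_measurable M"
    and H: "integrable M (\<lambda>x. H x powr q)" "\<And>x. H x \<ge> 0"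
    and le: "\<And>x. x \<in> space M \<Longrightarrow> \<bar>a x\<bar> \<le> C * H x powr (q - 1)" and C: "C \<ge> 0"
    and ib: "integrable M (\<lambda>x. \<bar>b x\<bar> powr q)"
  shows "integrable M (\<lambda>x. a x * b x)"
    and "m > 0 \<Longrightarrow> \<bar>\<integral>x. a x * b x \<partial>M\<bar>
      \<le> C * (m * (\<integral>x. H x powr q \<partial>M) + m powr (1 - q) * (\<integral>x. \<bar>b x\<bar> powr q \<partial>M))"
proof -
  let ?g = "\<lambda>m x. C * (m * H x powr q + m powr (1 - q) * \<bar>b x\<bar> powr q)"
  have ig: "integrable M (?g m)" for m
    by (rule integrable_mult_right, rule Bochner_Integration.integrable_add; rule integrable_mult_right)
       (rule H ib)+
  have ptw: "\<bar>a x * b x\<bar> \<le> ?g m x" if "m > 0" "x \<in> space M" for m x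
  proof -
    have "\<bar>a x * b x\<bar> \<le> C * H x powr (q - 1) * \<bar>b x\<bar>"
      unfolding abs_mult using le[OF that(2)] by (intro mult_right_mono) auto
    also have "\<dots> = C * (H x powr (q - 1) * \<bar>b x\<bar>)" by (simp add: mult.assoc)
    also have "\<dots> \<le> ?g m x"
      using H(2) that(1) q C by (intro mult_left_mono powr_mult_le_weighted) auto
    finally show ?thesis .
  qed
  show int: "integrable M (\<lambda>x. a x * b x)"
    by (rule integrable_dominated[OF ig[of 1]]) (use a b ptw[of 1] in auto)
  show "\<bar>\<integral>x. a x * b x \<partial>M\<bar>
      \<le> C * (m * (\<integral>x. H x powr q \<partial>M) + m powr (1 - q) * (\<integral>x. \<bar>b x\<bar> powr q \<partial>M))" if m: "m > 0"
  proof -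
    have "\<bar>\<integral>x. a x * b x \<partial>M\<bar> \<le> (\<integral>x. \<bar>a x * b x\<bar> \<partial>M)" by (rule integral_abs_bound)
    also have "\<dots> \<le> (\<integral>x. ?g m x \<partial>M)"
      by (rule integral_mono[OF integrable_abs[OF int] ig ptw[OF m]])
    also have "\<dots> = C * (m * (\<integral>x. H x powr q \<partial>M) + m powr (1 - q) * (\<integral>x. \<bar>b x\<bar> powr q \<partial>M))"
      unfolding integral_mult_right_zero
        Bochner_Integration.integral_add[OF integrable_mult_right[OF H(1)] integrable_mult_right[OF ib]] ..
    finally show ?thesis .
  qed
qed

text \<open>Fix \<open>m\<close> so small that the part belonging to \<open>H\<close> is at most
  half of the tolerance; for this \<open>m\<close> the part belonging to \<open>b k\<close> tends to
  0.\<close>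

lemma integral_product_tendsto_0:
  fixes a H :: "'a \<Rightarrow> real" and b :: "nat \<Rightarrow> 'a \<Rightarrow> real"
  assumes q: "q > 1" and a: "a \<in> borel_measurable M" and b: "\<And>k. b k \<in> borel_measurable M"
    and H: "integrable M (\<lambda>x. H x powr q)" "\<And>x. H x \<ge> 0"
    and le: "\<And>x. x \<in> space M \<Longrightarrow> \<bar>a x\<bar> \<le> C * H x powr (q - 1)" and C: "C \<ge> 0"
    and ib: "\<And>k. integrable M (\<lambda>x. \<bar>b k x\<bar> powr q)"
    and lim: "(\<lambda>k. \<integral>x. \<bar>b k x\<bar> powr q \<partial>M) \<longlonglongrightarrow> 0"
  shows "(\<lambda>k. \<integral>x. a x * b k x \<partial>M) \<longlonglongrightarrow> 0"
proof (rule LIMSEQ_I)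
  fix e :: real assume e: "e > 0"
  define I where "I = (\<integral>x. H x powr q \<partial>M)"
  have I: "I \<ge> 0" unfolding I_def by simp
  \<comment> \<open>The \<open>+ 1\<close> keeps the denominator positive when
    \<open>C * I = 0\<close>.\<close>
  define m where "m = e / (2 * (C * I + 1))"
  have CI: "C * I \<ge> 0" using C I by simp
  have m: "m > 0" using e CI by (simp add: m_def)
  have "C * (m * I) = e / 2 * (C * I / (C * I + 1))" by (simp add: m_def)
  also have "\<dots> \<le> e / 2 * 1" using e CI by (intro mult_left_mono) (auto simp: divide_le_eq)
  finally have mI: "C * (m * I) \<le> e / 2" by simp
  have "(\<lambda>k. C * (m powr (1 - q) * (\<integral>x. \<bar>b k x\<bar> powr q \<partial>M))) \<longlonglongrightarrow> C * (m powr (1 - q) * 0)"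
    by (intro tendsto_mult tendsto_const lim)
  then have "\<forall>\<^sub>F k in sequentially. C * (m powr (1 - q) * (\<integral>x. \<bar>b k x\<bar> powr q \<partial>M)) < e / 2"
    using e by (intro order_tendstoD) auto
  then obtain N where N: "\<And>k. k \<ge> N \<Longrightarrow> C * (m powr (1 - q) * (\<integral>x. \<bar>b k x\<bar> powr q \<partial>M)) < e / 2"
    by (auto simp: eventually_sequentially)
  have "norm ((\<integral>x. a x * b k x \<partial>M) - 0) < e" if "k \<ge> N" for k
  proof -
    have "\<bar>\<integral>x. a x * b k x \<partial>M\<bar> \<le> C * (m * I + m powr (1 - q) * (\<integral>x. \<bar>b k x\<bar> powr q \<partial>M))"
      unfolding I_def by (rule integral_product_weighted(2)[OF q a b H le C ib m])
    then show ?thesis using mI N[OF that] by (simp add: distrib_left)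
  qed
  then show "\<exists>N. \<forall>k\<ge>N. norm ((\<integral>x. a x * b k x \<partial>M) - 0) < e" by blast
qed

section \<open>Closure properties of \<open>Lp\<close> and local integrability\<close>

lemma Lp_diff:
  assumes "Lp \<Omega> q g" "Lp \<Omega> q h" "q \<ge> 1"
  shows "Lp \<Omega> q (\<lambda>x. g x - h x)"
proof -
  have m: "g \<in> borel_measurable (lebesgue_on \<Omega>)" "h \<in> borel_measurable (lebesgue_on \<Omega>)"
    and i: "integrable (lebesgue_on \<Omega>) (\<lambda>x. \<bar>g x\<bar> powr q)" "integrable (lebesgue_on \<Omega>) (\<lambda>x. \<bar>h x\<bar> powr q)"
    using assms by (auto simp: Lp_def)
  have "integrable (lebesgue_on \<Omega>) (\<lambda>x. \<bar>g x - h x\<bar> powr q)"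
  proof (rule integrable_dominated)
    show "integrable (lebesgue_on \<Omega>) (\<lambda>x. 2 powr q * (\<bar>g x\<bar> powr q + \<bar>h x\<bar> powr q))"
      by (rule integrable_mult_right) (rule Bochner_Integration.integrable_add[OF i])
    show "(\<lambda>x. \<bar>g x - h x\<bar> powr q) \<in> borel_measurable (lebesgue_on \<Omega>)" using m by measurable
    fix x
    have "\<bar>g x - h x\<bar> powr q \<le> (\<bar>g x\<bar> + \<bar>h x\<bar>) powr q"
      using assms(3) by (intro powr_mono2) auto
    also have "\<dots> \<le> 2 powr q * (\<bar>g x\<bar> powr q + \<bar>h x\<bar> powr q)"
      using assms(3) by (intro powr_add_le) auto
    finally show "\<bar>\<bar>g x - h x\<bar> powr q\<bar> \<le> 2 powr q * (\<bar>g x\<bar> powr q + \<bar>h x\<bar> powr q)" by simp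
  qed
  then show ?thesis using m by (simp add: Lp_def)
qed

lemma integrable_imp_loc_integrable:
  assumes \<Omega>: "\<Omega> \<in> sets lebesgue" and g: "integrable (lebesgue_on \<Omega>) g"
  shows "loc_integrable \<Omega> g"
  unfolding loc_integrable_def
proof (intro allI impI)
  fix K assume K: "compact K \<and> K \<subseteq> \<Omega>"
  have KL: "K \<in> sets lebesgue" using K by (simp add: compact_imp_closed)
  have "set_integrable lebesgue \<Omega> g"
    using g \<Omega> unfolding set_integrable_def by (subst (asm) integrable_restrict_space) auto
  then have "set_integrable lebesgue K g" by (rule set_integrable_subset[OF _ KL]) (use K in simp)
  then show "integrable (lebesgue_on K) g"
    using KL unfolding set_integrable_def by (subst integrable_restrict_space) auto
qed

context quasilinear
begin

section \<open>Strong convergence of gradients and the limit equation\<close>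

lemma test_fun_Lp:
  assumes "test_fun \<Omega> \<psi>"
  shows "Lp \<Omega> q \<psi>" "Lp \<Omega> q (partial i \<psi>)"
proof -
  obtain B where B: "B > 0" "\<And>x. \<bar>\<psi> x\<bar> \<le> B" "\<And>x. norm (grad \<psi> x) \<le> B" using test_fun_bounded[OF assms] by metis
  have B': "\<bar>partial i \<psi> x\<bar> \<le> B" for x
    using component_le_norm_cart[of "grad \<psi> x" i] B(3)[of x] by simp
  show "Lp \<Omega> q \<psi>" unfolding Lp_def
    using test_fun_measurable_M[OF assms] B q_ge
    by (auto intro!: integrable_bounded[where B = "B powr q"] powr_mono2)
  show "Lp \<Omega> q (partial i \<psi>)" unfolding Lp_def
    using test_fun_measurable_M[OF assms] B' q_ge
    by (auto intro!: integrable_bounded[where B = "B powr q"] powr_mono2)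
qed

text \<open>Members of the sequence solve different frozen problems and cannot be compared with each
  other directly. An approximate solution \<open>\<psi>\<close> of the limit problem is, by
  stability, also one for every late problem, so each late member is compared with
  \<open>\<psi>\<close>.\<close>

lemma approx_sequence_cauchy:
  assumes w: "\<And>n. admissible R (w n)" and u: "admissible R u"
    and lim: "\<And>x. x \<in> \<Omega> \<Longrightarrow> (\<lambda>n. w n x) \<longlonglongrightarrow> u x"
    and \<phi>: "\<And>n. approx_sol (w n) (t n) (\<phi> n)" and t: "t \<longlonglongrightarrow> 0" and e: "e > 0"
  shows "\<exists>N. \<forall>m\<ge>N. \<forall>n\<ge>N. (\<integral>x. norm (grad (\<phi> m) x - grad (\<phi> n) x) powr q \<partial>M) \<le> e"
proof -
  have tf: "test_fun \<Omega> (\<phi> n)" for n using \<phi>[of n] by (simp add: approx_sol_def)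
  \<comment> \<open>The \<open>q\<close>-power triangle inequality costs \<open>2 powr q\<close> and
    two distances to \<open>\<psi>\<close> are added; together they give \<open>e\<close>.\<close>
  define d where "d = e / 2 powr q / 2"
  have d: "d > 0" using e by (simp add: d_def)
  define \<theta> where "\<theta> = min (\<kappa> / 4) (\<kappa> / 4 * d)"
  have \<theta>: "0 < \<theta>" "\<theta> \<le> \<kappa> / 4" "4 * \<theta> / \<kappa> \<le> d" using kappa_pos d by (auto simp: \<theta>_def field_simps min_def)
  obtain \<psi> where \<psi>: "approx_sol u (\<theta> / 2) \<psi>" using approx_sol_exists[OF u, of "\<theta> / 2"] \<theta> by auto
  have tp: "test_fun \<Omega> \<psi>" using \<psi> by (simp add: approx_sol_def)
  have "\<forall>\<^sub>F n in sequentially. approx_sol (w n) (2 * (\<theta> / 2)) \<psi>"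
    using \<theta> by (intro approx_sol_stable[OF w u lim \<psi>]) auto
  moreover have "\<forall>\<^sub>F n in sequentially. t n < \<theta>" by (rule order_tendstoD(2)[OF t \<theta>(1)])
  ultimately have "\<forall>\<^sub>F n in sequentially. energy (\<lambda>x. \<phi> n x - \<psi> x) \<le> d"
  proof eventually_elim
    case (elim n)
    have "approx_sol (w n) \<theta> (\<phi> n)" using approx_sol_mono[OF \<phi>[of n], of \<theta>] elim(2) by simp
    moreover have "approx_sol (w n) \<theta> \<psi>" using elim(1) by simp
    ultimately have "energy (\<lambda>x. \<phi> n x - \<psi> x) \<le> 4 * \<theta> / \<kappa>"
      by (rule approx_sol_compare[OF w _ _ \<theta>(1,2)])
    then show ?case using \<theta>(3) by linarith
  qed
  then obtain N where N: "\<And>n. n \<ge> N \<Longrightarrow> energy (\<lambda>x. \<phi> n x - \<psi> x) \<le> d"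
    by (auto simp: eventually_sequentially)
  have "(\<integral>x. norm (grad (\<phi> m) x - grad (\<phi> n) x) powr q \<partial>M) \<le> e" if mn: "m \<ge> N" "n \<ge> N" for m n
  proof -
    let ?a = "\<lambda>n x. \<phi> n x - \<psi> x"
    have a: "test_fun \<Omega> (?a n)" for n by (rule test_fun_diff[OF tf tp])
    note g = grad_diff[OF tf[THEN test_fun_smooth] tp[THEN test_fun_smooth]]
    note g2 = grad_diff[OF tf[THEN test_fun_smooth] tf[THEN test_fun_smooth]]
    note iE = Bochner_Integration.integrable_add[OF integrable_energy[OF a[of m]] integrable_energy[OF a[of n]]]
    have "(\<integral>x. norm (grad (\<phi> m) x - grad (\<phi> n) x) powr q \<partial>M)
       \<le> (\<integral>x. 2 powr q * (norm (grad (?a m) x) powr q + norm (grad (?a n) x) powr q) \<partial>M)"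
    proof (rule integral_mono)
      show "integrable M (\<lambda>x. norm (grad (\<phi> m) x - grad (\<phi> n) x) powr q)"
        using integrable_energy[OF test_fun_diff[OF tf tf, of m n]] unfolding g2 .
      show "integrable M (\<lambda>x. 2 powr q * (norm (grad (?a m) x) powr q + norm (grad (?a n) x) powr q))"
        by (rule integrable_mult_right[OF iE])
      fix x
      have "norm (grad (\<phi> m) x - grad (\<phi> n) x) \<le> norm (grad (?a m) x) + norm (grad (?a n) x)"
        unfolding g using norm_triangle_ineq4[of "grad (\<phi> m) x - grad \<psi> x" "grad (\<phi> n) x - grad \<psi> x"] by simp
      then have "norm (grad (\<phi> m) x - grad (\<phi> n) x) powr q \<le> (norm (grad (?a m) x) + norm (grad (?a n) x)) powr q"
        using q_ge by (intro powr_mono2) auto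
      also have "\<dots> \<le> 2 powr q * (norm (grad (?a m) x) powr q + norm (grad (?a n) x) powr q)"
        using q_ge by (intro powr_add_le) auto
      finally show "norm (grad (\<phi> m) x - grad (\<phi> n) x) powr q
        \<le> 2 powr q * (norm (grad (?a m) x) powr q + norm (grad (?a n) x) powr q)" .
    qed
    also have "\<dots> = 2 powr q * (energy (?a m) + energy (?a n))"
      unfolding integral_mult_right_zero
        Bochner_Integration.integral_add[OF integrable_energy[OF a[of m]] integrable_energy[OF a[of n]]] energy_def ..
    also have "\<dots> \<le> 2 powr q * (d + d)" using N[OF mn(1)] N[OF mn(2)] by (intro mult_left_mono) auto
    also have "\<dots> = e" by (simp add: d_def)
    finally show ?thesis .
  qed
  then show ?thesis by blast
qed

text \<open>Along the subsequence, gradients converge almost everywhere below \<open>h\<close>, and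
  the functions are uniformly bounded. The weak derivative, membership in the closure of test
  functions and the equation then all follow from convergence theorems, for smooth
  \<open>\<psi>\<close> first.\<close>

lemma exists_solution_test:
  obtains R u G where "admissible R u" "G \<in> borel_measurable M" "integrable M (\<lambda>x. norm (G x) powr q)"
    "sobolev0 \<Omega> q u G"
    "\<And>\<psi>. test_fun \<Omega> \<psi> \<Longrightarrow> (\<integral>x. field (u x) (G x) \<bullet> grad \<psi> x - f x (u x) * \<psi> x \<partial>M) = 0"
proof -
  obtain R B w \<phi> u and t :: "nat \<Rightarrow> real" where w: "\<And>n. admissible R (w n)" and u: "admissible R u"
    and \<phi>: "\<And>n. approx_sol (w n) (t n) (\<phi> n)" and t: "\<And>n::nat. t n > 0" "t \<longlonglongrightarrow> 0"
    and wlim: "\<And>x. x \<in> \<Omega> \<Longrightarrow> (\<lambda>n. w n x) \<longlonglongrightarrow> u x"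
    and philim: "\<And>x. x \<in> \<Omega> \<Longrightarrow> (\<lambda>n. \<phi> n x) \<longlonglongrightarrow> u x" and bd: "\<And>n x. \<bar>\<phi> n x\<bar> \<le> B"
    by (rule approx_sequence, rule that)
  have tf: "test_fun \<Omega> (\<phi> n)" for n using \<phi>[of n] by (simp add: approx_sol_def)
  have q1: "q \<ge> 1" "q > 1" "q > 0" using q_ge by auto
  obtain k G h where k: "strict_mono (k :: nat \<Rightarrow> nat)" and G: "G \<in> borel_measurable M" and h: "h \<in> borel_measurable M"
    and int_h: "integrable M (\<lambda>x. h x powr q)" and dom: "AE x in M. \<forall>n. norm (grad (\<phi> (k n)) x) \<le> h x"
    and glim: "AE x in M. (\<lambda>n. grad (\<phi> (k n)) x) \<longlonglongrightarrow> G x" and Gh: "AE x in M. norm (G x) \<le> h x"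
    and l0: "(\<lambda>n. \<integral>x. norm (grad (\<phi> (k n)) x - G x) powr q \<partial>M) \<longlonglongrightarrow> 0"
    by (rule powr_cauchy_dominated_subseq[OF q1(1) test_fun_measurable_M(2)[OF tf] integrable_energy[OF tf]
        approx_sequence_cauchy[OF w u wlim \<phi> t(2)]])
  have pl: "(\<lambda>n. \<phi> (k n) x) \<longlonglongrightarrow> u x" "(\<lambda>n. w (k n) x) \<longlonglongrightarrow> u x" if "x \<in> \<Omega>" for x
    using LIMSEQ_subseq_LIMSEQ[OF philim[OF that] k] LIMSEQ_subseq_LIMSEQ[OF wlim[OF that] k]
    by (simp_all add: o_def)
  have tk: "(\<lambda>n. t (k n)) \<longlonglongrightarrow> 0" using LIMSEQ_subseq_LIMSEQ[OF t(2) k] by (simp add: o_def)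
  have um: "u \<in> borel_measurable M" and uR: "\<And>x. x \<in> \<Omega> \<Longrightarrow> \<bar>u x\<bar> \<le> R"
    using u by (auto simp: admissible_def)
  have int_G: "integrable M (\<lambda>x. norm (G x) powr q)"
  proof (rule Bochner_Integration.integrable_bound[OF int_h])
    show "(\<lambda>x. norm (G x) powr q) \<in> borel_measurable M" using G by measurable
    show "AE x in M. norm (norm (G x) powr q) \<le> norm (h x powr q)"
      using Gh by eventually_elim (use q1 in \<open>auto intro: powr_mono2\<close>)
  qed
  have Gi: "\<bar>G x $ i\<bar> \<le> norm (G x)" for x i by (rule component_le_norm_cart)
  have Gm: "(\<lambda>x. G x $ i) \<in> borel_measurable M" for i
    using measurable_compose[OF G borel_measurable_continuous_onI, of "\<lambda>y. y $ i"] by (simp add: continuous_on_component continuous_on_id)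
  have G_Lp: "Lp \<Omega> q (\<lambda>x. G x $ i)" for i
    unfolding Lp_def
  proof (intro conjI Gm integrable_dominated[OF int_G])
    show "(\<lambda>x. \<bar>G x $ i\<bar> powr q) \<in> borel_measurable M" using Gm[of i] by measurable
    show "\<bar>\<bar>G x $ i\<bar> powr q\<bar> \<le> norm (G x) powr q" for x
      using Gi[of x i] q1 by (auto intro: powr_mono2)
  qed
  have u_Lp: "Lp \<Omega> q u"
    unfolding Lp_def using um uR q1
    by (auto intro!: integrable_bounded[where B = "R powr q"] powr_mono2)
  have int_u: "integrable M u" using um uR by (rule integrable_bounded)
  have int_Gi: "integrable M (\<lambda>x. G x $ i)" for i
  proof (rule integrable_dominated[OF Bochner_Integration.integrable_add[OF integrable_const[of 1] int_G] Gm])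
    fix x
    show "\<bar>G x $ i\<bar> \<le> 1 + norm (G x) powr q"
      using Gi[of x i] powr_le_one_plus[of "norm (G x)" 1 q] q1 by simp
  qed
  \<comment> \<open>Nonnegativity of \<open>h\<close> is available only almost everywhere, so it
    joins the almost-everywhere facts used for the majorants.\<close>
  have h0: "AE x in M. h x \<ge> 0" using Gh by eventually_elim (rule order_trans[OF norm_ge_zero])
  have int_1h: "integrable M (\<lambda>x. 1 + h x powr q)"
    by (rule Bochner_Integration.integrable_add[OF integrable_const int_h])
  have weak: "weak_partial \<Omega> i u (\<lambda>x. G x $ i)" for i
    unfolding weak_partial_def
  proof (intro conjI allI impI integrable_imp_loc_integrable Omega_lebesgue int_u int_Gi)
    fix \<psi> assume \<psi>: "test_fun \<Omega> \<psi>"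
    obtain D where D: "D > 0" "\<And>x. \<bar>\<psi> x\<bar> \<le> D" "\<And>x. norm (grad \<psi> x) \<le> D" using test_fun_bounded[OF \<psi>] by metis
    have Dp: "\<bar>partial i \<psi> x\<bar> \<le> D" for x
      using component_le_norm_cart[of "grad \<psi> x" i] D(3)[of x] by simp
    have "(\<lambda>n. \<integral>x. \<phi> (k n) x * partial i \<psi> x \<partial>M) \<longlonglongrightarrow> (\<integral>x. u x * partial i \<psi> x \<partial>M)"
    proof (rule integral_dominated_convergence[where w = "\<lambda>x. B * D"])
      show "(\<lambda>x. u x * partial i \<psi> x) \<in> borel_measurable M"
        "\<And>n. (\<lambda>x. \<phi> (k n) x * partial i \<psi> x) \<in> borel_measurable M"
        using um test_fun_measurable_M[OF tf] test_fun_measurable_M[OF \<psi>] by simp_all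
      show "AE x in M. (\<lambda>n. \<phi> (k n) x * partial i \<psi> x) \<longlonglongrightarrow> u x * partial i \<psi> x"
        by (intro AE_I2 tendsto_mult tendsto_const pl) simp
      show "AE x in M. norm (\<phi> (k n) x * partial i \<psi> x) \<le> B * D" for n
        unfolding real_norm_def abs_mult using bd Dp D(1) order_trans[OF abs_ge_zero bd]
        by (intro AE_I2 mult_mono) auto
    qed simp
    moreover have "(\<lambda>n. \<integral>x. partial i (\<phi> (k n)) x * \<psi> x \<partial>M) \<longlonglongrightarrow> (\<integral>x. G x $ i * \<psi> x \<partial>M)"
    proof (rule integral_dominated_convergence[where w = "\<lambda>x. (1 + h x powr q) * D"])
      show "(\<lambda>x. G x $ i * \<psi> x) \<in> borel_measurable M"
        "\<And>n. (\<lambda>x. partial i (\<phi> (k n)) x * \<psi> x) \<in> borel_measurable M"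
        using Gm test_fun_measurable_M[OF tf] test_fun_measurable_M[OF \<psi>] by simp_all
      show "integrable M (\<lambda>x. (1 + h x powr q) * D)" by (rule integrable_mult_left[OF int_1h])
      show "AE x in M. (\<lambda>n. partial i (\<phi> (k n)) x * \<psi> x) \<longlonglongrightarrow> G x $ i * \<psi> x"
        using glim
      proof eventually_elim
        case (elim x)
        from tendsto_vec_nth[OF elim, of i] show ?case by (intro tendsto_mult tendsto_const) simp
      qed
      show "AE x in M. norm (partial i (\<phi> (k n)) x * \<psi> x) \<le> (1 + h x powr q) * D" for n
        using dom h0
      proof eventually_elim
        case (elim x)
        have "\<bar>partial i (\<phi> (k n)) x\<bar> \<le> h x"
          using component_le_norm_cart[of "grad (\<phi> (k n)) x" i] elim(1) order_trans by fastforce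
        also have "h x \<le> 1 + h x powr q" using powr_le_one_plus[of "h x" 1 q] elim(2) q1 by simp
        finally show ?case unfolding real_norm_def abs_mult using D by (intro mult_mono) auto
      qed
    qed
    moreover have "(\<integral>x. \<phi> (k n) x * partial i \<psi> x \<partial>M) = - (\<integral>x. partial i (\<phi> (k n)) x * \<psi> x \<partial>M)" for n
      by (rule test_fun_integral_by_parts[OF open_Omega tf \<psi>])
    ultimately have "(\<lambda>n. - (\<integral>x. partial i (\<phi> (k n)) x * \<psi> x \<partial>M)) \<longlonglongrightarrow> (\<integral>x. u x * partial i \<psi> x \<partial>M)"
      and "(\<lambda>n. - (\<integral>x. partial i (\<phi> (k n)) x * \<psi> x \<partial>M)) \<longlonglongrightarrow> - (\<integral>x. G x $ i * \<psi> x \<partial>M)"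
      by (simp_all add: tendsto_minus)
    then show "(\<integral>x. u x * partial i \<psi> x \<partial>M) = - (\<integral>x. G x $ i * \<psi> x \<partial>M)"
      by (rule LIMSEQ_unique)
  qed
  have sob: "sobolev0 \<Omega> q u G"
    unfolding sobolev0_def sobolev_def
  proof (intro conjI allI u_Lp G_Lp weak exI[of _ "\<lambda>n. \<phi> (k n)"] tf)
    have "(\<lambda>n. \<integral>x. \<bar>\<phi> (k n) x - u x\<bar> powr q \<partial>M) \<longlonglongrightarrow> (\<integral>x. 0 \<partial>M)"
    proof (rule integral_dominated_convergence[where w = "\<lambda>x. (B + R) powr q"])
      show "(\<lambda>x. \<bar>\<phi> (k n) x - u x\<bar> powr q) \<in> borel_measurable M" for n
        using um test_fun_measurable_M(1)[OF tf[of "k n"]] by measurable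
      show "AE x in M. (\<lambda>n. \<bar>\<phi> (k n) x - u x\<bar> powr q) \<longlonglongrightarrow> 0"
      proof (rule AE_I2)
        fix x assume "x \<in> space M"
        then have "(\<lambda>n. \<bar>\<phi> (k n) x - u x\<bar>) \<longlonglongrightarrow> 0"
          using pl(1)[of x] by (simp add: LIM_zero tendsto_rabs_zero)
        then have "(\<lambda>n. \<bar>\<phi> (k n) x - u x\<bar> powr q) \<longlonglongrightarrow> 0 powr q"
          using q1 by (intro tendsto_powr2 tendsto_const) auto
        then show "(\<lambda>n. \<bar>\<phi> (k n) x - u x\<bar> powr q) \<longlonglongrightarrow> 0" using q1 by simp
      qed
      show "AE x in M. norm (\<bar>\<phi> (k n) x - u x\<bar> powr q) \<le> (B + R) powr q" for n
      proof (rule AE_I2)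
        fix x assume "x \<in> space M"
        then have "\<bar>\<phi> (k n) x - u x\<bar> \<le> B + R" using bd[of "k n" x] uR[of x] by simp
        then show "norm (\<bar>\<phi> (k n) x - u x\<bar> powr q) \<le> (B + R) powr q" using q1 by (auto intro: powr_mono2)
      qed
    qed auto
    then show "(\<lambda>n. \<integral>x. \<bar>\<phi> (k n) x - u x\<bar> powr q \<partial>M) \<longlonglongrightarrow> 0" by simp
    fix i
    show "(\<lambda>n. \<integral>x. \<bar>partial i (\<phi> (k n)) x - G x $ i\<bar> powr q \<partial>M) \<longlonglongrightarrow> 0"
    proof (rule tendsto_sandwich[OF _ _ tendsto_const l0])
      show "\<forall>\<^sub>F n in sequentially. 0 \<le> (\<integral>x. \<bar>partial i (\<phi> (k n)) x - G x $ i\<bar> powr q \<partial>M)"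
        by (intro always_eventually allI) simp
      show "\<forall>\<^sub>F n in sequentially. (\<integral>x. \<bar>partial i (\<phi> (k n)) x - G x $ i\<bar> powr q \<partial>M)
          \<le> (\<integral>x. norm (grad (\<phi> (k n)) x - G x) powr q \<partial>M)"
      proof (intro always_eventually allI)
        fix n
        have le: "\<bar>partial i (\<phi> (k n)) x - G x $ i\<bar> powr q \<le> norm (grad (\<phi> (k n)) x - G x) powr q" for x
          using component_le_norm_cart[of "grad (\<phi> (k n)) x - G x" i] q1 by (auto intro: powr_mono2)
        have m: "(\<lambda>x. norm (grad (\<phi> (k n)) x - G x) powr q) \<in> borel_measurable M"
          using test_fun_measurable_M(2)[OF tf[of "k n"]] G by measurable
        have i: "integrable M (\<lambda>x. norm (grad (\<phi> (k n)) x - G x) powr q)"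
        proof (rule integrable_dominated[OF integrable_mult_right[OF
                Bochner_Integration.integrable_add[OF integrable_energy[OF tf[of "k n"]] int_G], of "2 powr q"] m])
          fix x
          have "norm (grad (\<phi> (k n)) x - G x) powr q \<le> (norm (grad (\<phi> (k n)) x) + norm (G x)) powr q"
            using q1 by (intro powr_mono2 norm_triangle_ineq4) auto
          also have "\<dots> \<le> 2 powr q * (norm (grad (\<phi> (k n)) x) powr q + norm (G x) powr q)"
            using q1 by (intro powr_add_le) auto
          finally show "\<bar>norm (grad (\<phi> (k n)) x - G x) powr q\<bar> \<le> 2 powr q * (norm (grad (\<phi> (k n)) x) powr q + norm (G x) powr q)"
            by simp
        qed
        have "integrable M (\<lambda>x. \<bar>partial i (\<phi> (k n)) x - G x $ i\<bar> powr q)"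
          using Lp_diff[OF test_fun_Lp(2)[OF tf] G_Lp q1(1)] by (simp add: Lp_def)
        then show "(\<integral>x. \<bar>partial i (\<phi> (k n)) x - G x $ i\<bar> powr q \<partial>M)
          \<le> (\<integral>x. norm (grad (\<phi> (k n)) x - G x) powr q \<partial>M)"
          by (rule integral_mono[OF _ i le])
      qed
    qed
  qed
  have eqn: "(\<integral>x. field (u x) (G x) \<bullet> grad \<psi> x - f x (u x) * \<psi> x \<partial>M) = 0" if \<psi>: "test_fun \<Omega> \<psi>" for \<psi>
  proof -
    obtain D where D: "D > 0" "\<And>x. \<bar>\<psi> x\<bar> \<le> D" "\<And>x. norm (grad \<psi> x) \<le> D" using test_fun_bounded[OF \<psi>] by metis
    define L where "L = CARD('n) + \<epsilon>"
    have L: "L \<ge> 0" using eps_pos by (simp add: L_def)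
    \<comment> \<open>An integrable majorant: \<open>field_bound\<close> gives the power
      \<open>q - 1\<close> of \<open>1 + h x\<close>, which is then replaced by a multiple of
      \<open>1 + h x powr q\<close>.\<close>
    let ?w = "\<lambda>x. L * (1 + 2 powr q * (1 + h x powr q)) * D + FB R * D"
    have iw: "integrable M ?w"
      by (rule Bochner_Integration.integrable_add[OF integrable_mult_left[OF integrable_mult_right[OF
            Bochner_Integration.integrable_add[OF integrable_const integrable_mult_right[OF int_1h]]]] integrable_const])
    have "(\<lambda>n. form (w (k n)) (\<phi> (k n)) \<psi>) \<longlonglongrightarrow> (\<integral>x. field (u x) (G x) \<bullet> grad \<psi> x - f x (u x) * \<psi> x \<partial>M)"
      unfolding form_def
    proof (rule integral_dominated_convergence[OF _ _ iw])
      show "(\<lambda>x. field (u x) (G x) \<bullet> grad \<psi> x - f x (u x) * \<psi> x) \<in> borel_measurable M"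
        using field_measurable[OF um G] rhs_measurable[OF u] test_fun_measurable_M[OF \<psi>] by simp
      show "(\<lambda>x. field (w (k n) x) (grad (\<phi> (k n)) x) \<bullet> grad \<psi> x - f x (w (k n) x) * \<psi> x) \<in> borel_measurable M" for n
        using field_grad_measurable[OF w tf] rhs_measurable[OF w] test_fun_measurable_M[OF \<psi>] by simp
      have "AE x in M. continuous_on UNIV (f x)" using cara by (simp add: caratheodory_def)
      then show "AE x in M. (\<lambda>n. field (w (k n) x) (grad (\<phi> (k n)) x) \<bullet> grad \<psi> x - f x (w (k n) x) * \<psi> x)
          \<longlonglongrightarrow> field (u x) (G x) \<bullet> grad \<psi> x - f x (u x) * \<psi> x"
        using glim AE_space
      proof eventually_elim
        case (elim x)
        have x: "x \<in> \<Omega>" using elim(3) by simp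
        have "(\<lambda>n. f x (w (k n) x)) \<longlonglongrightarrow> f x (u x)"
          by (rule continuous_on_tendsto_compose[OF elim(1) pl(2)[OF x]]) auto
        then show ?case
          by (intro tendsto_diff tendsto_inner tendsto_mult tendsto_const tendsto_field pl(2)[OF x] elim(2))
      qed
      show "AE x in M. norm (field (w (k n) x) (grad (\<phi> (k n)) x) \<bullet> grad \<psi> x - f x (w (k n) x) * \<psi> x) \<le> ?w x" for n
        using dom h0 AE_space
      proof eventually_elim
        case (elim x)
        have x: "x \<in> \<Omega>" using elim(3) by simp
        let ?F = "field (w (k n) x) (grad (\<phi> (k n)) x)"
        have gh: "norm (grad (\<phi> (k n)) x) \<le> h x" using elim(1) by blast
        have "norm ?F \<le> L * (1 + norm (grad (\<phi> (k n)) x)) powr (q - 1)"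
          unfolding L_def by (rule field_bound)
        also have "\<dots> \<le> L * (1 + h x) powr (q - 1)"
          using L gh q1 by (intro mult_left_mono powr_mono2) auto
        also have "\<dots> \<le> L * (1 + (1 + h x) powr q)"
          using L elim(2) q1 by (intro mult_left_mono powr_le_one_plus) auto
        also have "\<dots> \<le> L * (1 + 2 powr q * (1 + h x powr q))"
          using L elim(2) q1 powr_add_le[of 1 "h x" q] by (intro mult_left_mono) auto
        finally have F: "norm ?F \<le> L * (1 + 2 powr q * (1 + h x powr q))" .
        have "\<bar>?F \<bullet> grad \<psi> x\<bar> \<le> norm ?F * norm (grad \<psi> x)" by (rule Cauchy_Schwarz_ineq2)
        also have "\<dots> \<le> L * (1 + 2 powr q * (1 + h x powr q)) * D"
          using order_trans[OF norm_ge_zero F] by (intro mult_mono F D(3)) auto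
        finally have 1: "\<bar>?F \<bullet> grad \<psi> x\<bar> \<le> L * (1 + 2 powr q * (1 + h x powr q)) * D" .
        have 2: "\<bar>f x (w (k n) x) * \<psi> x\<bar> \<le> FB R * D"
          unfolding abs_mult using admissible_bound[OF w x, of "k n"] D FB_pos[of R] by (intro mult_mono) auto
        show ?case using 1 2 unfolding real_norm_def by linarith
      qed
    qed
    moreover have "(\<lambda>n. form (w (k n)) (\<phi> (k n)) \<psi>) \<longlonglongrightarrow> 0"
    proof (rule Lim_null_comparison)
      show "\<forall>\<^sub>F n in sequentially. norm (form (w (k n)) (\<phi> (k n)) \<psi>) \<le> t (k n) * (1 + energy \<psi>)"
        using approx_sol_abs[OF w \<phi> \<psi>] by (intro always_eventually allI) simp
      show "(\<lambda>n. t (k n) * (1 + energy \<psi>)) \<longlonglongrightarrow> 0"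
        using tendsto_mult_left_zero[OF tk] by blast
    qed
    ultimately show ?thesis by (rule LIMSEQ_unique)
  qed
  show ?thesis by (rule that[OF u G int_G sob eqn])
qed


text \<open>Extends the equation from test functions to all of the space by density: for fixed
  \<open>u\<close> and \<open>G\<close> each integral is linear in \<open>v\<close> or its gradient,
  with a coefficient of order \<open>H powr (q - 1)\<close>, hence continuous under convergence of
  \<open>q\<close>-th powers.\<close>

lemma exists_weak_solution:
  obtains u G where "u \<in> borel_measurable M" "sobolev0 \<Omega> q u G"
    "\<And>\<psi>. test_fun \<Omega> \<psi> \<Longrightarrow> (\<integral>x. field (u x) (G x) \<bullet> grad \<psi> x - f x (u x) * \<psi> x \<partial>M) = 0"
    "\<And>v Dv i. sobolev0 \<Omega> q v Dv \<Longrightarrow> integrable M (\<lambda>x. flux (p i (u x)) (G x $ i) * Dv x $ i)"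
    "\<And>v Dv. sobolev0 \<Omega> q v Dv \<Longrightarrow> integrable M (\<lambda>x. flux q (G x) \<bullet> Dv x)"
    "\<And>v Dv. sobolev0 \<Omega> q v Dv \<Longrightarrow> integrable M (\<lambda>x. f x (u x) * v x)"
    "\<And>v Dv. sobolev0 \<Omega> q v Dv \<Longrightarrow> (\<Sum>i\<in>UNIV. \<integral>x. flux (p i (u x)) (G x $ i) * Dv x $ i \<partial>M)
      + \<epsilon> * (\<integral>x. flux q (G x) \<bullet> Dv x \<partial>M) = (\<integral>x. f x (u x) * v x \<partial>M)"
proof -
  obtain R u G where u: "admissible R u" and G: "G \<in> borel_measurable M" and int_G: "integrable M (\<lambda>x. norm (G x) powr q)"
    and sob: "sobolev0 \<Omega> q u G"
    and eqn: "\<And>\<psi>. test_fun \<Omega> \<psi> \<Longrightarrow> (\<integral>x. field (u x) (G x) \<bullet> grad \<psi> x - f x (u x) * \<psi> x \<partial>M) = 0"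
    by (rule exists_solution_test, rule that)
  have q1: "q \<ge> 1" "q > 1" using q_ge by auto
  have um: "u \<in> borel_measurable M" using u by (simp add: admissible_def)
  \<comment> \<open>Since \<open>H x \<ge> 1\<close>, the smaller exponents
    \<open>p i (u x) - 1\<close> can be raised to \<open>q - 1\<close>, and the bounded right-hand
    side fits the same majorant.\<close>
  define H where "H x = 1 + norm (G x)" for x
  have H: "H x \<ge> 0" "H x \<ge> 1" for x by (auto simp: H_def)
  have int_H: "integrable M (\<lambda>x. H x powr q)"
  proof (rule integrable_dominated[OF integrable_mult_right[OF
        Bochner_Integration.integrable_add[OF integrable_const[of 1] int_G], of "2 powr q"]])
    show "(\<lambda>x. H x powr q) \<in> borel_measurable M" unfolding H_def using G by measurable
    show "\<bar>H x powr q\<bar> \<le> 2 powr q * (1 + norm (G x) powr q)" for x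
      using powr_add_le[of 1 "norm (G x)" q] q1 by (simp add: H_def)
  qed
  define a1 where "a1 i x = flux (p i (u x)) (G x $ i)" for i x
  define a2 where "a2 i x = flux q (G x) $ i" for i x
  have field_nth: "field (u x) (G x) $ i = a1 i x + \<epsilon> * a2 i x" for i x
    by (simp add: field_def a1_def a2_def)
  have Gm: "(\<lambda>x. G x $ i) \<in> borel_measurable M" for i
    using measurable_compose[OF G borel_measurable_continuous_onI, of "\<lambda>y. y $ i"]
    by (simp add: continuous_on_component continuous_on_id)
  have a1m: "a1 i \<in> borel_measurable M" for i
  proof -
    have "(\<lambda>x. p i (u x)) \<in> borel_measurable M"
      using measurable_compose[OF um borel_measurable_continuous_onI[OF p_cont[of i]]] .
    then show ?thesis unfolding a1_def flux_def using Gm[of i] by measurable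
  qed
  have a2m: "a2 i \<in> borel_measurable M" for i
    unfolding a2_def flux_def vector_scaleR_component using G Gm[of i] by measurable
  have a1b: "\<bar>a1 i x\<bar> \<le> 1 * H x powr (q - 1)" for i x
  proof -
    have "\<bar>a1 i x\<bar> = \<bar>G x $ i\<bar> powr (p i (u x) - 1)"
      using norm_flux[of "p i (u x)" "G x $ i"] by (simp add: a1_def)
    also have "\<dots> \<le> H x powr (p i (u x) - 1)"
      using p_ge[of i "u x"] component_le_norm_cart[of "G x" i] by (intro powr_mono2) (auto simp: H_def)
    also have "\<dots> \<le> H x powr (q - 1)" using p_le[of i "u x"] H by (intro powr_mono) auto
    finally show ?thesis by simp
  qed
  have a2b: "\<bar>a2 i x\<bar> \<le> 1 * H x powr (q - 1)" for i x
  proof -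
    have "\<bar>a2 i x\<bar> \<le> norm (flux q (G x))" unfolding a2_def by (rule component_le_norm_cart)
    also have "\<dots> \<le> H x powr (q - 1)" unfolding norm_flux using q1 by (intro powr_mono2) (auto simp: H_def)
    finally show ?thesis by simp
  qed
  define F where "F x = f x (u x)" for x
  have Fm: "F \<in> borel_measurable M" unfolding F_def by (rule rhs_measurable[OF u])
  have Fb: "\<bar>F x\<bar> \<le> FB R * H x powr (q - 1)" if "x \<in> space M" for x
  proof -
    have "\<bar>F x\<bar> \<le> FB R * 1" unfolding F_def using admissible_bound[OF u, of x] that by simp
    also have "\<dots> \<le> FB R * H x powr (q - 1)"
      using H[of x] q1 FB_pos[of R] by (intro mult_left_mono ge_one_powr_ge_zero) auto
    finally show ?thesis .
  qed
  have FB0: "FB R \<ge> 0" using FB_pos[of R] by simp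
  have vLp: "Lp \<Omega> q v" "Lp \<Omega> q (\<lambda>x. Dv x $ i)" if "sobolev0 \<Omega> q v Dv" for v Dv i
    using that by (auto simp: sobolev0_def sobolev_def)
  have i1: "integrable M (\<lambda>x. a1 i x * b x)" and i2: "integrable M (\<lambda>x. a2 i x * b x)"
    and i3: "integrable M (\<lambda>x. F x * b x)" if "Lp \<Omega> q b" for b i
    using that unfolding Lp_def
    by (intro integral_product_weighted(1)[OF q1(2) a1m _ int_H H(1) a1b]
        integral_product_weighted(1)[OF q1(2) a2m _ int_H H(1) a2b]
        integral_product_weighted(1)[OF q1(2) Fm _ int_H H(1) Fb FB0]; simp)+
  \<comment> \<open>The complete residual as a functional of the pair: it vanishes on test functions
    by \<open>eqn\<close> and on their limits by continuity.\<close>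
  define A where "A v Dv = (\<Sum>i\<in>UNIV. (\<integral>x. a1 i x * Dv x $ i \<partial>M) + \<epsilon> * (\<integral>x. a2 i x * Dv x $ i \<partial>M))
      - (\<integral>x. F x * v x \<partial>M)" for v :: "real^'n \<Rightarrow> real" and Dv :: "real^'n \<Rightarrow> real^'n"
  have A_test: "A \<psi> (grad \<psi>) = 0" if \<psi>: "test_fun \<Omega> \<psi>" for \<psi>
  proof -
    note I = i1[OF test_fun_Lp(2)[OF \<psi>]] i2[OF test_fun_Lp(2)[OF \<psi>]] i3[OF test_fun_Lp(1)[OF \<psi>]]
    have Is: "integrable M (\<lambda>x. a1 i x * partial i \<psi> x + \<epsilon> * (a2 i x * partial i \<psi> x))" for i
      by (rule Bochner_Integration.integrable_add[OF I(1) integrable_mult_right[OF I(2)]])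
    have "(\<integral>x. field (u x) (G x) \<bullet> grad \<psi> x - f x (u x) * \<psi> x \<partial>M)
       = (\<integral>x. (\<Sum>i\<in>UNIV. a1 i x * partial i \<psi> x + \<epsilon> * (a2 i x * partial i \<psi> x)) - F x * \<psi> x \<partial>M)"
      by (simp add: inner_vec_def field_nth F_def algebra_simps)
    also have "\<dots> = A \<psi> (grad \<psi>)"
      unfolding A_def
        Bochner_Integration.integral_diff[OF Bochner_Integration.integrable_sum[OF Is] I(3)]
        Bochner_Integration.integral_sum[OF Is] grad_nth
        Bochner_Integration.integral_add[OF I(1) integrable_mult_right[OF I(2)]] integral_mult_right_zero ..
    finally show ?thesis using eqn[OF \<psi>] by simp
  qed
  have A0: "A v Dv = 0" if v: "sobolev0 \<Omega> q v Dv" for v Dv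
  proof -
    obtain \<psi> where \<psi>: "\<And>k. test_fun \<Omega> (\<psi> k)"
      and l1: "(\<lambda>k. \<integral>x. \<bar>\<psi> k x - v x\<bar> powr q \<partial>M) \<longlonglongrightarrow> 0"
      and l2: "\<And>i. (\<lambda>k. \<integral>x. \<bar>partial i (\<psi> k) x - Dv x $ i\<bar> powr q \<partial>M) \<longlonglongrightarrow> 0"
      using v unfolding sobolev0_def by blast
    note d1 = Lp_diff[OF test_fun_Lp(1)[OF \<psi>] vLp(1)[OF v] q1(1)]
    note d2 = Lp_diff[OF test_fun_Lp(2)[OF \<psi>] vLp(2)[OF v] q1(1)]
    note dm1 = d1[unfolded Lp_def, THEN conjunct1] and di1 = d1[unfolded Lp_def, THEN conjunct2]
    note dm2 = d2[unfolded Lp_def, THEN conjunct1] and di2 = d2[unfolded Lp_def, THEN conjunct2]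
    have lim1: "(\<lambda>k. \<integral>x. a1 i x * partial i (\<psi> k) x \<partial>M) \<longlonglongrightarrow> (\<integral>x. a1 i x * Dv x $ i \<partial>M)" for i
    proof (rule LIM_zero_cancel)
      have "(\<lambda>k. \<integral>x. a1 i x * (partial i (\<psi> k) x - Dv x $ i) \<partial>M) \<longlonglongrightarrow> 0"
        by (rule integral_product_tendsto_0[OF q1(2) a1m dm2 int_H H(1) a1b _ di2 l2]) simp
      then show "(\<lambda>k. (\<integral>x. a1 i x * partial i (\<psi> k) x \<partial>M) - (\<integral>x. a1 i x * Dv x $ i \<partial>M)) \<longlonglongrightarrow> 0"
        unfolding right_diff_distrib
          Bochner_Integration.integral_diff[OF i1[OF test_fun_Lp(2)[OF \<psi>]] i1[OF vLp(2)[OF v]]] .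
    qed
    have lim2: "(\<lambda>k. \<integral>x. a2 i x * partial i (\<psi> k) x \<partial>M) \<longlonglongrightarrow> (\<integral>x. a2 i x * Dv x $ i \<partial>M)" for i
    proof (rule LIM_zero_cancel)
      have "(\<lambda>k. \<integral>x. a2 i x * (partial i (\<psi> k) x - Dv x $ i) \<partial>M) \<longlonglongrightarrow> 0"
        by (rule integral_product_tendsto_0[OF q1(2) a2m dm2 int_H H(1) a2b _ di2 l2]) simp
      then show "(\<lambda>k. (\<integral>x. a2 i x * partial i (\<psi> k) x \<partial>M) - (\<integral>x. a2 i x * Dv x $ i \<partial>M)) \<longlonglongrightarrow> 0"
        unfolding right_diff_distrib
          Bochner_Integration.integral_diff[OF i2[OF test_fun_Lp(2)[OF \<psi>]] i2[OF vLp(2)[OF v]]] .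
    qed
    have lim3: "(\<lambda>k. \<integral>x. F x * \<psi> k x \<partial>M) \<longlonglongrightarrow> (\<integral>x. F x * v x \<partial>M)"
    proof (rule LIM_zero_cancel)
      have "(\<lambda>k. \<integral>x. F x * (\<psi> k x - v x) \<partial>M) \<longlonglongrightarrow> 0"
        by (rule integral_product_tendsto_0[OF q1(2) Fm dm1 int_H H(1) Fb FB0 di1 l1])
      then show "(\<lambda>k. (\<integral>x. F x * \<psi> k x \<partial>M) - (\<integral>x. F x * v x \<partial>M)) \<longlonglongrightarrow> 0"
        unfolding right_diff_distrib
          Bochner_Integration.integral_diff[OF i3[OF test_fun_Lp(1)[OF \<psi>]] i3[OF vLp(1)[OF v]]] .
    qed
    have "(\<lambda>k. A (\<psi> k) (grad (\<psi> k))) \<longlonglongrightarrow> A v Dv"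
      unfolding A_def grad_nth
      by (rule tendsto_diff[OF tendsto_sum lim3], rule tendsto_add[OF lim1], rule tendsto_mult_left[OF lim2])
    then have "(\<lambda>k. 0 :: real) \<longlonglongrightarrow> A v Dv" unfolding A_test[OF \<psi>] .
    then show ?thesis by (simp add: LIMSEQ_const_iff)
  qed
  have i4: "integrable M (\<lambda>x. flux q (G x) \<bullet> Dv x)"
    and e4: "(\<integral>x. flux q (G x) \<bullet> Dv x \<partial>M) = (\<Sum>i\<in>UNIV. \<integral>x. a2 i x * Dv x $ i \<partial>M)"
    if v: "sobolev0 \<Omega> q v Dv" for v Dv
  proof -
    have eq: "flux q (G x) \<bullet> Dv x = (\<Sum>i\<in>UNIV. a2 i x * Dv x $ i)" for x
      by (simp add: inner_vec_def a2_def)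
    show "integrable M (\<lambda>x. flux q (G x) \<bullet> Dv x)"
      unfolding eq by (rule Bochner_Integration.integrable_sum[OF i2[OF vLp(2)[OF v]]])
    show "(\<integral>x. flux q (G x) \<bullet> Dv x \<partial>M) = (\<Sum>i\<in>UNIV. \<integral>x. a2 i x * Dv x $ i \<partial>M)"
      unfolding eq by (rule Bochner_Integration.integral_sum[OF i2[OF vLp(2)[OF v]]])
  qed
  show ?thesis
  proof (rule that[OF um sob eqn])
    fix v Dv i assume v: "sobolev0 \<Omega> q v Dv"
    show "integrable M (\<lambda>x. flux (p i (u x)) (G x $ i) * Dv x $ i)"
      using i1[OF vLp(2)[OF v]] unfolding a1_def .
    show "integrable M (\<lambda>x. flux q (G x) \<bullet> Dv x)" by (rule i4[OF v])
    show "integrable M (\<lambda>x. f x (u x) * v x)" using i3[OF vLp(1)[OF v]] unfolding F_def .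
    show "(\<Sum>i\<in>UNIV. \<integral>x. flux (p i (u x)) (G x $ i) * Dv x $ i \<partial>M)
      + \<epsilon> * (\<integral>x. flux q (G x) \<bullet> Dv x \<partial>M) = (\<integral>x. f x (u x) * v x \<partial>M)"
      using A0[OF v] unfolding e4[OF v] by (simp add: A_def a1_def F_def sum.distrib sum_distrib_left)
  qed
qed

section \<open>Non-triviality\<close>

lemma solution_nontrivial:
  assumes f0: "\<And>x. x \<in> \<Omega> \<Longrightarrow> f x 0 < 0"
    and um: "u \<in> borel_measurable M" and sob: "sobolev0 \<Omega> q u G"
    and test: "\<And>\<psi>. test_fun \<Omega> \<psi> \<Longrightarrow> (\<integral>x. field (u x) (G x) \<bullet> grad \<psi> x - f x (u x) * \<psi> x \<partial>M) = 0"
    and int: "integrable M (\<lambda>x. flux q (G x) \<bullet> G x)"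
    and eqn: "(\<Sum>i\<in>UNIV. \<integral>x. flux (p i (u x)) (G x $ i) * G x $ i \<partial>M)
      + \<epsilon> * (\<integral>x. flux q (G x) \<bullet> G x \<partial>M) = (\<integral>x. f x (u x) * u x \<partial>M)"
  shows "\<not> (AE x in M. u x = 0)"
proof
  assume u0: "AE x in M. u x = 0"
  have fu: "AE x in M. f x (u x) = f x 0" using u0 by eventually_elim simp
  have "(\<integral>x. f x (u x) * u x \<partial>M) = 0"
    by (rule integral_eq_zero_AE) (use u0 in \<open>eventually_elim, simp\<close>)
  moreover have "(\<Sum>i\<in>UNIV. \<integral>x. flux (p i (u x)) (G x $ i) * G x $ i \<partial>M) \<ge> 0"
  proof (intro sum_nonneg integral_nonneg_AE AE_I2)
    fix i x
    show "0 \<le> flux (p i (u x)) (G x $ i) * G x $ i"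
      using flux_inner_self[of "p i (u x)" "G x $ i"] by simp
  qed
  moreover have nn: "(\<integral>x. flux q (G x) \<bullet> G x \<partial>M) \<ge> 0"
    by (intro integral_nonneg_AE AE_I2) (simp add: flux_inner_self)
  ultimately have "\<epsilon> * (\<integral>x. flux q (G x) \<bullet> G x \<partial>M) \<le> 0"
    using eqn by linarith
  then have "(\<integral>x. flux q (G x) \<bullet> G x \<partial>M) = 0"
    using nn eps_pos by (simp add: mult_le_0_iff)
  then have "AE x in M. flux q (G x) \<bullet> G x = 0"
    using integral_nonneg_eq_0_iff_AE[OF int] by (simp add: flux_inner_self)
  then have G0: "AE x in M. G x = 0"
    by eventually_elim (simp add: flux_inner_self)
  obtain \<psi> a \<rho> where \<psi>: "test_fun \<Omega> \<psi>" "\<And>x. \<psi> x \<ge> 0" "\<rho> > 0" "ball a \<rho> \<subseteq> \<Omega>"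
    "\<And>x. x \<in> ball a \<rho> \<Longrightarrow> \<psi> x > 0"
    using exists_bump[OF open_Omega nonempty_Omega] by metis
  have adm: "admissible 1 (\<lambda>x. 0)" by (simp add: admissible_def)
  have i0: "integrable M (\<lambda>x. f x 0 * \<psi> x)" by (rule integrable_rhs[OF adm \<psi>(1)])
  have "AE x in M. field (u x) (G x) \<bullet> grad \<psi> x - f x (u x) * \<psi> x = - (f x 0 * \<psi> x)"
    using G0 u0 by eventually_elim (simp add: field_inner)
  then have "(\<integral>x. - (f x 0 * \<psi> x) \<partial>M) = (\<integral>x. field (u x) (G x) \<bullet> grad \<psi> x - f x (u x) * \<psi> x \<partial>M)"
  proof (intro integral_cong_AE)
    show "(\<lambda>x. - (f x 0 * \<psi> x)) \<in> borel_measurable M"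
      using i0 by simp
    \<comment> \<open>Follows from \<open>G\<close> being zero almost everywhere, by completeness of
      Lebesgue measure.\<close>
    have "(\<lambda>x. G x) \<in> borel_measurable M"
    proof (rule borel_measurable_lebesgue_on_AE[OF Omega_lebesgue])
      show "(\<lambda>x. 0) \<in> borel_measurable M" by simp
      show "AE x in M. 0 = G x" using G0 by eventually_elim simp
    qed
    then show "(\<lambda>x. field (u x) (G x) \<bullet> grad \<psi> x - f x (u x) * \<psi> x) \<in> borel_measurable M"
      using field_measurable[OF um, of G] caratheodory_measurable[OF Omega_lebesgue cara um]
        test_fun_measurable_M[OF \<psi>(1)] by simp
    show "AE x in M. - (f x 0 * \<psi> x) = field (u x) (G x) \<bullet> grad \<psi> x - f x (u x) * \<psi> x"
      if "AE x in M. field (u x) (G x) \<bullet> grad \<psi> x - f x (u x) * \<psi> x = - (f x 0 * \<psi> x)"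
      using that by eventually_elim simp
  qed
  then have z: "(\<integral>x. - (f x 0 * \<psi> x) \<partial>M) = 0" using test[OF \<psi>(1)] by simp
  have nn: "AE x in M. 0 \<le> - (f x 0 * \<psi> x)"
  proof (rule AE_I2)
    fix x assume "x \<in> space M"
    then have "f x 0 * \<psi> x \<le> 0" using f0[of x] \<psi>(2)[of x] by (intro mult_nonpos_nonneg) auto
    then show "0 \<le> - (f x 0 * \<psi> x)" by simp
  qed
  have "integrable M (\<lambda>x. - (f x 0 * \<psi> x))" using i0 by simp
  then have "AE x in M. - (f x 0 * \<psi> x) = 0"
    using integral_nonneg_eq_0_iff_AE[OF _ nn] z by blast
  \<comment> \<open>Where both \<open>f x 0\<close> and the bump are nonzero the product cannot
    vanish, so the ball would have to be a null set.\<close>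
  then have "AE x in M. x \<notin> ball a \<rho>"
    using AE_space
  proof eventually_elim
    case (elim x)
    have "f x 0 \<noteq> 0" using f0[of x] elim(2) by simp
    then have "\<psi> x = 0" using elim(1) by simp
    then show ?case using \<psi>(5)[of x] by auto
  qed
  then have "AE x in lebesgue. x \<in> \<Omega> \<longrightarrow> x \<notin> ball a \<rho>"
    by (subst (asm) AE_restrict_space_iff) simp_all
  then have "AE x in lebesgue. x \<notin> ball a \<rho>"
    by eventually_elim (use \<psi>(4) in blast)
  then have "negligible (ball a \<rho>)"
    by (simp add: AE_iff_null_sets negligible_iff_null_sets)
  then show False
    using open_not_negligible[of "ball a \<rho>"] \<psi>(3) by simp
qed

end

text \<open>For continuous exponents the essential infimum and supremum are the \<open>Inf\<close>
  and \<open>Sup\<close> of the range. The case distinction on \<open>r = 1\<close> gives the value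
  1 to the zeroth power of 0, where \<open>powr\<close> gives 0. Integrability is asserted along
  with the identity because a Bochner integral that does not exist has value 0 by
  convention.\<close>

theorem theorem3p4:
  fixes \<Omega> :: "(real^'n::finite) set"
    and p :: "'n \<Rightarrow> real \<Rightarrow> real"
    and f :: "real^'n \<Rightarrow> real \<Rightarrow> real"
    and c r \<epsilon> pminus pplus :: real
  assumes "CARD('n) \<ge> 2"
    and "bounded_lipschitz_domain \<Omega>"
    and "\<And>i. continuous_on UNIV (p i)"
    and "\<And>i t. p i t \<ge> 2"
    and "\<And>i. real CARD('n) < Inf (range (p i))"
    and "\<And>i. bdd_above (range (p i))"
    and "pminus = (MIN i. Inf (range (p i)))"
    and "pplus = (MAX i. Sup (range (p i)))"
    and "caratheodory \<Omega> f"
    and "\<And>x. x \<in> \<Omega> \<Longrightarrow> f x 0 < 0"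
    and "c > 0" and "1 \<le> r" and "r < pminus"
    and "\<And>x t. x \<in> \<Omega> \<Longrightarrow> \<bar>f x t\<bar> \<le> c * (1 + (if r = 1 then 1 else \<bar>t\<bar> powr (r - 1)))"
    and "\<epsilon> > 0"
  shows "\<exists>u Du. sobolev0 \<Omega> pplus u Du \<and> \<not> (AE x in lebesgue_on \<Omega>. u x = 0) \<and>
     (\<forall>v Dv. sobolev0 \<Omega> pplus v Dv \<longrightarrow>
        (\<forall>i. integrable (lebesgue_on \<Omega>)
               (\<lambda>x. \<bar>Du x $ i\<bar> powr (p i (u x) - 2) * Du x $ i * Dv x $ i)) \<and>
        integrable (lebesgue_on \<Omega>) (\<lambda>x. norm (Du x) powr (pplus - 2) * (Du x \<bullet> Dv x)) \<and>
        integrable (lebesgue_on \<Omega>) (\<lambda>x. f x (u x) * v x) \<and>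
        (\<Sum>i\<in>UNIV. \<integral>x. \<bar>Du x $ i\<bar> powr (p i (u x) - 2) * Du x $ i * Dv x $ i \<partial>lebesgue_on \<Omega>)
          + \<epsilon> * (\<integral>x. norm (Du x) powr (pplus - 2) * (Du x \<bullet> Dv x) \<partial>lebesgue_on \<Omega>)
          = (\<integral>x. f x (u x) * v x \<partial>lebesgue_on \<Omega>))"
proof -
  have inf_le: "Inf (range (p i)) \<le> p i t" for i t
    using assms(4) by (intro cInf_lower bdd_belowI[of _ 2]) auto
  have le_plus: "p i t \<le> pplus" for i t
  proof -
    have "p i t \<le> Sup (range (p i))" using assms(6) by (intro cSup_upper) auto
    also have "\<dots> \<le> pplus" unfolding assms(8) by (intro Max_ge) auto
    finally show ?thesis .
  qed
  have "r < pplus"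
  proof -
    have "pminus \<le> Inf (range (p undefined))" unfolding assms(7) by (intro Min_le) auto
    then show ?thesis using assms(13) inf_le[of undefined 0] le_plus[of undefined 0] by linarith
  qed
  interpret quasilinear \<Omega> p f c r \<epsilon> pplus
  proof
    show "open \<Omega>" "bounded \<Omega>" "\<Omega> \<noteq> {}" using assms(2) by (auto simp: bounded_lipschitz_domain_def)
    show "real CARD('n) < pplus"
      using assms(5)[of undefined] inf_le[of undefined 0] le_plus[of undefined 0] by linarith
    fix x and t R :: real assume x: "x \<in> \<Omega>" and R: "1 \<le> R" "\<bar>t\<bar> \<le> R"
    \<comment> \<open>For \<open>r = 1\<close> both sides are 1, as \<open>R\<close> is nonzero;
      otherwise monotonicity of powers applies.\<close>
    have "(if r = 1 then 1 else \<bar>t\<bar> powr (r - 1)) \<le> R powr (r - 1)"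
      using R assms(12) by (auto intro!: powr_mono2)
    then have "c * (1 + (if r = 1 then 1 else \<bar>t\<bar> powr (r - 1))) \<le> c * (1 + R powr (r - 1))"
      using assms(11) by (intro mult_left_mono) auto
    then show "\<bar>f x t\<bar> \<le> c * (1 + R powr (r - 1))" using assms(14)[OF x, of t] by linarith
  qed (use assms le_plus \<open>r < pplus\<close> in auto)
  obtain u G where um: "u \<in> borel_measurable M" and sob: "sobolev0 \<Omega> pplus u G"
    and test: "\<And>\<psi>. test_fun \<Omega> \<psi> \<Longrightarrow> (\<integral>x. field (u x) (G x) \<bullet> grad \<psi> x - f x (u x) * \<psi> x \<partial>M) = 0"
    and i1: "\<And>v Dv i. sobolev0 \<Omega> pplus v Dv \<Longrightarrow> integrable M (\<lambda>x. flux (p i (u x)) (G x $ i) * Dv x $ i)"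
    and i2: "\<And>v Dv. sobolev0 \<Omega> pplus v Dv \<Longrightarrow> integrable M (\<lambda>x. flux pplus (G x) \<bullet> Dv x)"
    and i3: "\<And>v Dv. sobolev0 \<Omega> pplus v Dv \<Longrightarrow> integrable M (\<lambda>x. f x (u x) * v x)"
    and eqn: "\<And>v Dv. sobolev0 \<Omega> pplus v Dv \<Longrightarrow> (\<Sum>i\<in>UNIV. \<integral>x. flux (p i (u x)) (G x $ i) * Dv x $ i \<partial>M)
      + \<epsilon> * (\<integral>x. flux pplus (G x) \<bullet> Dv x \<partial>M) = (\<integral>x. f x (u x) * v x \<partial>M)"
    by (rule exists_weak_solution, rule that)
  have nontriv: "\<not> (AE x in M. u x = 0)"
    by (rule solution_nontrivial[OF assms(10) um sob test i2[OF sob] eqn[OF sob]])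
  have fl1: "\<bar>G x $ i\<bar> powr (p i (u x) - 2) * G x $ i = flux (p i (u x)) (G x $ i)" for x i
    by (simp add: flux_def)
  have fl2: "norm (G x) powr (pplus - 2) * (G x \<bullet> y) = flux pplus (G x) \<bullet> y" for x y
    by (simp add: flux_def)
  show ?thesis
  proof (intro exI[of _ u] exI[of _ G] conjI allI impI sob nontriv)
    fix v Dv assume v: "sobolev0 \<Omega> pplus v Dv"
    show "integrable M (\<lambda>x. \<bar>G x $ i\<bar> powr (p i (u x) - 2) * G x $ i * Dv x $ i)" for i
      unfolding fl1 by (rule i1[OF v])
    show "integrable M (\<lambda>x. norm (G x) powr (pplus - 2) * (G x \<bullet> Dv x))"
      unfolding fl2 by (rule i2[OF v])
    show "integrable M (\<lambda>x. f x (u x) * v x)" by (rule i3[OF v])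
    show "(\<Sum>i\<in>UNIV. \<integral>x. \<bar>G x $ i\<bar> powr (p i (u x) - 2) * G x $ i * Dv x $ i \<partial>M)
        + \<epsilon> * (\<integral>x. norm (G x) powr (pplus - 2) * (G x \<bullet> Dv x) \<partial>M) = (\<integral>x. f x (u x) * v x \<partial>M)"
      unfolding fl1 fl2 by (rule eqn[OF v])
  qed
qed

end
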